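(* Let $L$ be a finite-dimensional left Leibniz algebra over a field of characteristic $0$, and let $R = R(L)$ be the soluble radical of $L$. Then there exists a semi-simple subalgebra $S$ of $L$ such that $S + R = L$ and $S \cap R = 0$.
   Context: A left Leibniz algebra over a field $F$ is an $F$-vector space $L$ with a bilinear product $(a,b)\mapsto ab$ such that every left multiplication operator $d_a\colon L\to L$, $d_a(x)=ax$, is a derivation, i.e. $a(bc) = (ab)c + b(ac)$ for all $a,b,c\in L$. The product is not assumed to be antisymmetric. Lie algebras are exactly the left Leibniz algebras in which $x^2 = xx = 0$ for all $x$. A subalgebra is a subspace closed under the product; an ideal is a subspace $I$ with $LI\subseteq I$ and $IL\subseteq I$. An algebra $A$ is soluble if its derived series $A^{(0)}=A$, $A^{(n+1)}=A^{(n)}A^{(n)}$ (the span of all products) reaches $0$. The soluble radical $R(L)$ is the largest soluble ideal of $L$. A (Leibniz) algebra is semi-simple if its soluble radical is $0$ (such an algebra is in particular a semi-simple Lie algebra). *)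

theory Defs
  imports Complex_Main "HOL-Library.Set_Algebras"
begin

locale left_leibniz_algebra = vector_space scale
  for scale :: "'a::field \<Rightarrow> 'b::ab_group_add \<Rightarrow> 'b" (infixr \<open>*s\<close> 75) +
  fixes mult :: "'b \<Rightarrow> 'b \<Rightarrow> 'b" (infixl \<open>\<cdot>\<close> 70)
  assumes linear_mult_right: "Vector_Spaces.linear scale scale (\<lambda>y. x \<cdot> y)"
    and linear_mult_left: "Vector_Spaces.linear scale scale (\<lambda>x. x \<cdot> y)"
    and left_leibniz: "a \<cdot> (b \<cdot> c) = (a \<cdot> b) \<cdot> c + b \<cdot> (a \<cdot> c)"
begin

definition subalgebra :: "'b set \<Rightarrow> bool"
  where "subalgebra A \<longleftrightarrow> subspace A \<and> (\<forall>x\<in>A. \<forall>y\<in>A. x \<cdot> y \<in> A)"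

text \<open>The notions below are relative to a subalgebra \<open>A\<close>, so that they apply both to the
  whole algebra (\<open>A = UNIV\<close>) and to its subalgebras, viewed as algebras in their own right.\<close>

definition ideal_of :: "'b set \<Rightarrow> 'b set \<Rightarrow> bool"
  where "ideal_of A I \<longleftrightarrow> subspace I \<and> I \<subseteq> A \<and> (\<forall>a\<in>A. \<forall>x\<in>I. a \<cdot> x \<in> I \<and> x \<cdot> a \<in> I)"

definition prod_space :: "'b set \<Rightarrow> 'b set \<Rightarrow> 'b set"
  where "prod_space A B = span {x \<cdot> y |x y. x \<in> A \<and> y \<in> B}"

primrec derived_series :: "'b set \<Rightarrow> nat \<Rightarrow> 'b set"
  where
    "derived_series A 0 = A"
  | "derived_series A (Suc n) = prod_space (derived_series A n) (derived_series A n)"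

definition soluble :: "'b set \<Rightarrow> bool"
  where "soluble A \<longleftrightarrow> (\<exists>n. derived_series A n = {0})"

text \<open>The largest element with respect to inclusion; it exists when the algebra is
  finite-dimensional, see \<open>soluble_radical_greatest\<close> below.\<close>

definition soluble_radical :: "'b set \<Rightarrow> 'b set"
  where "soluble_radical A = (GREATEST I. ideal_of A I \<and> soluble I)"

definition semi_simple :: "'b set \<Rightarrow> bool"
  where "semi_simple A \<longleftrightarrow> soluble_radical A = {0}"


lemma mult_add_right: "x \<cdot> (y + z) = x \<cdot> y + x \<cdot> z"
  using linear_mult_right[of x] by (simp add: Vector_Spaces.linear_iff)

lemma mult_add_left: "(x + y) \<cdot> z = x \<cdot> z + y \<cdot> z"
  using linear_mult_left[of z] by (simp add: Vector_Spaces.linear_iff)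

lemma mult_zero_right: "x \<cdot> 0 = 0"
  using mult_add_right[of x 0 0] by simp

lemma mult_zero_left: "0 \<cdot> x = 0"
  using mult_add_left[of 0 0 x] by simp

lemma prod_space_mono: "A \<subseteq> A' \<Longrightarrow> B \<subseteq> B' \<Longrightarrow> prod_space A B \<subseteq> prod_space A' B'"
  unfolding prod_space_def by (rule span_mono) blast

lemma derived_series_mono: "A \<subseteq> B \<Longrightarrow> derived_series A n \<subseteq> derived_series B n"
  by (induction n) (simp_all add: prod_space_mono)

lemma derived_series_add: "derived_series A (m + n) = derived_series (derived_series A m) n"
  by (induction n) auto

lemma subspace_derived_series: "subspace A \<Longrightarrow> subspace (derived_series A n)"
  by (cases n) (auto simp: prod_space_def)

lemma subspace_plus: "subspace I \<Longrightarrow> subspace J \<Longrightarrow> subspace (I + J)"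
proof -
  assume "subspace I" "subspace J"
  then have "subspace {x + y |x y. x \<in> I \<and> y \<in> J}" by (rule subspace_sums)
  moreover have "{x + y |x y. x \<in> I \<and> y \<in> J} = I + J" by (auto simp: set_plus_def)
  ultimately show ?thesis by simp
qed

lemma Un_subset_plus: "subspace I \<Longrightarrow> subspace J \<Longrightarrow> I \<union> J \<subseteq> I + J"
  using set_plus_intro[of _ I 0 J] set_plus_intro[of 0 I _ J] subspace_0 by auto

lemma derived_series_subset:
  assumes "ideal_of A I"
  shows "derived_series I n \<subseteq> I"
proof (induction n)
  case (Suc n)
  have "x \<cdot> y \<in> I" if "x \<in> derived_series I n" "y \<in> derived_series I n" for x y
    using that Suc.IH assms unfolding ideal_of_def by blast
  then have "{x \<cdot> y |x y. x \<in> derived_series I n \<and> y \<in> derived_series I n} \<subseteq> I" by blast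
  moreover have "subspace I" using assms by (simp add: ideal_of_def)
  ultimately show ?case by (simp add: prod_space_def span_minimal)
qed simp

lemma derived_series_plus:
  assumes "ideal_of A I" "ideal_of A J"
  shows "derived_series (I + J) n \<subseteq> derived_series I n + J"
proof (induction n)
  case 0
  show ?case by simp
next
  case (Suc n)
  have sI: "subspace I" and sJ: "subspace J" using assms by (auto simp: ideal_of_def)
  have IA: "derived_series I n \<subseteq> A"
    using derived_series_subset[OF assms(1)] assms(1) by (auto simp: ideal_of_def)
  have sP: "subspace (derived_series I (Suc n) + J)"
    by (intro subspace_plus subspace_derived_series sI sJ)
  have "x \<cdot> y \<in> derived_series I (Suc n) + J"
    if x: "x \<in> derived_series I n + J" and y: "y \<in> derived_series I n + J" for x y
  proof -
    obtain a j where a: "x = a + j" "a \<in> derived_series I n" "j \<in> J"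
      using x by (rule set_plus_elim)
    obtain b k where b: "y = b + k" "b \<in> derived_series I n" "k \<in> J"
      using y by (rule set_plus_elim)
    have ab: "a \<cdot> b \<in> derived_series I (Suc n)"
      using a b by (auto simp: prod_space_def intro: span_base)
    have aA: "a \<in> A" "b \<in> A" "j \<in> A" "k \<in> A"
      using a b IA assms(2) by (auto simp: ideal_of_def)
    have "a \<cdot> k + j \<cdot> b + j \<cdot> k \<in> J"
      using aA a b assms(2) sJ unfolding ideal_of_def by (intro subspace_add) auto
    moreover have "x \<cdot> y = a \<cdot> b + (a \<cdot> k + j \<cdot> b + j \<cdot> k)"
      by (simp add: a b mult_add_left mult_add_right algebra_simps)
    ultimately show ?thesis using ab by (metis set_plus_intro)
  qed
  then have "derived_series (I + J) (Suc n) \<subseteq> derived_series I (Suc n) + J"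
    unfolding derived_series.simps(2)[of "I + J"] prod_space_def[of "derived_series (I + J) n"]
    using Suc.IH sP by (intro span_minimal subsetI) (auto simp: subset_iff)
  then show ?case .
qed

lemma soluble_ideal_plus:
  assumes "ideal_of A I" "soluble I" "ideal_of A J" "soluble J"
    and A: "subspace A"
  shows "ideal_of A (I + J) \<and> soluble (I + J)"
proof
  show "ideal_of A (I + J)"
    unfolding ideal_of_def
  proof (intro conjI ballI)
    show "subspace (I + J)"
      using assms by (auto simp: ideal_of_def intro: subspace_plus)
    show "I + J \<subseteq> A"
    proof
      fix z assume "z \<in> I + J"
      then obtain x y where "z = x + y" "x \<in> I" "y \<in> J" by (rule set_plus_elim)
      with assms show "z \<in> A" by (auto simp: ideal_of_def intro!: subspace_add)
    qed
    fix a z assume a: "a \<in> A" and "z \<in> I + J"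
    from \<open>z \<in> I + J\<close> obtain x y where z: "z = x + y" "x \<in> I" "y \<in> J"
      by (rule set_plus_elim)
    show "a \<cdot> z \<in> I + J"
      using assms a z unfolding ideal_of_def z(1) mult_add_right by (intro set_plus_intro) auto
    show "z \<cdot> a \<in> I + J"
      using assms a z unfolding ideal_of_def z(1) mult_add_left by (intro set_plus_intro) auto
  qed
  have s: "subspace (I + J)"
    using assms by (auto simp: ideal_of_def intro: subspace_plus)
  obtain m n where m: "derived_series I m = {0}" and n: "derived_series J n = {0}"
    using assms by (auto simp: soluble_def)
  have "derived_series (I + J) m \<subseteq> J"
    using derived_series_plus[OF assms(1,3), of m] m by (auto simp: set_plus_def)
  then have "derived_series (I + J) (m + n) \<subseteq> {0}"
    unfolding derived_series_add using derived_series_mono n by metis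
  then show "soluble (I + J)"
    unfolding soluble_def using subspace_0[OF subspace_derived_series[OF s]] by blast
qed

lemma soluble_radical_greatest:
  assumes fin: "finite_dimensional_vector_space scale B" and A: "subalgebra A"
  shows "ideal_of A (soluble_radical A)" "soluble (soluble_radical A)"
    and "\<And>I. ideal_of A I \<Longrightarrow> soluble I \<Longrightarrow> I \<subseteq> soluble_radical A"
proof -
  interpret fd: finite_dimensional_vector_space scale B by (rule fin)
  let ?P = "\<lambda>I. ideal_of A I \<and> soluble I"
  have sA: "subspace A" using A by (simp add: subalgebra_def)
  have P0: "?P {0}"
    using subspace_0[OF sA]
    by (auto simp: ideal_of_def mult_zero_left mult_zero_right soluble_def
        intro!: exI[of _ "0::nat"])
  have bound: "\<forall>I. ?P I \<longrightarrow> dim I < Suc fd.dimension"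
    by (intro allI impI le_imp_less_Suc fd.dim_subset_UNIV)
  obtain R where R: "?P R" and max: "\<And>I. ?P I \<Longrightarrow> dim I \<le> dim R"
    using ex_has_greatest_nat[of ?P "{0}" dim "Suc fd.dimension", OF P0 bound] by auto
  have le: "I \<subseteq> R" if I: "?P I" for I
  proof -
    have s: "subspace I" "subspace R" using I R by (auto simp: ideal_of_def)
    have "?P (I + R)" using I R sA by (intro soluble_ideal_plus) auto
    then have "dim (I + R) \<le> dim R" by (rule max)
    moreover have "R \<subseteq> I + R" "I \<subseteq> I + R" using Un_subset_plus[OF s] by auto
    ultimately have "R = I + R"
      by (intro fd.subspace_dim_equal subspace_plus s)
    then show ?thesis using \<open>I \<subseteq> I + R\<close> by simp
  qed
  have eq: "soluble_radical A = R"
    unfolding soluble_radical_def using R le by (intro Greatest_equality) auto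
  show "ideal_of A (soluble_radical A)" "soluble (soluble_radical A)"
    using R eq by auto
  show "\<And>I. ideal_of A I \<Longrightarrow> soluble I \<Longrightarrow> I \<subseteq> soluble_radical A"
    using le eq by auto
qed

end

end

theory Submission
  imports Defs "HOL-Library.Function_Algebras" "HOL-Algebra.Algebraic_Closure_Type"
begin

text \<open>Write \<open>R\<close> for the radical. Cartan's criterion (proved over the algebraic closure, and finished by
  Engel's theorem) makes the Killing form of \<open>L / R\<close> non-degenerate on every ideal, so every ideal of
  \<open>L / R\<close> is perfect. Perfectness of all ideals in turn gives Whitehead's first lemma by means of
  Casimir operators. The complement of \<open>R\<close> is found by induction along a chain of ideals: for an
  abelian minimal ideal \<open>I\<close>, the lemma is applied to the module of linear maps into \<open>I\<close>.\<close>

section \<open>Linear algebra\<close>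

text \<open>Left multiplications satisfy \<open>(x \<cdot> y) \<cdot> z = x \<cdot> (y \<cdot> z) -
  y \<cdot> (x \<cdot> z)\<close>, so they form a representation by commutators although the product
  is not antisymmetric. Everything built on left actions alone (trace forms, Cartan, Casimir,
  Whitehead) therefore runs as for Lie algebras. Right multiplication has to be handled in ideals
  and in the last splitting step, where the Lie argument forks into two cases. A quotient has no
  type of its own. Statements carry a pair such as \<open>P \<subseteq> U\<close> standing for U /
  P, and equality in the quotient becomes membership in \<open>P\<close>. Likewise A / I is
  \<open>A\<close> together with the ideal \<open>I\<close>, and all subalgebras stay sets in one
  ambient algebra, so that the induction can change both. The ground field need not be algebraically
  closed, yet algebra and modules are never extended: only matrices are mapped to the closure,
  inside one lemma. There, functionals with rational values supply the positivity that the closure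
  lacks.\<close>

context vector_space
begin

lemma linear_functional_zero: "Vector_Spaces.linear scale (*) f \<Longrightarrow> f 0 = 0"
  using module_hom.zero[of scale "(*)" f] by (simp add: module_hom_iff_linear)

lemma linear_functional_add: "Vector_Spaces.linear scale (*) f \<Longrightarrow> f (x + y) = f x + f y"
  by (simp add: Vector_Spaces.linear_iff)

lemma linear_functional_diff: "Vector_Spaces.linear scale (*) f \<Longrightarrow> f (x - y) = f x - f y"
  using module_hom.diff[of scale "(*)" f] by (simp add: module_hom_iff_linear)

lemma linear_functional_scale: "Vector_Spaces.linear scale (*) f \<Longrightarrow> f (scale c x) = c * f x"
  by (simp add: Vector_Spaces.linear_iff)

lemma linear_functional_sum: "Vector_Spaces.linear scale (*) f \<Longrightarrow> f (sum g S) = (\<Sum>i\<in>S. f (g i))"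
  using module_hom.sum[of scale "(*)" f] by (simp add: module_hom_iff_linear)

lemmas linear_functional_simps = linear_functional_zero linear_functional_add
  linear_functional_diff linear_functional_scale linear_functional_sum

lemma functional_of_independent:
  assumes "independent B"
  obtains g where "Vector_Spaces.linear scale (*) g" "\<And>x. x \<in> B \<Longrightarrow> g x = f x"
proof -
  interpret vector_space_pair scale "(*)" by unfold_locales (auto simp: algebra_simps)
  show ?thesis using linear_independent_extend[OF assms, of f] that by blast
qed

text \<open>Spaces of functions such as \<open>linear_maps\<close> sit in a type that may be
  infinite-dimensional. A finite spanning set of \<open>V\<close> takes the place of finite
  dimension of the type.\<close>

lemma dim_psubset_in_finite_span:
  assumes "subspace U" "U \<subset> V" "V \<subseteq> span F" "finite F"
  shows "dim U < dim V"
proof -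
  obtain B where B: "B \<subseteq> U" "independent B" "U \<subseteq> span B"
    using maximal_independent_subset by blast
  obtain C where C: "B \<subseteq> C" "C \<subseteq> V" "independent C" "V \<subseteq> span C"
    using maximal_independent_subset_extend[of B V] B assms by blast
  have "finite C" using independent_span_bound[of F C] C assms by blast
  moreover have "B \<noteq> C"
    using span_minimal[OF B(1) assms(1)] C(4) assms(2) by blast
  ultimately have "card B < card C" using C(1) by (intro psubset_card_mono) auto
  then show ?thesis using basis_card_eq_dim B C by metis
qed

text \<open>Quotients are never formed: this is a basis of \<open>U / P\<close> lifted to \<open>U\<close>, together with the
  dual basis.\<close>

definition coordinates_modulo :: "'b set \<Rightarrow> 'b set \<Rightarrow> nat \<Rightarrow> (nat \<Rightarrow> 'b) \<Rightarrow> (nat \<Rightarrow> 'b \<Rightarrow> 'a) \<Rightarrow> bool" where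
  "coordinates_modulo P U n b co \<longleftrightarrow>
    (\<forall>i<n. b i \<in> U) \<and> (\<forall>i. Vector_Spaces.linear scale (*) (co i)) \<and> (\<forall>i<n. \<forall>p\<in>P. co i p = 0) \<and>
    (\<forall>i<n. \<forall>j<n. co i (b j) = (if i = j then 1 else 0)) \<and>
    (\<forall>u\<in>U. u - (\<Sum>i<n. scale (co i u) (b i)) \<in> P)"

lemma coordinates_moduloD:
  assumes "local.coordinates_modulo P U n b co"
  shows "i < n \<Longrightarrow> b i \<in> U" "Vector_Spaces.linear scale (*) (co i)"
    "i < n \<Longrightarrow> p \<in> P \<Longrightarrow> co i p = 0"
    "i < n \<Longrightarrow> j < n \<Longrightarrow> co i (b j) = (if i = j then 1 else 0)"
    "u \<in> U \<Longrightarrow> u - (\<Sum>i<n. scale (co i u) (b i)) \<in> P"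
  using assms by (auto simp: local.coordinates_modulo_def)

text \<open>A basis \<open>B\<close> of \<open>P\<close> is extended to a basis \<open>C\<close> of
  \<open>U\<close>; the vectors of \<open>C - B\<close> give a basis of U / P, and their dual
  functionals vanish on \<open>B\<close>.\<close>

lemma coordinates_modulo_exists:
  assumes "subspace P" "subspace U" "P \<subseteq> U" "U \<subseteq> span F" "finite F"
  obtains n b co where "local.coordinates_modulo P U n b co"
proof -
  obtain B where B: "B \<subseteq> P" "independent B" "P \<subseteq> span B"
    using maximal_independent_subset by blast
  obtain C where C: "B \<subseteq> C" "C \<subseteq> U" "independent C" "U \<subseteq> span C"
    using maximal_independent_subset_extend[of B U] B assms by blast
  have fin: "finite C" using independent_span_bound[of F C] C assms by blast
  obtain b where "bij_betw b {0..<card (C - B)} (C - B)"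
    using ex_bij_betw_nat_finite[of "C - B"] fin by auto
  then have b: "bij_betw b {..<card (C - B)} (C - B)" by (simp add: lessThan_atLeast0)
  let ?n = "card (C - B)"
  have "\<exists>g. Vector_Spaces.linear scale (*) g \<and> (\<forall>x\<in>C. g x = (if x = b i then 1 else 0))" for i
    by (rule functional_of_independent[OF C(3), of "\<lambda>x. if x = b i then 1 else 0"]) blast
  then obtain co where co: "\<And>i. Vector_Spaces.linear scale (*) (co i)"
    "\<And>i x. x \<in> C \<Longrightarrow> co i x = (if x = b i then 1 else 0)"
    by metis
  have bC: "b i \<in> C" "b i \<notin> B" if "i < ?n" for i
    using b that by (auto simp: bij_betw_def)
  have delta: "co i (b j) = (if i = j then 1 else 0)" if "i < ?n" "j < ?n" for i j
    using that co(2)[OF bC(1)[OF that(2)], of i] b by (auto simp: bij_betw_def inj_on_def)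
  have coP: "co i p = 0" if "i < ?n" "p \<in> P" for i p
  proof -
    have "p \<in> span B" using that B by blast
    then show ?thesis
    proof (induction rule: span_induct_alt)
      case (step c x y)
      moreover have "co i x = 0"
        using step co(2)[of x i] bC[OF that(1)] C(1) by (auto split: if_splits)
      ultimately show ?case
        by (auto simp: linear_functional_simps[OF co(1)])
    qed (simp add: linear_functional_simps[OF co(1)])
  qed
  have rest: "u - (\<Sum>i<?n. scale (co i u) (b i)) \<in> P" if "u \<in> U" for u
  proof -
    have "u \<in> span C" using that C by blast
    then show ?thesis
    proof (induction rule: span_induct_alt)
      case base
      then show ?case using assms(1) by (simp add: linear_functional_simps[OF co(1)] subspace_0)
    next
      case (step c x y)
      have "x - (\<Sum>i<?n. scale (co i x) (b i)) \<in> P"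
      proof (cases "x \<in> B")
        case True
        then have "\<And>i. i < ?n \<Longrightarrow> co i x = 0" using coP B by blast
        then show ?thesis using True B by auto
      next
        case False
        then obtain j where j: "j < ?n" "x = b j"
          using b step by (auto simp: bij_betw_def image_iff)
        then have "(\<Sum>i<?n. scale (co i x) (b i)) = (\<Sum>i<?n. if i = j then x else 0)"
          by (intro sum.cong) (auto simp: delta)
        then show ?thesis using j assms(1) by (simp add: subspace_0)
      qed
      then have "scale c (x - (\<Sum>i<?n. scale (co i x) (b i))) + (y - (\<Sum>i<?n. scale (co i y) (b i))) \<in> P"
        using step assms(1) by (intro subspace_add subspace_scale) auto
      then show ?case
        by (simp add: linear_functional_simps[OF co(1)] scale_left_distrib scale_right_diff_distrib
            sum.distrib scale_sum_right algebra_simps)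
    qed
  qed
  show ?thesis
    by (rule that[of ?n b co]) (use bC C co delta coP rest in \<open>auto simp: local.coordinates_modulo_def\<close>)
qed

text \<open>A member of largest dimension is maximal for inclusion. This supplies maximal
  subalgebras, submodules and ideals, hence irreducible quotients.\<close>

lemma maximal_subspace:
  assumes "Q S0" and Q: "\<And>S. Q S \<Longrightarrow> subspace S \<and> S \<subseteq> span F" and F: "finite F"
  shows "\<exists>S. Q S \<and> (\<forall>T. Q T \<longrightarrow> S \<subseteq> T \<longrightarrow> T = S)"
proof -
  have "dim S \<le> card F" if "Q S" for S using dim_le_card Q[OF that] F by blast
  then obtain S where S: "Q S" "\<And>T. Q T \<Longrightarrow> dim T \<le> dim S"
    using ex_has_greatest_nat[of Q S0 dim "Suc (card F)"] assms(1) by (auto simp: less_Suc_eq_le)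
  have "T = S" if "Q T" "S \<subseteq> T" for T
    using dim_psubset_in_finite_span[of S T F] S(2)[OF that(1)] Q[OF S(1)] Q[OF that(1)] F that(2)
    by (metis leD psubsetI)
  then show ?thesis using S(1) by blast
qed

text \<open>Linearity of \<open>\<beta>\<close> in its first argument turns a combination of
  functionals \<open>\<beta> z\<close> into a single \<open>\<beta> w\<close>. What remains is that
  common kernels determine spans, proved by removing one \<open>z\<close> at a time while
  \<open>f\<close> changes.\<close>

lemma functional_in_span_of_kernels:
  fixes \<beta> :: "'b \<Rightarrow> 'b \<Rightarrow> 'a"
  assumes K: "subspace K"
    and add1: "\<And>x y z. x \<in> K \<Longrightarrow> y \<in> K \<Longrightarrow> z \<in> K \<Longrightarrow> \<beta> (x + y) z = \<beta> x z + \<beta> y z"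
    and sc1: "\<And>c x z. x \<in> K \<Longrightarrow> z \<in> K \<Longrightarrow> \<beta> (scale c x) z = c * \<beta> x z"
    and add2: "\<And>x y z. x \<in> K \<Longrightarrow> y \<in> K \<Longrightarrow> z \<in> K \<Longrightarrow> \<beta> z (x + y) = \<beta> z x + \<beta> z y"
    and sc2: "\<And>c x z. x \<in> K \<Longrightarrow> z \<in> K \<Longrightarrow> \<beta> z (scale c x) = c * \<beta> z x"
    and "finite Z" "Z \<subseteq> K"
    and "\<And>x y. x \<in> K \<Longrightarrow> y \<in> K \<Longrightarrow> f (x + y) = f x + f y"
    and "\<And>c x. x \<in> K \<Longrightarrow> f (scale c x) = c * f x"
    and "\<And>x. x \<in> K \<Longrightarrow> (\<And>z. z \<in> Z \<Longrightarrow> \<beta> z x = 0) \<Longrightarrow> f x = 0"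
  shows "\<exists>z\<in>K. \<forall>x\<in>K. f x = \<beta> z x"
  using assms(6-)
proof (induction Z arbitrary: f rule: finite_induct)
  case empty
  then show ?case using sc1[of 0 _ 0] subspace_0[OF K] by (intro bexI[of _ 0]) auto
next
  case (insert z Z)
  have zK: "z \<in> K" and ZK: "Z \<subseteq> K" using insert by auto
  show ?case
  proof (cases "\<exists>x\<in>K. (\<forall>y\<in>Z. \<beta> y x = 0) \<and> \<beta> z x \<noteq> 0")
    case False
    show ?thesis
    proof (rule insert.IH)
      show "f x = 0" if "x \<in> K" "\<And>y. y \<in> Z \<Longrightarrow> \<beta> y x = 0" for x
        using that False insert.prems(4)[of x] by blast
    qed (use insert.prems ZK in auto)
  next
    case True
    then obtain x1 where x1: "x1 \<in> K" "\<And>y. y \<in> Z \<Longrightarrow> \<beta> y x1 = 0" "\<beta> z x1 \<noteq> 0" by blast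
    \<comment> \<open>A vector dual to \<open>z\<close>: killed by \<open>Z\<close> and of value 1
      under \<open>\<beta> z\<close>. Subtracting \<open>f x0\<close> times \<open>\<beta> z\<close>
      from \<open>f\<close> removes the dependence on \<open>z\<close>.\<close>
    define x0 where "x0 = scale (1 / \<beta> z x1) x1"
    have x0: "x0 \<in> K" "\<And>y. y \<in> Z \<Longrightarrow> \<beta> y x0 = 0" "\<beta> z x0 = 1"
      using x1 zK ZK K by (auto simp: x0_def sc2 subspace_scale subsetD)
    define g where "g x = f x - f x0 * \<beta> z x" for x
    have "\<exists>w\<in>K. \<forall>x\<in>K. g x = \<beta> w x"
    proof (rule insert.IH)
      show "g x = 0" if x: "x \<in> K" "\<And>y. y \<in> Z \<Longrightarrow> \<beta> y x = 0" for x
      proof -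
        define u where "u = x + scale (- \<beta> z x) x0"
        have sK: "scale (- \<beta> z x) x0 \<in> K" by (rule subspace_scale[OF K x0(1)])
        have uK: "u \<in> K" unfolding u_def by (rule subspace_add[OF K x(1) sK])
        have "\<beta> y u = 0" if "y \<in> insert z Z" for y
        proof -
          have yK: "y \<in> K" using that insert.prems by blast
          show ?thesis unfolding u_def add2[OF x(1) sK yK] sc2[OF x0(1) yK]
            using that x x0 by auto
        qed
        then have "f u = 0" using insert.prems(4)[OF uK] by blast
        then show ?thesis
          unfolding u_def g_def insert.prems(2)[OF x(1) sK] insert.prems(3)[OF x0(1)]
          by simp
      qed
    qed (use ZK insert.prems zK in \<open>auto simp: g_def add2 sc2 algebra_simps\<close>)
    then obtain w where w: "w \<in> K" "\<And>x. x \<in> K \<Longrightarrow> g x = \<beta> w x" by blast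
    have sK: "scale (f x0) z \<in> K" using zK K by (simp add: subspace_scale)
    have "f x = \<beta> (w + scale (f x0) z) x" if "x \<in> K" for x
      using w(2)[OF that] unfolding add1[OF w(1) sK that] sc1[OF zK that] g_def
      by (metis diff_add_cancel)
    then show ?thesis using w sK K by (intro bexI[of _ "w + scale (f x0) z"]) (auto simp: subspace_add)
  qed
qed

text \<open>Riesz representation for a form that may be degenerate, where a functional has to kill
  the radical. Orthogonality to a basis of \<open>K\<close> is already orthogonality to
  \<open>K\<close>. This yields the dual family of the Casimir operator.\<close>

lemma functional_represented:
  fixes \<beta> :: "'b \<Rightarrow> 'b \<Rightarrow> 'a"
  assumes K: "subspace K" "K \<subseteq> span F" "finite F"
    and add1: "\<And>x y z. x \<in> K \<Longrightarrow> y \<in> K \<Longrightarrow> z \<in> K \<Longrightarrow> \<beta> (x + y) z = \<beta> x z + \<beta> y z"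
    and sc1: "\<And>c x z. x \<in> K \<Longrightarrow> z \<in> K \<Longrightarrow> \<beta> (scale c x) z = c * \<beta> x z"
    and add2: "\<And>x y z. x \<in> K \<Longrightarrow> y \<in> K \<Longrightarrow> z \<in> K \<Longrightarrow> \<beta> z (x + y) = \<beta> z x + \<beta> z y"
    and sc2: "\<And>c x z. x \<in> K \<Longrightarrow> z \<in> K \<Longrightarrow> \<beta> z (scale c x) = c * \<beta> z x"
    and f: "Vector_Spaces.linear scale (*) f"
    and rad: "\<And>x. x \<in> K \<Longrightarrow> (\<And>z. z \<in> K \<Longrightarrow> \<beta> z x = 0) \<Longrightarrow> f x = 0"
  shows "\<exists>z\<in>K. \<forall>x\<in>K. f x = \<beta> z x"
proof -
  obtain B where B: "B \<subseteq> K" "independent B" "K \<subseteq> span B"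
    using maximal_independent_subset by blast
  have fin: "finite B" using independent_span_bound[of F B] B K by blast
  show ?thesis
  proof (rule functional_in_span_of_kernels[where Z = B])
    show "f x = 0" if x: "x \<in> K" "\<And>z. z \<in> B \<Longrightarrow> \<beta> z x = 0" for x
    proof (rule rad[OF x(1)])
      fix z assume "z \<in> K"
      then have "z \<in> span B" using B by blast
      then have "z \<in> K \<and> \<beta> z x = 0"
      proof (induction rule: span_induct_alt)
        case base
        then show ?case using sc1[of 0 x 0] subspace_0[OF K(1)] x(1) by auto
      next
        case (step c y w)
        then show ?case using x B K(1)
          by (auto simp: add1 sc1 subspace_add subspace_scale subsetD)
      qed
      then show "\<beta> z x = 0" ..
    qed
  qed (use assms fin B in \<open>auto simp: linear_functional_simps[OF f]\<close>)
qed

text \<open>Meant for the iterates of an operator on one vector, where it gives an annihilating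
  polynomial. The family is indexed and may repeat a vector, but \<open>dependent\<close> sees only
  sets; hence the case split.\<close>

lemma linear_relation_of_bounded_family:
  fixes w :: "nat \<Rightarrow> 'b"
  assumes "\<And>i. w i \<in> span F" "finite F"
  shows "\<exists>c. (\<exists>i\<le>card F. c i \<noteq> 0) \<and> (\<Sum>i\<le>card F. scale (c i) (w i)) = 0"
proof (cases "inj_on w {..card F}")
  case False
  then obtain i j where ij: "i \<le> card F" "j \<le> card F" "i \<noteq> j" "w i = w j"
    by (auto simp: inj_on_def)
  define c where "c k = (if k = i then 1 else 0) - (if k = j then 1 else (0::'a))" for k
  have "(\<Sum>k\<le>card F. scale (c k) (w k))
      = (\<Sum>k\<le>card F. if k = i then w i else 0) - (\<Sum>k\<le>card F. if k = j then w j else 0)"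
    unfolding sum_subtractf[symmetric] by (intro sum.cong) (auto simp: c_def)
  also have "\<dots> = 0" using ij by simp
  finally show ?thesis using ij by (intro exI[of _ c]) (auto simp: c_def intro!: exI[of _ i])
next
  case True
  let ?S = "w ` {..card F}"
  have "card ?S = Suc (card F)" using True by (simp add: card_image)
  then have "dependent ?S"
    using independent_span_bound[of F ?S] assms by auto
  then obtain u where u: "\<exists>v\<in>?S. u v \<noteq> 0" "(\<Sum>v\<in>?S. scale (u v) v) = 0"
    by (auto simp: dependent_finite)
  then show ?thesis using True
    by (intro exI[of _ "u \<circ> w"]) (auto simp: sum.reindex)
qed

end

section \<open>Triangularisation\<close>

locale triangular_family = vector_space scale
  for scale :: "'k::alg_closed_field \<Rightarrow> 'v::ab_group_add \<Rightarrow> 'v" (infixr \<open>*s\<close> 75) +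
  fixes T :: "'v \<Rightarrow> 'v" and V F :: "'v set"
  assumes T: "Vector_Spaces.linear scale scale T"
    and V: "subspace V" "\<And>v. v \<in> V \<Longrightarrow> T v \<in> V" "V \<subseteq> span F" "finite F"
begin

lemma T_simps: "T 0 = 0" "T (x + y) = T x + T y" "T (x - y) = T x - T y" "T (c *s x) = c *s T x"
  "T (sum g S) = (\<Sum>i\<in>S. T (g i))"
proof -
  interpret T: module_hom scale scale T using T by (simp add: module_hom_iff_linear)
  show "T 0 = 0" "T (x + y) = T x + T y" "T (x - y) = T x - T y" "T (c *s x) = c *s T x"
    "T (sum g S) = (\<Sum>i\<in>S. T (g i))"
    by (rule T.zero T.add T.diff T.scale T.sum)+
qed

text \<open>The remainder of \<open>T (b i)\<close> may involve only earlier vectors with the same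
  eigenvalue \<open>a i\<close>. This separates the generalised eigenspaces without forming them,
  and no normal form inside them is sought.\<close>

definition triangular :: "(nat \<Rightarrow> 'v) \<Rightarrow> (nat \<Rightarrow> 'k) \<Rightarrow> nat \<Rightarrow> bool" where
  "triangular b a n \<longleftrightarrow> (\<forall>i<n. b i \<in> V \<and> b i \<notin> span (b ` {..<i})
    \<and> T (b i) - a i *s b i \<in> span (b ` {j. j < i \<and> a j = a i}))"

lemma triangular_independent:
  assumes "triangular b a n"
  shows "m \<le> n \<Longrightarrow> independent (b ` {..<m}) \<and> inj_on b {..<m}"
proof (induction m)
  case (Suc m)
  then have "b m \<notin> span (b ` {..<m})" using assms by (auto simp: triangular_def)
  then show ?case using Suc
    by (auto simp: lessThan_Suc independent_insert span_base)
qed (simp add: independent_empty)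

lemma triangular_bound: "triangular b a n \<Longrightarrow> n \<le> card F"
proof -
  assume g: "triangular b a n"
  then have "b ` {..<n} \<subseteq> span F" using V by (auto simp: triangular_def)
  then have "card (b ` {..<n}) \<le> card F"
    using independent_span_bound[OF V(4)] triangular_independent[OF g, of n] by blast
  then show ?thesis using triangular_independent[OF g, of n] by (simp add: card_image)
qed

text \<open>Among the non-zero polynomials p with p(T) v0 in \<open>U\<close>, take one of least
  degree. It has a root \<open>a\<close>, so it is (X - a) q, and v = q(T) v0 lies outside
  \<open>U\<close> by minimality.\<close>

lemma eigenvector_modulo:
  assumes U: "subspace U" and v0: "v0 \<in> V" "v0 \<notin> U"
  obtains a v where "v \<in> V" "v \<notin> U" "T v - a *s v \<in> U"
proof -
  define ev where "ev p v = (\<Sum>i\<le>degree p. coeff p i *s (T ^^ i) v)" for p :: "'k poly" and v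
  have ev: "ev p v = (\<Sum>i<N. coeff p i *s (T ^^ i) v)" if "degree p < N" for p v N
    unfolding ev_def using that
    by (intro sum.mono_neutral_left) (auto simp: coeff_eq_0 not_le)
  have TV: "(T ^^ i) v0 \<in> V" for i
    by (induction i) (use v0 V in auto)
  have evV: "ev p v0 \<in> V" for p
    unfolding ev_def using TV V(1) by (intro subspace_sum subspace_scale) auto
  have ev_mult: "ev ([:-a, 1:] * q) v = T (ev q v) - a *s ev q v" for a q v
  proof -
    let ?N = "Suc (degree q)"
    have 1: "degree ([:-a, 1:] * q) < Suc ?N"
      using degree_mult_le[of "[:-a, 1:]" q] by simp
    have eq: "[:-a, 1:] * q = pCons 0 q - smult a q" by simp
    have dp: "degree (pCons 0 q) \<le> ?N" by (rule degree_pCons_le)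
    have c0: "coeff q ?N = 0" by (simp add: coeff_eq_0)
    have "(\<Sum>i<Suc ?N. coeff (pCons 0 q) i *s (T ^^ i) v) = (\<Sum>i<?N. coeff q i *s T ((T ^^ i) v))"
      by (subst sum.lessThan_Suc_shift) simp
    moreover have "(\<Sum>i<Suc ?N. (a * coeff q i) *s (T ^^ i) v) = a *s (\<Sum>i<?N. coeff q i *s (T ^^ i) v)"
      using c0 by (simp add: scale_sum_right scale_right_distrib)
    ultimately show ?thesis
      unfolding ev[OF 1] ev[where p = q, OF lessI] unfolding arg_cong[OF eq, of coeff]
      by (simp only: coeff_diff coeff_smult scale_left_diff_distrib sum_subtractf T_simps)
  qed
  \<comment> \<open>The \<open>card F + 1\<close> vectors \<open>v0\<close>, \<open>T v0\<close>,
    ... are linearly dependent, which gives a non-zero polynomial sending \<open>v0\<close> to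
    0.\<close>
  obtain c where c: "\<exists>i\<le>card F. c i \<noteq> 0" "(\<Sum>i\<le>card F. c i *s (T ^^ i) v0) = 0"
    using linear_relation_of_bounded_family[of "\<lambda>i. (T ^^ i) v0" F] TV V by blast
  define p where "p = (\<Sum>i\<le>card F. monom (c i) i)"
  have cp: "coeff p i = (if i \<le> card F then c i else 0)" for i
    by (simp add: p_def coeff_sum)
  have "degree p < Suc (card F)"
    using degree_le[of "card F" p] cp by (simp add: less_Suc_eq_le)
  then have "ev p v0 = 0"
    using c(2) by (simp add: ev cp lessThan_Suc_atMost)
  moreover have "p \<noteq> 0" using c(1) cp by (metis coeff_0)
  ultimately have "\<exists>p. p \<noteq> 0 \<and> ev p v0 \<in> U" using subspace_0[OF U] by auto
  then obtain p where p: "p \<noteq> 0" "ev p v0 \<in> U"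
    and min: "\<And>q. q \<noteq> 0 \<Longrightarrow> ev q v0 \<in> U \<Longrightarrow> degree p \<le> degree q"
    using ex_has_least_nat[of "\<lambda>p. p \<noteq> 0 \<and> ev p v0 \<in> U" _ degree] by metis
  \<comment> \<open>A non-zero constant would put \<open>v0\<close> itself into
    \<open>U\<close>.\<close>
  have "degree p > 0"
  proof (rule ccontr)
    assume "\<not> degree p > 0"
    then obtain k where k: "p = [:k:]" "k \<noteq> 0" using p(1) by (metis degree_eq_zeroE neq0_conv pCons_0_0)
    then have "k *s v0 \<in> U" using p(2) by (simp add: ev_def)
    then have "inverse k *s k *s v0 \<in> U" using U by (rule subspace_scale[rotated])
    then show False using v0 k by simp
  qed
  then obtain a where "poly p a = 0" using alg_closed_imp_poly_has_root by blast
  then obtain q where q: "p = [:-a, 1:] * q" by (auto simp: poly_eq_0_iff_dvd elim: dvdE)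
  have q0: "q \<noteq> 0" using q p by auto
  have "degree p = Suc (degree q)" unfolding q using q0 by (subst degree_mult_eq) auto
  then have "ev q v0 \<notin> U" using min q0 by fastforce
  then show ?thesis using that[of "ev q v0" a] evV p(2) ev_mult q by metis
qed

text \<open>\<open>T\<close> minus \<open>c\<close> is invertible on the generalised eigenspaces for
  other eigenvalues, so its image together with the basis vectors for \<open>c\<close> fills the
  span. The induction adds one vector of the flag at a time.\<close>

lemma triangular_solve:
  assumes g: "triangular b a n" and u: "u \<in> span (b ` {..<n})"
  shows "\<exists>w\<in>span (b ` {..<n}). u - (T w - c *s w) \<in> span (b ` {j. j < n \<and> a j = c})"
proof -
  let ?C = "span (b ` {j. j < n \<and> a j = c})"
  define S where "S m = {u. \<exists>w\<in>span (b ` {..<m}). u - (T w - c *s w) \<in> ?C}" for m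
  have subS: "subspace (S m)" for m
  proof (rule subspaceI)
    show "0 \<in> S m" unfolding S_def
      by (auto intro!: bexI[of _ 0] simp: T_simps span_zero)
  next
    fix x y assume "x \<in> S m" "y \<in> S m"
    then obtain v w where vw: "v \<in> span (b ` {..<m})" "w \<in> span (b ` {..<m})"
      "x - (T v - c *s v) \<in> ?C" "y - (T w - c *s w) \<in> ?C"
      unfolding S_def by blast
    have "(x - (T v - c *s v)) + (y - (T w - c *s w)) \<in> ?C" using vw by (intro span_add)
    then show "x + y \<in> S m" unfolding S_def
      using span_add[OF vw(1,2)]
      by (auto intro!: bexI[of _ "v + w"] simp: T_simps scale_right_distrib algebra_simps)
  next
    fix k x assume "x \<in> S m"
    then obtain v where v: "v \<in> span (b ` {..<m})" "x - (T v - c *s v) \<in> ?C"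
      unfolding S_def by blast
    have "k *s (x - (T v - c *s v)) \<in> ?C" using v by (intro span_scale)
    then show "k *s x \<in> S m" unfolding S_def
      using span_scale[OF v(1), of k]
      by (auto intro!: bexI[of _ "k *s v"] simp: T_simps scale_right_diff_distrib algebra_simps)
  qed
  have "m \<le> n \<Longrightarrow> span (b ` {..<m}) \<subseteq> S m" for m
  proof (induction m)
    case 0
    then show ?case using subspace_0[OF subS] by simp
  next
    case (Suc m)
    have mono: "span (b ` {..<m}) \<subseteq> span (b ` {..<Suc m})" by (intro span_mono) auto
    have le: "S m \<subseteq> S (Suc m)" unfolding S_def using mono by blast
    have "b m \<in> S (Suc m)"
    proof (cases "a m = c")
      case True
      then have "b m \<in> ?C" using Suc by (intro span_base) auto
      then show ?thesis unfolding S_def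
        by (auto intro!: bexI[of _ 0] simp: T_simps span_zero)
    next
      case False
      let ?r = "T (b m) - a m *s b m"
      have "?r \<in> span (b ` {j. j < m \<and> a j = a m})"
        using g Suc by (auto simp: triangular_def)
      moreover have "span (b ` {j. j < m \<and> a j = a m}) \<subseteq> span (b ` {..<m})"
        by (intro span_mono) auto
      ultimately have "?r \<in> S (Suc m)" using Suc le by auto
      moreover have "T (b m) - c *s b m \<in> S (Suc m)"
      proof -
        have "b m \<in> span (b ` {..<Suc m})" by (intro span_base) auto
        then show ?thesis unfolding S_def
          by (auto intro!: bexI[of _ "b m"] simp: span_zero)
      qed
      \<comment> \<open>Both vectors are in \<open>S (Suc m)\<close>, and their difference is
        \<open>(a m - c) *s b m\<close> with a non-zero factor.\<close>
      ultimately have "(T (b m) - c *s b m) - ?r \<in> S (Suc m)"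
        by (rule subspace_diff[OF subS, rotated])
      moreover have "(T (b m) - c *s b m) - ?r = (a m - c) *s b m"
        by (simp add: algebra_simps)
      ultimately have "inverse (a m - c) *s (a m - c) *s b m \<in> S (Suc m)"
        using subS by (metis subspace_scale)
      then show ?thesis using False by simp
    qed
    moreover have "b ` {..<m} \<subseteq> S (Suc m)"
      using Suc le span_superset by fastforce
    ultimately show ?case
      by (intro span_minimal subS) (auto simp: lessThan_Suc)
  qed
  then show ?thesis using u unfolding S_def by blast
qed

lemma triangular_extend:
  assumes g: "triangular b a n" and "\<not> V \<subseteq> span (b ` {..<n})"
  shows "\<exists>b a. triangular b a (Suc n)"
proof -
  let ?U = "span (b ` {..<n})"
  obtain v0 where "v0 \<in> V" "v0 \<notin> ?U" using assms by blast
  then obtain c v where v: "v \<in> V" "v \<notin> ?U" "T v - c *s v \<in> ?U"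
    using eigenvector_modulo[of ?U v0] by blast
  \<comment> \<open>Replacing \<open>v\<close> by \<open>v - w\<close> moves the remainder into the
    span of the earlier vectors with eigenvalue \<open>c\<close>, as \<open>triangular\<close>
    demands.\<close>
  obtain w where w: "w \<in> ?U"
    "(T v - c *s v) - (T w - c *s w) \<in> span (b ` {j. j < n \<and> a j = c})"
    using triangular_solve[OF g v(3), of c] by blast
  have "?U \<subseteq> V" using g V(1) by (intro span_minimal) (auto simp: triangular_def)
  then have vw: "v - w \<in> V" using v w V(1) by (intro subspace_diff) auto
  have nU: "v - w \<notin> ?U" using v w by (metis diff_add_cancel span_add)
  define b' where "b' = b(n := v - w)"
  define a' where "a' = a(n := c)"
  have img: "b' ` {..<i} = b ` {..<i}" "b' ` {j. j < i \<and> a' j = d} = b ` {j. j < i \<and> a j = d}"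
    if "i \<le> n" for i d
    using that by (force simp: b'_def a'_def)+
  have "T (v - w) - c *s (v - w) \<in> span (b ` {j. j < n \<and> a j = c})"
    using w(2) by (simp add: T_simps scale_right_diff_distrib algebra_simps)
  then have "triangular b' a' (Suc n)"
    using g vw nU unfolding triangular_def
    by (auto simp: less_Suc_eq_le img) (auto simp: b'_def a'_def le_less triangular_def)
  then show ?thesis by blast
qed

lemma triangular_spanning:
  obtains n b a where "triangular b a n" "V \<subseteq> span (b ` {..<n})"
proof -
  let ?P = "\<lambda>n. \<exists>b a. triangular b a n"
  have P0: "?P 0" by (simp add: triangular_def)
  obtain n where n: "?P n" "\<And>m. ?P m \<Longrightarrow> m \<le> n"
    using Nat.ex_has_greatest_nat[of ?P 0 "card F", OF P0] triangular_bound
    by auto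
  then obtain b a where g: "triangular b a n" by blast
  then have "V \<subseteq> span (b ` {..<n})" using triangular_extend n by (meson Suc_n_not_le_n)
  then show ?thesis using that g by blast
qed

text \<open>The coordinate form of \<open>triangular\<close>: the last two clauses speak of the
  matrix entries \<open>co i (T (b j))\<close> and are what \<open>jordan_like\<close> asks
  for.\<close>

lemma triangular_basis:
  obtains n :: nat and b co where
    "\<And>i. i < n \<Longrightarrow> b i \<in> V"
    "\<And>i. Vector_Spaces.linear scale (*) (co i)"
    "\<And>i j. i < n \<Longrightarrow> j < n \<Longrightarrow> co i (b j) = (if i = j then 1 else 0)"
    "\<And>v. v \<in> V \<Longrightarrow> v = (\<Sum>i<n. co i v *s b i)"
    "\<And>i j. j < i \<Longrightarrow> i < n \<Longrightarrow> co i (T (b j)) = 0"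
    "\<And>i j. i < n \<Longrightarrow> j < n \<Longrightarrow> co i (T (b j)) \<noteq> 0 \<Longrightarrow> co i (T (b i)) = co j (T (b j))"
proof -
  obtain n b a where g: "triangular b a n" and sp: "V \<subseteq> span (b ` {..<n})" by (rule triangular_spanning)
  have ind: "independent (b ` {..<n})" and inj: "inj_on b {..<n}"
    using triangular_independent[OF g, of n] by auto
  have "\<exists>g. Vector_Spaces.linear scale (*) g
      \<and> (\<forall>x\<in>b ` {..<n}. g x = (if x = b i then 1 else 0))" for i
    by (rule functional_of_independent[OF ind, of "\<lambda>x. if x = b i then 1 else 0"]) blast
  then obtain co where co: "\<And>i. Vector_Spaces.linear scale (*) (co i)"
    "\<And>i x. x \<in> b ` {..<n} \<Longrightarrow> co i x = (if x = b i then 1 else 0)"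
    by metis
  have delta: "co i (b j) = (if i = j then 1 else 0)" if "i < n" "j < n" for i j
    using that co(2)[of "b j" i] inj by (auto simp: inj_on_def)
  have exp: "v = (\<Sum>i<n. co i v *s b i)" if "v \<in> span (b ` {..<n})" for v
    using that
  proof (induction rule: span_induct_alt)
    case base
    then show ?case by (simp add: linear_functional_simps[OF co(1)])
  next
    case (step c x y)
    then obtain j where j: "x = b j" "j < n" by blast
    have "(\<Sum>i<n. co i x *s b i) = (\<Sum>i<n. if i = j then b j else 0)"
      using j by (intro sum.cong) (auto simp: delta)
    then have "x = (\<Sum>i<n. co i x *s b i)" using j by simp
    then have "c *s x + y = c *s (\<Sum>i<n. co i x *s b i) + (\<Sum>i<n. co i y *s b i)"
      using step.IH by (rule arg_cong2[where f = "\<lambda>u v. c *s u + v"])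
    also have "\<dots> = (\<Sum>i<n. co i (c *s x + y) *s b i)"
      by (simp add: linear_functional_add[OF co(1)] linear_functional_scale[OF co(1)]
          scale_left_distrib sum.distrib scale_sum_right)
    finally show ?case .
  qed
  \<comment> \<open>Except above the diagonal at equal eigenvalues, the matrix is the diagonal
    matrix of \<open>a\<close>.\<close>
  have diff: "co i (T (b j)) = a j * (if i = j then 1 else 0)"
    if "i < n" "j < n" "\<not> (i < j \<and> a i = a j)" for i j
  proof -
    have "T (b j) - a j *s b j \<in> span (b ` {k. k < j \<and> a k = a j})"
      using g that by (auto simp: triangular_def)
    then have "co i (T (b j) - a j *s b j) = 0"
    proof (induction rule: span_induct_alt)
      case (step c x y)
      then obtain k where "x = b k" "k < j" "a k = a j" by blast
      then have "co i x = 0" using that delta[of i k] by auto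
      then show ?case using step by (simp add: linear_functional_simps[OF co(1)])
    qed (simp add: linear_functional_simps[OF co(1)])
    then show ?thesis using that delta by (simp add: linear_functional_simps[OF co(1)])
  qed
  show ?thesis
  proof (rule that[of n b co])
    show "co i (T (b j)) = 0" if "j < i" "i < n" for i j
      using that diff[of i j] by auto
    show "co i (T (b i)) = co j (T (b j))" if "i < n" "j < n" "co i (T (b j)) \<noteq> 0" for i j
      using that diff[of i j] diff[of i i] diff[of j j] by (cases "a i = a j") (auto split: if_splits)
  qed (use g sp co delta exp in \<open>auto simp: triangular_def\<close>)
qed

end

section \<open>Matrices and traces\<close>

type_synonym 'k matrix = "nat \<Rightarrow> nat \<Rightarrow> 'k"

text \<open>Only the inner dimension is recorded. One operation then serves square and rectangular
  matrices, and associativity holds for all indices.\<close>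

definition mat_mul :: "nat \<Rightarrow> 'k::comm_ring_1 matrix \<Rightarrow> 'k matrix \<Rightarrow> 'k matrix" where
  "mat_mul n A B i j = (\<Sum>k<n. A i k * B k j)"

definition mat_tr :: "nat \<Rightarrow> 'k::comm_ring_1 matrix \<Rightarrow> 'k" where
  "mat_tr n A = (\<Sum>i<n. A i i)"

definition mat_comm :: "nat \<Rightarrow> 'k::comm_ring_1 matrix \<Rightarrow> 'k matrix \<Rightarrow> 'k matrix" where
  "mat_comm n A B i j = mat_mul n A B i j - mat_mul n B A i j"

text \<open>Entries outside the block of size \<open>n\<close> carry no meaning, so matrices are
  compared on the block.\<close>

definition agree :: "nat \<Rightarrow> 'k matrix \<Rightarrow> 'k matrix \<Rightarrow> bool" where
  "agree n A B \<longleftrightarrow> (\<forall>i<n. \<forall>j<n. A i j = B i j)"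

lemma agreeI: "(\<And>i j. i < n \<Longrightarrow> j < n \<Longrightarrow> A i j = B i j) \<Longrightarrow> agree n A B"
  by (simp add: agree_def)

lemma mat_mul_assoc: "mat_mul n (mat_mul m A B) C = mat_mul m A (mat_mul n B C)"
proof (intro ext)
  fix i j
  have "mat_mul n (mat_mul m A B) C i j = (\<Sum>k<n. \<Sum>l<m. A i l * B l k * C k j)"
    by (simp add: mat_mul_def sum_distrib_right)
  also have "\<dots> = (\<Sum>l<m. \<Sum>k<n. A i l * B l k * C k j)" by (rule sum.swap)
  also have "\<dots> = mat_mul m A (mat_mul n B C) i j"
    by (simp add: mat_mul_def sum_distrib_left mult.assoc)
  finally show "mat_mul n (mat_mul m A B) C i j = mat_mul m A (mat_mul n B C) i j" .
qed

lemma mat_tr_mat_mul_commute: "mat_tr m (mat_mul n A B) = mat_tr n (mat_mul m B A)"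
  unfolding mat_tr_def mat_mul_def by (subst sum.swap) (simp add: mult.commute)

lemma mat_tr_add: "mat_tr n (\<lambda>i j. A i j + B i j) = mat_tr n A + mat_tr n B"
  by (simp add: mat_tr_def sum.distrib)

lemma mat_tr_diff: "mat_tr n (\<lambda>i j. A i j - B i j) = mat_tr n A - mat_tr n B"
  by (simp add: mat_tr_def sum_subtractf)

lemma mat_tr_scale: "mat_tr n (\<lambda>i j. c * A i j) = c * mat_tr n A"
  by (simp add: mat_tr_def sum_distrib_left)

lemma mat_tr_cong: "agree n A B \<Longrightarrow> mat_tr n A = mat_tr n B"
  by (simp add: mat_tr_def agree_def)

lemma mat_mul_add_right: "mat_mul n A (\<lambda>i j. B i j + C i j) = (\<lambda>i j. mat_mul n A B i j + mat_mul n A C i j)"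
  by (simp add: mat_mul_def fun_eq_iff sum.distrib algebra_simps)

lemma mat_mul_diff_right: "mat_mul n A (\<lambda>i j. B i j - C i j) = (\<lambda>i j. mat_mul n A B i j - mat_mul n A C i j)"
  by (simp add: mat_mul_def fun_eq_iff sum_subtractf algebra_simps)

lemma mat_mul_scale_right: "mat_mul n A (\<lambda>i j. c * B i j) = (\<lambda>i j. c * mat_mul n A B i j)"
  by (simp add: mat_mul_def fun_eq_iff sum_distrib_left algebra_simps)

lemma mat_mul_add_left: "mat_mul n (\<lambda>i j. B i j + C i j) A = (\<lambda>i j. mat_mul n B A i j + mat_mul n C A i j)"
  by (simp add: mat_mul_def fun_eq_iff sum.distrib algebra_simps)

lemma mat_mul_diff_left: "mat_mul n (\<lambda>i j. B i j - C i j) A = (\<lambda>i j. mat_mul n B A i j - mat_mul n C A i j)"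
  by (simp add: mat_mul_def fun_eq_iff sum_subtractf algebra_simps)

lemma mat_mul_scale_left: "mat_mul n (\<lambda>i j. c * B i j) A = (\<lambda>i j. c * mat_mul n B A i j)"
  by (simp add: mat_mul_def fun_eq_iff sum_distrib_left algebra_simps)

lemmas mat_mul_linear = mat_mul_add_right mat_mul_diff_right mat_mul_scale_right mat_mul_add_left mat_mul_diff_left mat_mul_scale_left

lemma agree_mat_mul: "agree n A A' \<Longrightarrow> agree n B B' \<Longrightarrow> agree n (mat_mul n A B) (mat_mul n A' B')"
  by (simp add: agree_def mat_mul_def)

lemma mat_tr_mat_mul_cong: "agree n A A' \<Longrightarrow> agree n B B' \<Longrightarrow> mat_tr n (mat_mul n A B) = mat_tr n (mat_mul n A' B')"
  by (intro mat_tr_cong agree_mat_mul)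

lemma mat_comm_eta: "mat_comm n A B = (\<lambda>i j. mat_mul n A B i j - mat_mul n B A i j)"
  by (simp add: mat_comm_def fun_eq_iff)

text \<open>Cyclicity of the trace; the invariance of all trace forms goes back to this.\<close>

lemma mat_tr_mat_comm: "mat_tr n (mat_mul n (mat_comm n A B) C) = mat_tr n (mat_mul n A (mat_comm n B C))"
proof -
  have "mat_tr n (mat_mul n (mat_mul n B A) C) = mat_tr n (mat_mul n A (mat_mul n C B))"
    by (metis mat_mul_assoc mat_tr_mat_mul_commute)
  then show ?thesis
    by (simp add: mat_comm_eta mat_mul_linear mat_tr_diff mat_mul_assoc)
qed

lemma mat_comm_add_right: "mat_comm n A (\<lambda>i j. B i j + c * C i j) = (\<lambda>i j. mat_comm n A B i j + c * mat_comm n A C i j)"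
  by (simp add: mat_comm_eta mat_mul_linear fun_eq_iff algebra_simps)

section \<open>The operators ad J - c on matrices and their generalised eigenspaces\<close>

definition ad_shift :: "nat \<Rightarrow> 'k::comm_ring_1 matrix \<Rightarrow> 'k \<Rightarrow> 'k matrix \<Rightarrow> 'k matrix" where
  "ad_shift n J c Z i j = mat_comm n J Z i j - c * Z i j"

lemma ad_shift_eta: "ad_shift n J c Z = (\<lambda>i j. mat_comm n J Z i j - c * Z i j)"
  by (simp add: ad_shift_def fun_eq_iff)

lemma ad_shift_combine: "ad_shift n J c (\<lambda>i j. A i j + k * B i j)
    = (\<lambda>i j. ad_shift n J c A i j + k * ad_shift n J c B i j)"
  by (simp add: ad_shift_def fun_eq_iff mat_comm_add_right algebra_simps)

lemma ad_shift_commute: "ad_shift n J c (ad_shift n J d Z) = ad_shift n J d (ad_shift n J c Z)"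
proof -
  have *: "ad_shift n J d Z = (\<lambda>i j. mat_comm n J Z i j + (- d) * Z i j)" for d and Z
    by (simp add: ad_shift_def fun_eq_iff)
  show ?thesis
    unfolding * mat_comm_add_right by (simp only: fun_eq_iff) (simp add: algebra_simps)
qed

lemma ad_shift_pow_sum:
  "(ad_shift n J c ^^ m) (\<lambda>i j. \<Sum>x\<in>S. f x i j) = (\<lambda>i j. \<Sum>x\<in>S. (ad_shift n J c ^^ m) (f x) i j)"
proof -
  have *: "ad_shift n J c (\<lambda>i j. \<Sum>x\<in>S. f x i j) = (\<lambda>i j. \<Sum>x\<in>S. ad_shift n J c (f x) i j)" for f
  proof (induction S rule: infinite_finite_induct)
    case (insert x S)
    then show ?case using ad_shift_combine[of n J c "f x" 1 "\<lambda>i j. \<Sum>x\<in>S. f x i j"] by simp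
  qed (simp_all add: ad_shift_def mat_comm_def mat_mul_def fun_eq_iff)
  show ?thesis by (induction m) (simp_all add: *)
qed

text \<open>What is needed of the Jordan normal form: the diagonal part of \<open>J\<close> commutes with the strictly
  upper triangular rest.\<close>

locale jordan_like =
  fixes n :: nat and J :: "'k::field matrix"
  assumes upper: "\<And>i j. j < i \<Longrightarrow> i < n \<Longrightarrow> J i j = 0"
    and diag: "\<And>i j. i < n \<Longrightarrow> j < n \<Longrightarrow> J i j \<noteq> 0 \<Longrightarrow> J i i = J j j"
begin

text \<open>\<open>c\<close> is a weight for the diagonal part of \<open>J\<close>; \<open>d\<close>
  bounds the support by j - i >= d - n, written without subtraction. So \<open>d = 0\<close> is no
  restriction, and \<open>d = 2 * n\<close> leaves only the zero block.\<close>

definition graded :: "'k \<Rightarrow> nat \<Rightarrow> 'k matrix \<Rightarrow> bool" where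
  "graded c d Z \<longleftrightarrow> (\<forall>i<n. \<forall>j<n. Z i j \<noteq> 0 \<longrightarrow> J i i - J j j = c \<and> i + d \<le> j + n)"

text \<open>The diagonal part of \<open>J\<close> contributes the factor
  \<open>J i i - J j j - c\<close>, which is 0 in weight \<open>c\<close>; an off-diagonal entry of
  \<open>J\<close> links equal eigenvalues and shifts the support up by at least one.\<close>

lemma graded_ad_shift:
  assumes Z: "graded c d Z"
  shows "graded c (Suc d) (ad_shift n J c Z)"
  unfolding graded_def
proof (intro allI impI, rule ccontr)
  fix i j assume ij: "i < n" "j < n" and nz: "ad_shift n J c Z i j \<noteq> 0"
    and no: "\<not> (J i i - J j j = c \<and> i + Suc d \<le> j + n)"
  have ZD: "J i i - J j j = c" "i + d \<le> j + n" if "i < n" "j < n" "Z i j \<noteq> 0" for i j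
    using Z that by (auto simp: graded_def)
  have JD: "i \<le> j" if "i < n" "j < n" "J i j \<noteq> 0" for i j
    using upper[of j i] that by force
  have 1: "J i k * Z k j = 0" if "k < n" "k \<noteq> i" for k
  proof (rule ccontr)
    assume "J i k * Z k j \<noteq> 0"
    then have "J i k \<noteq> 0" "Z k j \<noteq> 0" by auto
    then show False using no ZD[of k j] JD[of i k] diag[of i k] that ij by auto
  qed
  have 2: "Z i k * J k j = 0" if "k < n" "k \<noteq> j" for k
  proof (rule ccontr)
    assume "Z i k * J k j \<noteq> 0"
    then have "J k j \<noteq> 0" "Z i k \<noteq> 0" by auto
    then show False using no ZD[of i k] JD[of k j] diag[of k j] that ij by auto
  qed
  have "mat_mul n J Z i j = J i i * Z i j"
    unfolding mat_mul_def using ij 1 by (subst sum.remove[of _ i]) (auto intro!: sum.neutral simp del: mult_eq_0_iff)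
  moreover have "mat_mul n Z J i j = Z i j * J j j"
    unfolding mat_mul_def using ij 2 by (subst sum.remove[of _ j]) (auto intro!: sum.neutral simp del: mult_eq_0_iff)
  ultimately have "ad_shift n J c Z i j = (J i i - J j j - c) * Z i j"
    by (simp add: ad_shift_def mat_comm_def algebra_simps)
  also have "\<dots> = 0" using ZD[of i j] ij by auto
  finally show False using nz by simp
qed

lemma graded_ad_shift_pow: "graded c 0 Z \<Longrightarrow> graded c d ((ad_shift n J c ^^ d) Z)"
  by (induction d) (auto intro: graded_ad_shift)

lemma ad_shift_nilpotent: "graded c 0 Z \<Longrightarrow> agree n ((ad_shift n J c ^^ (2 * n)) Z) (\<lambda>i j. 0)"
  using graded_ad_shift_pow[of c Z "2 * n"] by (fastforce simp: graded_def agree_def)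

lemma graded_ad_shift_other: "graded c 0 Z \<Longrightarrow> graded c 0 (ad_shift n J d Z)"
proof -
  assume Z: "graded c 0 Z"
  have "ad_shift n J d Z i j = ad_shift n J c Z i j + (c - d) * Z i j" for i j
    by (simp add: ad_shift_def algebra_simps)
  then show ?thesis using Z graded_ad_shift[OF Z] by (fastforce simp: graded_def)
qed

lemma graded_ad_shift_other_pow: "graded c 0 Z \<Longrightarrow> graded c 0 ((ad_shift n J d ^^ m) Z)"
  by (induction m) (auto intro: graded_ad_shift_other)

context
  fixes P :: "'k matrix \<Rightarrow> bool"
  assumes P0: "P (\<lambda>i j. 0)"
    and Pcomb: "\<And>A B c. P A \<Longrightarrow> P B \<Longrightarrow> P (\<lambda>i j. A i j + c * B i j)"
    and Pcong: "\<And>A B. agree n A B \<Longrightarrow> P A \<Longrightarrow> P B"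
    and Pcomm: "\<And>A. P A \<Longrightarrow> P (mat_comm n J A)"
begin

lemma closed_ad_shift: "P A \<Longrightarrow> P (ad_shift n J c A)"
  using Pcomb[OF Pcomm, of A A "- c"] by (simp add: ad_shift_eta)

lemma closed_ad_shift_pow: "P A \<Longrightarrow> P ((ad_shift n J c ^^ m) A)"
  by (induction m) (auto intro: closed_ad_shift)

lemma closed_sum: "(\<And>x. x \<in> S \<Longrightarrow> P (f x)) \<Longrightarrow> P (\<lambda>i j. \<Sum>x\<in>S. c x * f x i j)"
proof (induction S rule: infinite_finite_induct)
  case (insert x S)
  then show ?case using Pcomb[of "\<lambda>i j. \<Sum>x\<in>S. c x * f x i j" "f x" "c x"]
    by (simp add: add.commute)
qed (simp_all add: P0)

text \<open>The images of \<open>Z\<close> under ad J - d and ad J - c differ by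
  \<open>c - d\<close> times \<open>Z\<close>. The first is in \<open>P\<close> by assumption, the
  second by induction, since it needs one power less to vanish.\<close>

lemma eigen_cancel:
  assumes "agree n ((ad_shift n J c ^^ m) Z) (\<lambda>i j. 0)" "P (ad_shift n J d Z)" "c \<noteq> d"
  shows "P Z"
  using assms(1,2)
proof (induction m arbitrary: Z)
  case 0
  then show ?case using Pcong[OF _ P0] by (auto simp: agree_def)
next
  case (Suc m)
  let ?V = "ad_shift n J c Z"
  have "P ?V"
  proof (rule Suc.IH)
    show "agree n ((ad_shift n J c ^^ m) ?V) (\<lambda>i j. 0)"
      using Suc.prems(1) by (simp add: funpow_Suc_right del: funpow.simps)
    show "P (ad_shift n J d ?V)"
      using closed_ad_shift[OF Suc.prems(2), of c] by (simp add: ad_shift_commute)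
  qed
  then have "P (\<lambda>i j. 0 + (1 / (c - d)) * (ad_shift n J d Z i j + (- 1) * ?V i j))"
    by (intro Pcomb P0 Suc.prems)
  moreover have "(\<lambda>i j. 0 + (1 / (c - d)) * (ad_shift n J d Z i j + (- 1) * ?V i j)) = Z"
    using assms(3) by (simp add: fun_eq_iff ad_shift_def field_simps)
  ultimately show ?case by simp
qed

lemma eigen_cancel_pow:
  assumes "graded c 0 Z" "P ((ad_shift n J d ^^ m) Z)" "c \<noteq> d"
  shows "P Z"
  using assms(2)
proof (induction m)
  case (Suc m)
  have "P ((ad_shift n J d ^^ m) Z)"
    by (rule eigen_cancel[where m = "2 * n" and c = c and d = d])
      (use Suc assms graded_ad_shift_other_pow ad_shift_nilpotent in auto)
  then show ?case by (rule Suc.IH)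
qed simp

text \<open>A high power of ad J - d annihilates the component of weight \<open>d\<close> and keeps
  the others in their weights. By induction their images lie in \<open>P\<close>;
  \<open>eigen_cancel_pow\<close> brings the components back, and the one for \<open>d\<close>
  remains as a difference.\<close>

lemma graded_components:
  assumes "finite C" "\<And>c. c \<in> C \<Longrightarrow> graded c 0 (f c)" "P (\<lambda>i j. \<Sum>c\<in>C. f c i j)"
  shows "\<forall>c\<in>C. P (f c)"
  using assms
proof (induction C arbitrary: f rule: finite_induct)
  case (insert d C)
  let ?A = "ad_shift n J d ^^ (2 * n)"
  have "agree n (?A (f d)) (\<lambda>i j. 0)"
    by (rule ad_shift_nilpotent) (use insert in auto)
  then have "agree n (?A (\<lambda>i j. \<Sum>c\<in>insert d C. f c i j)) (\<lambda>i j. \<Sum>c\<in>C. ?A (f c) i j)"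
    unfolding ad_shift_pow_sum using insert.hyps by (simp add: agree_def)
  moreover have "P (?A (\<lambda>i j. \<Sum>c\<in>insert d C. f c i j))"
    using insert.prems by (intro closed_ad_shift_pow)
  ultimately have "P (\<lambda>i j. \<Sum>c\<in>C. ?A (f c) i j)" by (rule Pcong)
  then have "\<forall>c\<in>C. P (?A (f c))"
    using insert.prems by (intro insert.IH) (auto intro: graded_ad_shift_other_pow)
  then have PC: "P (f c)" if "c \<in> C" for c
    using that insert eigen_cancel_pow[where c = c and Z = "f c" and d = d and m = "2 * n"] by auto
  then have "P (\<lambda>i j. \<Sum>c\<in>C. 1 * f c i j)" by (intro closed_sum)
  then have "P (\<lambda>i j. (\<Sum>c\<in>insert d C. f c i j) + (- 1) * (\<Sum>c\<in>C. 1 * f c i j))"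
    using insert.prems by (intro Pcomb)
  then have "P (f d)" using insert.hyps by simp
  then show ?case using PC by simp
qed simp

text \<open>As \<open>\<phi>\<close> is additive, commutation with the diagonal matrix of the
  \<open>\<phi> (J i i)\<close> multiplies the component of weight \<open>c\<close> by
  \<open>\<phi> c\<close>. That the components lie in \<open>P\<close> replaces the usual
  interpolation polynomial in ad J.\<close>

lemma closed_weighted:
  fixes \<phi> :: "'k \<Rightarrow> 'k"
  assumes Z: "P Z" and \<phi>: "\<And>a b. \<phi> (a - b) = \<phi> a - \<phi> b"
  shows "P (\<lambda>i j. (\<phi> (J i i) - \<phi> (J j j)) * Z i j)"
proof -
  define C where "C = (\<lambda>(i, j). J i i - J j j) ` ({..<n} \<times> {..<n})"
  define f where "f c i j = (if J i i - J j j = c then Z i j else 0)" for c i j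
  have fin: "finite C" by (simp add: C_def)
  have in_C: "J i i - J j j \<in> C" if "i < n" "j < n" for i j
    using that by (auto simp: C_def)
  have "agree n Z (\<lambda>i j. \<Sum>c\<in>C. f c i j)"
    using in_C fin by (auto simp: agree_def f_def)
  then have "P (\<lambda>i j. \<Sum>c\<in>C. f c i j)" using Z by (rule Pcong)
  then have "\<forall>c\<in>C. P (f c)"
    by (intro graded_components fin) (auto simp: graded_def f_def)
  then have "P (\<lambda>i j. \<Sum>c\<in>C. \<phi> c * f c i j)" by (intro closed_sum) auto
  moreover have "agree n (\<lambda>i j. \<Sum>c\<in>C. \<phi> c * f c i j) (\<lambda>i j. (\<phi> (J i i) - \<phi> (J j j)) * Z i j)"
  proof (rule agreeI)
    fix i j assume ij: "i < n" "j < n"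
    have "(\<Sum>c\<in>C. \<phi> c * f c i j) = (\<Sum>c\<in>C. if J i i - J j j = c then \<phi> c * Z i j else 0)"
      by (intro sum.cong) (auto simp: f_def)
    then show "(\<Sum>c\<in>C. \<phi> c * f c i j) = (\<phi> (J i i) - \<phi> (J j j)) * Z i j"
      using in_C[OF ij] fin by (simp add: \<phi>)
  qed
  ultimately show ?thesis by (rule Pcong[rotated])
qed

end

text \<open>With \<open>Y = diag (\<phi> (J i i))\<close>, the set orthogonal to \<open>S\<close> is stable under \<open>ad J\<close>, hence under
  \<open>ad Y\<close>; so \<open>mat_tr ([A, B] Y) = mat_tr (A [B, Y]) = 0\<close>.\<close>

lemma weighted_trace_mat_comm:
  fixes \<phi> :: "'k \<Rightarrow> 'k"
  assumes orth: "\<And>A B. A \<in> S \<Longrightarrow> B \<in> S \<Longrightarrow> mat_tr n (mat_mul n A B) = 0"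
    and clos: "\<And>A. A \<in> S \<Longrightarrow> \<exists>B\<in>S. agree n (mat_comm n A J) B"
    and \<phi>: "\<And>a b. \<phi> (a - b) = \<phi> a - \<phi> b"
    and AB: "A \<in> S" "B \<in> S"
  shows "(\<Sum>i<n. mat_comm n A B i i * \<phi> (J i i)) = 0"
proof -
  define P where "P Z \<longleftrightarrow> (\<forall>A\<in>S. mat_tr n (mat_mul n A Z) = 0)" for Z
  have "P (\<lambda>i j. (\<phi> (J i i) - \<phi> (J j j)) * B i j)"
  proof (rule closed_weighted)
    show "P (\<lambda>i j. 0)" by (simp add: P_def mat_mul_def mat_tr_def)
    show "P (\<lambda>i j. W i j + c * Y i j)" if "P W" "P Y" for W Y c
      using that by (simp add: P_def mat_mul_linear mat_tr_add mat_tr_scale)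
    show "P Y" if "agree n W Y" "P W" for W Y
      using that mat_tr_mat_mul_cong[OF _ that(1)] unfolding P_def by (metis agreeI)
    show "P (mat_comm n J W)" if "P W" for W
      unfolding P_def
    proof
      fix A assume "A \<in> S"
      then obtain B where "B \<in> S" "agree n (mat_comm n A J) B" using clos by blast
      then show "mat_tr n (mat_mul n A (mat_comm n J W)) = 0"
        using that mat_tr_mat_mul_cong[of n "mat_comm n A J" B W W] by (auto simp: P_def mat_tr_mat_comm[symmetric] agree_def)
    qed
    show "P B" using AB orth by (simp add: P_def)
  qed (rule \<phi>)
  then have "(\<Sum>i<n. \<Sum>k<n. A i k * ((\<phi> (J k k) - \<phi> (J i i)) * B k i)) = 0"
    using AB by (simp add: P_def mat_tr_def mat_mul_def)
  then have "(\<Sum>i<n. \<Sum>k<n. A i k * B k i * \<phi> (J k k)) = (\<Sum>i<n. \<Sum>k<n. A i k * B k i * \<phi> (J i i))"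
    by (simp add: algebra_simps sum_subtractf)
  moreover have "(\<Sum>i<n. \<Sum>k<n. A i k * B k i * \<phi> (J k k)) = (\<Sum>i<n. mat_mul n B A i i * \<phi> (J i i))"
    by (subst sum.swap) (simp add: mat_mul_def sum_distrib_left sum_distrib_right mult_ac)
  moreover have "(\<Sum>i<n. \<Sum>k<n. A i k * B k i * \<phi> (J i i)) = (\<Sum>i<n. mat_mul n A B i i * \<phi> (J i i))"
    by (simp add: mat_mul_def sum_distrib_right)
  ultimately show ?thesis by (simp add: mat_comm_def left_diff_distrib sum_subtractf)
qed

end

section \<open>Change of basis for matrices\<close>

definition conjugate :: "nat \<Rightarrow> 'k::comm_ring_1 matrix \<Rightarrow> 'k matrix \<Rightarrow> 'k matrix \<Rightarrow> 'k matrix" where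
  "conjugate n P Q A = mat_mul n Q (mat_mul n A P)"

context
  fixes n m :: nat and P Q :: "'k::comm_ring_1 matrix"
  assumes PQ: "agree n (mat_mul m P Q) (\<lambda>i j. if i = j then 1 else 0)"
begin

lemma mat_mul_PQ_left: "i < n \<Longrightarrow> mat_mul n (mat_mul m P Q) A i j = A i j"
proof -
  assume i: "i < n"
  have "mat_mul n (mat_mul m P Q) A i j = (\<Sum>k<n. if k = i then A i j else 0)"
    unfolding mat_mul_def[of n] using i PQ by (intro sum.cong) (auto simp: agree_def)
  then show ?thesis using i by simp
qed

lemma mat_mul_PQ_right: "j < n \<Longrightarrow> mat_mul n A (mat_mul m P Q) i j = A i j"
proof -
  assume j: "j < n"
  have "mat_mul n A (mat_mul m P Q) i j = (\<Sum>k<n. if k = j then A i j else 0)"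
    unfolding mat_mul_def[of n] using j PQ by (intro sum.cong) (auto simp: agree_def)
  then show ?thesis using j by simp
qed

text \<open>Between the two conjugates stands the product of \<open>P\<close> and \<open>Q\<close>,
  which is the identity on the block of size \<open>n\<close> and cancels.\<close>

lemma conjugate_mat_mul: "mat_mul m (conjugate n P Q A) (conjugate n P Q B) = conjugate n P Q (mat_mul n A B)"
proof -
  have "mat_mul n A (mat_mul n (mat_mul m P Q) C) = mat_mul n A C" for C
    by (intro ext) (simp add: mat_mul_def[of n A] mat_mul_PQ_left)
  then show ?thesis by (simp add: conjugate_def mat_mul_assoc)
qed

lemma conjugate_mat_comm: "mat_comm m (conjugate n P Q A) (conjugate n P Q B) = conjugate n P Q (mat_comm n A B)"
  unfolding mat_comm_eta conjugate_mat_mul by (simp add: conjugate_def mat_mul_linear)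

lemma mat_tr_conjugate: "mat_tr m (conjugate n P Q A) = mat_tr n A"
proof -
  have "mat_tr m (conjugate n P Q A) = mat_tr n (mat_mul m (mat_mul n A P) Q)"
    unfolding conjugate_def by (rule mat_tr_mat_mul_commute)
  also have "\<dots> = mat_tr n A"
    by (intro mat_tr_cong agreeI) (simp add: mat_mul_assoc mat_mul_PQ_right)
  finally show ?thesis .
qed

lemma conjugate_eq_0D:
  assumes "agree m (conjugate n P Q A) (\<lambda>i j. 0)"
  shows "agree n A (\<lambda>i j. 0)"
proof (rule agreeI)
  fix i j assume ij: "i < n" "j < n"
  have "mat_mul m P (mat_mul m (conjugate n P Q A) Q) i j = mat_mul n (mat_mul m P Q) (mat_mul n A (mat_mul m P Q)) i j"
    by (simp add: conjugate_def mat_mul_assoc)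
  also have "\<dots> = A i j" using ij by (simp add: mat_mul_PQ_left mat_mul_PQ_right)
  finally show "A i j = 0" using assms by (simp add: mat_mul_def[of m] agree_def)
qed

end

lemma conjugate_linear:
  "conjugate n P Q (\<lambda>i j. A i j + B i j) = (\<lambda>i j. conjugate n P Q A i j + conjugate n P Q B i j)"
  "conjugate n P Q (\<lambda>i j. c * A i j) = (\<lambda>i j. c * conjugate n P Q A i j)"
  by (simp_all add: conjugate_def mat_mul_linear)

lemma conjugate_cong: "agree n A B \<Longrightarrow> conjugate n P Q A = conjugate n P Q B"
  by (simp add: conjugate_def mat_mul_def agree_def fun_eq_iff)

lemma sum_fun_apply: "(sum g S) x = (\<Sum>k\<in>S. g k x)"
  by (induction S rule: infinite_finite_induct) auto

text \<open>Columns of length \<open>n\<close> are modelled as functions that vanish from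
  \<open>n\<close> on. The columns of \<open>P\<close> are the triangularising basis, and
  \<open>Q\<close> holds the coordinates of the unit vectors in it.\<close>

lemma triangular_conjugate:
  fixes W :: "'k::alg_closed_field matrix"
  obtains m P Q where
    "agree n (mat_mul m P Q) (\<lambda>i j. if i = j then 1 else 0)"
    "jordan_like m (conjugate n P Q W)"
proof -
  define sc where "sc c f i = c * f i" for c :: 'k and f :: "nat \<Rightarrow> 'k" and i
  define V where "V = {f :: nat \<Rightarrow> 'k. \<forall>i\<ge>n. f i = 0}"
  define e where "e j i = (if i = j then 1 else 0 :: 'k)" for i j :: nat
  define T where "T f i = (if i < n then \<Sum>k<n. W i k * f k else 0)" for f i
  interpret vector_space sc
    by unfold_locales (auto simp: sc_def fun_eq_iff algebra_simps)
  have expand: "f = (\<Sum>k<n. sc (f k) (e k))" if "f \<in> V" for f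
  proof
    fix i
    have "(\<Sum>k<n. sc (f k) (e k)) i = (\<Sum>k<n. if k = i then f i else 0)"
      unfolding sum_fun_apply by (intro sum.cong) (auto simp: sc_def e_def)
    then show "f i = (\<Sum>k<n. sc (f k) (e k)) i" using that by (auto simp: V_def)
  qed
  have "triangular_family sc T V (e ` {..<n})"
  proof (intro triangular_family.intro triangular_family_axioms.intro vector_space_axioms)
    show "Vector_Spaces.linear sc sc T"
      unfolding Vector_Spaces.linear_iff using vector_space_axioms
      by (auto simp: T_def sc_def fun_eq_iff sum.distrib sum_distrib_left algebra_simps)
    show "local.subspace V" by (rule subspaceI) (auto simp: V_def sc_def)
    show "V \<subseteq> span (e ` {..<n})"
    proof
      fix f assume "f \<in> V"
      moreover have "(\<Sum>k<n. sc (f k) (e k)) \<in> span (e ` {..<n})"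
        by (intro span_sum span_scale span_base) auto
      ultimately show "f \<in> span (e ` {..<n})" using expand[of f, symmetric] by simp
    qed
  qed (auto simp: V_def T_def)
  then interpret tf: triangular_family sc T V "e ` {..<n}" .
  show ?thesis
  proof (rule tf.triangular_basis)
    fix m :: nat and b co assume b: "\<And>i. i < m \<Longrightarrow> b i \<in> V"
      and co: "\<And>i. Vector_Spaces.linear sc (*) (co i)"
      and delta: "\<And>i j. i < m \<Longrightarrow> j < m \<Longrightarrow> co i (b j) = (if i = j then 1 else 0)"
      and exp: "\<And>v. v \<in> V \<Longrightarrow> v = (\<Sum>i<m. sc (co i v) (b i))"
      and up: "\<And>i j. j < i \<Longrightarrow> i < m \<Longrightarrow> co i (T (b j)) = 0"
      and dg: "\<And>i j. i < m \<Longrightarrow> j < m \<Longrightarrow> co i (T (b j)) \<noteq> 0 \<Longrightarrow> co i (T (b i)) = co j (T (b j))"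
    define P where "P i j = b j i" for i j
    define Q where "Q i j = co i (e j)" for i j
    have "agree n (mat_mul m P Q) (\<lambda>i j. if i = j then 1 else 0)"
    proof (rule agreeI)
      fix i j assume that: "i < n" "j < n"
      have "e j \<in> V" using that by (auto simp: V_def e_def)
      from exp[OF this] have "e j i = (\<Sum>k<m. sc (co k (e j)) (b k)) i" by (rule fun_cong)
      then show "mat_mul m P Q i j = (if i = j then 1 else 0)"
        unfolding sum_fun_apply by (simp add: mat_mul_def P_def Q_def sc_def e_def mult.commute)
    qed
    moreover have J: "conjugate n P Q W i j = co i (T (b j))" if "i < m" "j < m" for i j
    proof -
      have TV: "T (b j) \<in> V" by (auto simp: V_def T_def)
      have "co i (T (b j)) = co i (\<Sum>k<n. sc (T (b j) k) (e k))" by (rule arg_cong[OF expand[OF TV]])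
      also have "\<dots> = (\<Sum>k<n. T (b j) k * Q i k)"
        by (simp add: linear_functional_simps[OF co] Q_def)
      also have "\<dots> = conjugate n P Q W i j"
        by (simp add: conjugate_def mat_mul_def T_def P_def mult.commute)
      finally show ?thesis by simp
    qed
    have "jordan_like m (conjugate n P Q W)"
    proof
      fix i j :: nat
      show "conjugate n P Q W i j = 0" if "j < i" "i < m"
        using that J[of i j] up[of j i] by simp
      show "conjugate n P Q W i i = conjugate n P Q W j j"
        if "i < m" "j < m" "conjugate n P Q W i j \<noteq> 0"
        using that dg[of i j] by (simp add: J)
    qed
    ultimately show ?thesis by (rule that)
  qed
qed

text \<open>The field is a vector space over the rationals, and a non-zero \<open>a\<close> is part
  of a basis. Rational values matter because a vanishing sum of their squares has only zero
  terms.\<close>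

lemma rational_functional:
  fixes a :: "'k::field_char_0"
  assumes "a \<noteq> 0"
  obtains \<phi> :: "'k \<Rightarrow> rat" where "\<phi> a \<noteq> 0" "\<And>x y. \<phi> (x + y) = \<phi> x + \<phi> y" "\<And>x y. \<phi> (x - y) = \<phi> x - \<phi> y"
    "\<And>q x. \<phi> (of_rat q * x) = q * \<phi> x"
proof -
  interpret vector_space "\<lambda>q x. of_rat q * (x :: 'k)"
    by unfold_locales (auto simp: of_rat_add of_rat_mult algebra_simps)
  have "independent {a}" using assms by simp
  then obtain g where g: "Vector_Spaces.linear (\<lambda>q x. of_rat q * (x :: 'k)) (*) g" "\<And>x. x \<in> {a} \<Longrightarrow> g x = 1"
    by (rule functional_of_independent[where f = "\<lambda>_. 1"]) blast
  show ?thesis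
    by (rule that[of g]) (use g(2) in \<open>auto simp: linear_functional_simps[OF g(1)]\<close>)
qed

section \<open>Finite-dimensional Leibniz algebras\<close>

locale fd_leibniz_algebra = left_leibniz_algebra scale mult + finite_dimensional_vector_space scale Basis
  for scale :: "'a::field_char_0 \<Rightarrow> 'b::ab_group_add \<Rightarrow> 'b" (infixr \<open>*s\<close> 75)
    and mult :: "'b \<Rightarrow> 'b \<Rightarrow> 'b" (infixl \<open>\<cdot>\<close> 70)
    and Basis :: "'b set"
begin

lemma mult_scale_right: "x \<cdot> (c *s y) = c *s (x \<cdot> y)"
  using linear_mult_right[of x] by (simp add: Vector_Spaces.linear_iff)

lemma mult_scale_left: "(c *s x) \<cdot> y = c *s (x \<cdot> y)"
  using linear_mult_left[of y] by (simp add: Vector_Spaces.linear_iff)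

lemma mult_diff_right: "x \<cdot> (y - z) = x \<cdot> y - x \<cdot> z"
  using mult_add_right[of x "y - z" z] by (simp add: algebra_simps)

lemma mult_diff_left: "(x - y) \<cdot> z = x \<cdot> z - y \<cdot> z"
  using mult_add_left[of "x - y" y z] by (simp add: algebra_simps)

lemmas mult_linear = mult_add_right mult_add_left mult_scale_right mult_scale_left
  mult_diff_right mult_diff_left mult_zero_right mult_zero_left

lemma subset_span_Basis: "S \<subseteq> span Basis"
  using span_Basis by blast

lemma prod_space_subset:
  assumes "subspace S" "\<And>x y. x \<in> A \<Longrightarrow> y \<in> B \<Longrightarrow> x \<cdot> y \<in> S"
  shows "prod_space A B \<subseteq> S"
  unfolding prod_space_def using assms by (intro span_minimal) auto

lemma prod_space_mem: "x \<in> A \<Longrightarrow> y \<in> B \<Longrightarrow> x \<cdot> y \<in> prod_space A B"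
  unfolding prod_space_def by (rule span_base) blast

lemma subspace_prod_space: "subspace (prod_space A B)"
  by (simp add: prod_space_def)

lemma span_insert_subspace:
  assumes "subspace S"
  shows "x \<in> span (insert a S) \<longleftrightarrow> (\<exists>k. \<exists>s\<in>S. x = s + k *s a)"
  unfolding span_breakdown_eq using assms
  by (metis (no_types, lifting) add_diff_cancel_right' diff_add_cancel span_eq_iff)

lemma subspace_extend: "subspace S \<Longrightarrow> S \<subseteq> V \<Longrightarrow> x \<in> V \<Longrightarrow> subspace V \<Longrightarrow> span (insert x S) \<subseteq> V"
  by (intro span_minimal) auto

lemma double_in_subspace: "subspace S \<Longrightarrow> x + x \<in> S \<Longrightarrow> x \<in> S"
proof -
  assume S: "subspace S" "x + x \<in> S"
  have "x + x = 2 *s x" by (metis one_add_one scale_left_distrib scale_one)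
  then have "inverse 2 *s 2 *s x \<in> S" using S by (metis subspace_scale)
  then show "x \<in> S" by simp
qed

section \<open>Engel's theorem\<close>

context
  fixes E K :: "'b set"
  assumes E: "subspace E" "\<And>x y. x \<in> E \<Longrightarrow> y \<in> E \<Longrightarrow> x \<cdot> y \<in> E"
    and K: "subspace K" "K \<subseteq> E" "\<And>x y. x \<in> E \<Longrightarrow> y \<in> K \<Longrightarrow> x \<cdot> y \<in> K"
      "\<And>x y. x \<in> K \<Longrightarrow> y \<in> E \<Longrightarrow> x \<cdot> y \<in> K"
    and antisym: "\<And>x y. x \<in> E \<Longrightarrow> y \<in> E \<Longrightarrow> x \<cdot> y + y \<cdot> x \<in> K"
    and nil: "\<And>x y. x \<in> E \<Longrightarrow> y \<in> E \<Longrightarrow> \<exists>N. ((\<cdot>) x ^^ N) y \<in> K"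
begin

text \<open>E / K is a Lie algebra, as antisymmetry holds modulo \<open>K\<close>; these are the
  preimages of its subalgebras.\<close>

definition sub_of :: "'b set \<Rightarrow> bool" where
  "sub_of h \<longleftrightarrow> subspace h \<and> K \<subseteq> h \<and> h \<subseteq> E \<and> (\<forall>x\<in>h. \<forall>y\<in>h. x \<cdot> y \<in> h)"

lemma sub_of_K: "sub_of K"
  using K by (auto simp: sub_of_def)

text \<open>Antisymmetry modulo \<open>K\<close> transfers the normalising condition to the other
  side. It also puts twice \<open>x \<cdot> x\<close> into \<open>K\<close>, hence
  \<open>x \<cdot> x\<close> in characteristic 0.\<close>

lemma sub_of_extend:
  assumes m: "sub_of m" and x: "x \<in> E" "\<And>p. p \<in> m \<Longrightarrow> p \<cdot> x \<in> m"
  shows "sub_of (span (insert x m))"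
proof -
  have sm: "subspace m" "K \<subseteq> m" "m \<subseteq> E" "\<And>p q. p \<in> m \<Longrightarrow> q \<in> m \<Longrightarrow> p \<cdot> q \<in> m"
    using m by (auto simp: sub_of_def)
  have xx: "x \<cdot> x \<in> m"
    using double_in_subspace[OF K(1), of "x \<cdot> x"] antisym x sm by blast
  have xm: "x \<cdot> p \<in> m" if "p \<in> m" for p
  proof -
    have "(x \<cdot> p + p \<cdot> x) - p \<cdot> x \<in> m"
      using antisym[of x p] that x sm by (intro subspace_diff) auto
    then show ?thesis by simp
  qed
  have "y \<cdot> z \<in> span (insert x m)" if yz: "y \<in> span (insert x m)" "z \<in> span (insert x m)" for y z
  proof -
    from yz sm(1) obtain p q k l where pq: "p \<in> m" "q \<in> m" "y = p + k *s x" "z = q + l *s x"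
      by (auto simp: span_insert_subspace)
    have "y \<cdot> z = p \<cdot> q + k *s (x \<cdot> q) + l *s (p \<cdot> x) + (l * k) *s (x \<cdot> x)"
      by (simp add: pq mult_linear scale_right_distrib add_ac)
    also have "\<dots> \<in> m"
      using pq xx xm x sm by (intro subspace_add subspace_scale) auto
    finally show ?thesis by (intro span_base) auto
  qed
  moreover have "m \<subseteq> span (insert x m)" by (auto intro: span_base)
  ultimately show ?thesis
    unfolding sub_of_def using sm x E(1) subspace_extend[of m E x] by auto
qed

text \<open>In the step, \<open>m\<close> is a maximal proper subalgebra of \<open>h\<close>; the induction hypothesis for the action
  of \<open>m\<close> on \<open>h / m\<close> shows that \<open>m\<close> has codimension one in \<open>h\<close>.\<close>

lemma engel_vector:
  assumes "sub_of h"
    and "subspace U" "subspace V" "K \<subseteq> U" "U \<subset> V" "V \<subseteq> E"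
    and "\<And>x u. x \<in> h \<Longrightarrow> u \<in> U \<Longrightarrow> x \<cdot> u \<in> U" "\<And>x u. x \<in> h \<Longrightarrow> u \<in> V \<Longrightarrow> x \<cdot> u \<in> V"
  shows "\<exists>w\<in>V - U. \<forall>x\<in>h. x \<cdot> w \<in> U"
  using assms
proof (induction "dim h" arbitrary: h U V rule: less_induct)
  case less
  have sh: "subspace h" "K \<subseteq> h" "h \<subseteq> E" "\<And>p q. p \<in> h \<Longrightarrow> q \<in> h \<Longrightarrow> p \<cdot> q \<in> h"
    using less.prems(1) by (auto simp: sub_of_def)
  show ?case
  proof (cases "h = K")
    \<comment> \<open>The zero subalgebra of E / K: \<open>K\<close> absorbs products, so it maps
      \<open>V\<close> into \<open>K\<close> and thus into \<open>U\<close>.\<close>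
    case True
    obtain w where w: "w \<in> V" "w \<notin> U" using less.prems(5) by blast
    then have "x \<cdot> w \<in> U" if "x \<in> h" for x
      using that K(4) True less.prems(4,6) by blast
    then show ?thesis using w by blast
  next
    case False
    have "\<exists>m. (sub_of m \<and> m \<subset> h) \<and> (\<forall>T. sub_of T \<and> T \<subset> h \<longrightarrow> m \<subseteq> T \<longrightarrow> T = m)"
      by (rule maximal_subspace[of _ K, OF _ _ finite_Basis])
        (use sub_of_K sh(2) False subset_span_Basis in \<open>auto simp: sub_of_def\<close>)
    then obtain m where m: "sub_of m" "m \<subset> h" and max: "\<And>T. sub_of T \<and> T \<subset> h \<Longrightarrow> m \<subseteq> T \<Longrightarrow> T = m"
      by blast
    have sm: "subspace m" "K \<subseteq> m" "\<And>p q. p \<in> m \<Longrightarrow> q \<in> m \<Longrightarrow> p \<cdot> q \<in> m"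
      using m by (auto simp: sub_of_def)
    have dim: "dim m < dim h"
      using dim_psubset_in_finite_span[OF sm(1) m(2) subset_span_Basis finite_Basis] .
    have "\<exists>w\<in>h - m. \<forall>x\<in>m. x \<cdot> w \<in> m"
      by (rule less.hyps[OF dim m(1)]) (use sm sh m in auto)
    then obtain x where x: "x \<in> h" "x \<notin> m" "\<And>p. p \<in> m \<Longrightarrow> p \<cdot> x \<in> m" by blast
    have "sub_of (span (insert x m))" using sub_of_extend[OF m(1) _ x(3)] x(1) sh by blast
    moreover have "span (insert x m) \<subseteq> h" using sm sh x m by (intro subspace_extend) auto
    moreover have "m \<subseteq> span (insert x m)" "x \<in> span (insert x m)" by (auto intro: span_base)
    ultimately have h: "h = span (insert x m)" using max x(2) by blast
    have "\<exists>w\<in>V - U. \<forall>x\<in>m. x \<cdot> w \<in> U"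
      by (rule less.hyps[OF dim m(1)]) (use less.prems m in auto)
    then obtain w0 where w0: "w0 \<in> V" "w0 \<notin> U" "\<And>p. p \<in> m \<Longrightarrow> p \<cdot> w0 \<in> U" by blast
    have "\<exists>N. ((\<cdot>) x ^^ N) w0 \<in> U" using nil[of x w0] x sh less.prems w0 by blast
    \<comment> \<open>The last iterate of \<open>x\<close> on \<open>w0\<close> outside
      \<open>U\<close> is the vector sought: \<open>x\<close> sends it into \<open>U\<close>, and
      \<open>m\<close> still does because \<open>p \<cdot> x\<close> stays in
      \<open>m\<close>.\<close>
    then obtain N where N: "((\<cdot>) x ^^ N) w0 \<in> U" "\<And>k. k < N \<Longrightarrow> ((\<cdot>) x ^^ k) w0 \<notin> U"
      using exists_least_iff[of "\<lambda>N. ((\<cdot>) x ^^ N) w0 \<in> U"] by blast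
    then obtain k where k: "N = Suc k" using w0 by (cases N) auto
    define w where "w = ((\<cdot>) x ^^ k) w0"
    have "((\<cdot>) x ^^ k) w0 \<in> V \<and> (\<forall>p\<in>m. p \<cdot> ((\<cdot>) x ^^ k) w0 \<in> U)" for k
    proof (induction k)
      case 0
      then show ?case using w0 by simp
    next
      case (Suc k)
      let ?v = "((\<cdot>) x ^^ k) w0"
      have "p \<cdot> (x \<cdot> ?v) \<in> U" if p: "p \<in> m" for p
        unfolding left_leibniz[of p x ?v]
        using p x Suc less.prems by (intro subspace_add) auto
      then show ?case using Suc x less.prems by auto
    qed
    then have w: "w \<in> V" "\<And>p. p \<in> m \<Longrightarrow> p \<cdot> w \<in> U" by (auto simp: w_def)
    have "x \<cdot> w \<in> U" using N(1) by (simp add: k w_def)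
    then have "y \<cdot> w \<in> U" if "y \<in> h" for y
      using that w less.prems(2) unfolding h span_insert_subspace[OF sm(1)]
      by (auto simp: mult_linear intro!: subspace_add subspace_scale)
    moreover have "w \<notin> U" using N(2)[of k] by (simp add: k w_def)
    ultimately show ?thesis using w by blast
  qed
qed

text \<open>For a maximal proper stable \<open>U\<close>, Engel yields \<open>w\<close> outside
  \<open>U\<close> that \<open>E\<close> sends into \<open>U\<close>. Maximality makes
  \<open>E\<close> the span of \<open>w\<close> and \<open>U\<close>, so all products fall into
  \<open>U\<close>, against perfectness.\<close>

lemma perfect_nil_trivial:
  assumes perfect: "\<And>x. x \<in> E \<Longrightarrow> \<exists>y\<in>prod_space E E. x - y \<in> K"
  shows "E \<subseteq> K"
proof (rule ccontr)
  assume no: "\<not> E \<subseteq> K"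
  let ?Q = "\<lambda>U. subspace U \<and> K \<subseteq> U \<and> U \<subset> E \<and> (\<forall>x\<in>E. \<forall>u\<in>U. x \<cdot> u \<in> U)"
  have "\<exists>U. ?Q U \<and> (\<forall>T. ?Q T \<longrightarrow> U \<subseteq> T \<longrightarrow> T = U)"
    by (rule maximal_subspace[of ?Q K, OF _ _ finite_Basis]) (use K no subset_span_Basis in auto)
  then obtain U where U: "?Q U" and max: "\<forall>T. ?Q T \<longrightarrow> U \<subseteq> T \<longrightarrow> T = U"
    by (rule exE) (erule conjE, rule that)
  have "sub_of E" using E K by (auto simp: sub_of_def)
  then have "\<exists>w\<in>E - U. \<forall>x\<in>E. x \<cdot> w \<in> U"
    by (rule engel_vector) (use U E in auto)
  then obtain w where w: "w \<in> E" "w \<notin> U" "\<And>x. x \<in> E \<Longrightarrow> x \<cdot> w \<in> U" by blast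
  have sU: "subspace U" using U by simp
  have stab: "x \<cdot> y \<in> U" if "x \<in> E" "y \<in> span (insert w U)" for x y
    using that U w unfolding span_insert_subspace[OF sU]
    by (auto simp: mult_linear intro!: subspace_add subspace_scale)
  have sup: "U \<subseteq> span (insert w U)" "w \<in> span (insert w U)" by (auto intro: span_base)
  have sub: "span (insert w U) \<subseteq> E" using U E w by (intro subspace_extend) auto
  have "\<not> ?Q (span (insert w U))" using max[rule_format, OF _ sup(1)] sup(2) w(2) by auto
  moreover have "x \<cdot> u \<in> span (insert w U)" if "x \<in> E" "u \<in> span (insert w U)" for x u
    using stab[OF that] sup(1) by blast
  ultimately have "E = span (insert w U)" using sub sup U by auto
  then have "prod_space E E \<subseteq> U" using stab U by (intro prod_space_subset) auto
  have "E \<subseteq> U"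
  proof
    fix x assume "x \<in> E"
    then obtain y where "y \<in> prod_space E E" "x - y \<in> K" using perfect by blast
    then have "y \<in> U" "x - y \<in> U" using \<open>prod_space E E \<subseteq> U\<close> U by auto
    then have "y + (x - y) \<in> U" using sU by (intro subspace_add)
    then show "x \<in> U" by simp
  qed
  then show False using U by blast
qed

end

section \<open>Cartan's criterion\<close>

text \<open>Linearity is global, whereas the product rule is asked on \<open>E\<close> only: the
  matrices will describe the action on a quotient of subspaces that are stable just under
  \<open>E\<close>.\<close>

definition matrix_rep :: "nat \<Rightarrow> 'b set \<Rightarrow> ('b \<Rightarrow> 'a matrix) \<Rightarrow> bool" where
  "matrix_rep n E M \<longleftrightarrow>
    (\<forall>x y. agree n (M (x + y)) (\<lambda>i j. M x i j + M y i j)) \<and>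
    (\<forall>c x. agree n (M (c *s x)) (\<lambda>i j. c * M x i j)) \<and>
    (\<forall>x\<in>E. \<forall>y\<in>E. agree n (M (x \<cdot> y)) (mat_comm n (M x) (M y)))"

lemma matrix_repD:
  assumes "matrix_rep n E M"
  shows "agree n (M (x + y)) (\<lambda>i j. M x i j + M y i j)"
    "agree n (M (c *s x)) (\<lambda>i j. c * M x i j)"
    "x \<in> E \<Longrightarrow> y \<in> E \<Longrightarrow> agree n (M (x \<cdot> y)) (mat_comm n (M x) (M y))"
  using assms by (auto simp: matrix_rep_def)

lemma matrix_rep_subset: "matrix_rep n E M \<Longrightarrow> F \<subseteq> E \<Longrightarrow> matrix_rep n F M"
  unfolding matrix_rep_def by blast

context
  fixes E :: "'b set" and n :: nat and M :: "'b \<Rightarrow> 'a matrix"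
  assumes E: "subspace E" "\<And>x y. x \<in> E \<Longrightarrow> y \<in> E \<Longrightarrow> x \<cdot> y \<in> E"
    and M: "matrix_rep n E M"
    and orth: "\<And>x y. x \<in> E \<Longrightarrow> y \<in> E \<Longrightarrow> mat_tr n (mat_mul n (M x) (M y)) = 0"
    and perfect: "\<And>x. x \<in> E \<Longrightarrow> \<exists>y\<in>prod_space E E. x - y \<in> E \<and> agree n (M (x - y)) (\<lambda>i j. 0)"
begin

text \<open>The trace condition forces all eigenvalues of \<open>M x\<close> to vanish. Then ad of
  its triangular form is nilpotent, and so is multiplication by \<open>x\<close> modulo the kernel
  of \<open>M\<close>.\<close>

lemma ad_nilpotent_modulo_kernel:
  assumes x: "x \<in> E"
  shows "\<exists>N. \<forall>y\<in>E. agree n (M (((\<cdot>) x ^^ N) y)) (\<lambda>i j. 0)"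
proof -
  define M' where "M' y i j = to_ac (M y i j)" for y i j
  show ?thesis
  proof (rule triangular_conjugate[of n "M' x"])
    fix m and P Q :: "'a alg_closure matrix"
    assume PQ: "agree n (mat_mul m P Q) (\<lambda>i j. if i = j then 1 else 0)"
      and jord: "jordan_like m (conjugate n P Q (M' x))"
    define c where "c y = conjugate n P Q (M' y)" for y
    define J where "J = c x"
    interpret jordan_like m J using jord by (simp add: J_def c_def)
    have c_add: "c (y + z) = (\<lambda>i j. c y i j + c z i j)" for y z
    proof -
      have "agree n (M' (y + z)) (\<lambda>i j. M' y i j + M' z i j)"
        using matrix_repD(1)[OF M] by (simp add: agree_def M'_def)
      then show ?thesis unfolding c_def conjugate_linear[symmetric] by (rule conjugate_cong)
    qed
    have c_scale: "c (k *s y) = (\<lambda>i j. to_ac k * c y i j)" for y k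
    proof -
      have "agree n (M' (k *s y)) (\<lambda>i j. to_ac k * M' y i j)"
        using matrix_repD(2)[OF M] by (simp add: agree_def M'_def)
      then show ?thesis unfolding c_def conjugate_linear[symmetric] by (rule conjugate_cong)
    qed
    have mat_mul': "mat_mul n (M' y) (M' z) i j = to_ac (mat_mul n (M y) (M z) i j)" for y z i j
      by (simp add: mat_mul_def M'_def to_ac_sum)
    have c_mult: "c (y \<cdot> z) = mat_comm m (c y) (c z)" if "y \<in> E" "z \<in> E" for y z
    proof -
      have "agree n (M' (y \<cdot> z)) (mat_comm n (M' y) (M' z))"
        using matrix_repD(3)[OF M that] by (simp add: agree_def mat_comm_def mat_mul') (simp add: M'_def)
      then show ?thesis
        unfolding c_def conjugate_mat_comm[OF PQ] by (rule conjugate_cong)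
    qed
    have c_mat_tr: "mat_tr m (mat_mul m (c y) (c z)) = 0" if "y \<in> E" "z \<in> E" for y z
    proof -
      have "mat_tr m (mat_mul m (c y) (c z)) = mat_tr n (mat_mul n (M' y) (M' z))"
        unfolding c_def conjugate_mat_mul[OF PQ] mat_tr_conjugate[OF PQ] ..
      also have "\<dots> = to_ac (mat_tr n (mat_mul n (M y) (M z)))"
        by (simp add: mat_tr_def mat_mul' to_ac_sum)
      finally show ?thesis using orth that by simp
    qed
    txt \<open>For a \<open>\<rat>\<close>-linear \<open>\<phi>\<close> with rational values, applying \<open>\<phi>\<close> to \<open>\<Sum> J\<^sub>i\<^sub>i \<phi> (J\<^sub>i\<^sub>i) = 0\<close> gives
      \<open>\<Sum> \<phi> (J\<^sub>i\<^sub>i)\<^sup>2 = 0\<close>.\<close>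
    have diag0: "J i0 i0 = 0" if i0: "i0 < m" for i0
    proof (rule ccontr)
      assume "J i0 i0 \<noteq> 0"
      then obtain \<phi> :: "'a alg_closure \<Rightarrow> rat" where \<phi>: "\<phi> (J i0 i0) \<noteq> 0"
        "\<And>x y. \<phi> (x + y) = \<phi> x + \<phi> y" "\<And>x y. \<phi> (x - y) = \<phi> x - \<phi> y"
        "\<And>q x. \<phi> (of_rat q * x) = q * \<phi> x"
        using rational_functional by blast
      have \<phi>0: "\<phi> 0 = 0" using \<phi>(3)[of 0 0] by simp
      \<comment> \<open>The trace of \<open>c v\<close> times the diagonal matrix of the
        \<open>\<phi> (J i i)\<close>. It vanishes on products by
        \<open>weighted_trace_mat_comm\<close>, hence at \<open>x\<close>, which by perfectness has
        the same matrix as a combination of products.\<close>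
      define g where "g v = (\<Sum>i<m. c v i i * of_rat (\<phi> (J i i)))" for v
      have "y \<cdot> z \<in> {v \<in> E. g v = 0}" if yz: "y \<in> E" "z \<in> E" for y z
      proof -
        have "(\<Sum>i<m. mat_comm m (c y) (c z) i i * of_rat (\<phi> (J i i))) = 0"
        proof (rule weighted_trace_mat_comm[where S = "c ` E"])
          show "\<exists>B\<in>c ` E. agree m (mat_comm m A J) B" if "A \<in> c ` E" for A
            using that E x c_mult by (force simp: J_def agree_def)
        qed (use yz c_mat_tr in \<open>auto simp: \<phi> of_rat_diff\<close>)
        then show ?thesis using yz E by (simp add: g_def c_mult)
      qed
      moreover have "subspace {v \<in> E. g v = 0}"
      proof (rule subspaceI)
        have "c 0 = (\<lambda>i j. 0)" using c_scale[of 0 0] subspace_0[OF E(1)] by simp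
        then show "0 \<in> {v \<in> E. g v = 0}" using subspace_0[OF E(1)] by (simp add: g_def)
      next
        fix y z assume "y \<in> {v \<in> E. g v = 0}" "z \<in> {v \<in> E. g v = 0}"
        then show "y + z \<in> {v \<in> E. g v = 0}"
          using subspace_add[OF E(1)] by (simp add: g_def c_add distrib_right sum.distrib)
      next
        fix k y assume "y \<in> {v \<in> E. g v = 0}"
        then show "k *s y \<in> {v \<in> E. g v = 0}"
          using subspace_scale[OF E(1)]
          by (simp add: g_def c_scale mult.assoc flip: sum_distrib_left)
      qed
      ultimately have prod: "prod_space E E \<subseteq> {v \<in> E. g v = 0}"
        by (intro prod_space_subset) blast+
      obtain y where y: "y \<in> prod_space E E" "x - y \<in> E" "agree n (M (x - y)) (\<lambda>i j. 0)"
        using perfect[OF x] by blast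
      have "conjugate n P Q (M' (x - y)) = conjugate n P Q (\<lambda>i j. 0)"
        using y(3) by (intro conjugate_cong) (simp add: agree_def M'_def)
      then have "c (x - y) = (\<lambda>i j. 0)"
        by (simp add: c_def conjugate_def mat_mul_def fun_eq_iff)
      moreover have "c (y + (x - y)) = (\<lambda>i j. c y i j + c (x - y) i j)"
        by (rule c_add)
      ultimately have "c x = c y" by simp
      then have "g x = 0" using prod y(1) by (auto simp: g_def)
      then have "\<phi> (\<Sum>i<m. of_rat (\<phi> (J i i)) * J i i) = 0"
        by (simp add: g_def J_def \<phi>0 mult.commute)
      moreover have "\<phi> (sum h S) = (\<Sum>i\<in>S. \<phi> (h i))" for h and S :: "nat set"
        by (induction S rule: infinite_finite_induct) (auto simp: \<phi>0 \<phi>)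
      ultimately have "(\<Sum>i<m. \<phi> (J i i) * \<phi> (J i i)) = 0" by (simp add: \<phi>)
      then have "\<phi> (J i0 i0) * \<phi> (J i0 i0) = 0"
        using i0 by (subst (asm) sum_nonneg_eq_0_iff) auto
      then show False using \<phi>(1) by simp
    qed
    have ad0: "ad_shift m J 0 = mat_comm m J" by (simp add: ad_shift_def fun_eq_iff)
    have "agree n (M (((\<cdot>) x ^^ (2 * m)) y)) (\<lambda>i j. 0)" if y: "y \<in> E" for y
    proof -
      have "((\<cdot>) x ^^ k) y \<in> E \<and> (ad_shift m J 0 ^^ k) (c y) = c (((\<cdot>) x ^^ k) y)" for k
        by (induction k) (use x y E in \<open>auto simp: ad0[unfolded J_def] c_mult J_def\<close>)
      \<comment> \<open>With zero diagonal, every matrix has weight 0.\<close>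
      moreover have "agree m ((ad_shift m J 0 ^^ (2 * m)) (c y)) (\<lambda>i j. 0)"
        by (rule ad_shift_nilpotent) (auto simp: graded_def diag0)
      ultimately have "agree m (conjugate n P Q (M' (((\<cdot>) x ^^ (2 * m)) y))) (\<lambda>i j. 0)"
        by (simp add: c_def)
      then have "agree n (M' (((\<cdot>) x ^^ (2 * m)) y)) (\<lambda>i j. 0)"
        by (rule conjugate_eq_0D[OF PQ])
      then show ?thesis by (simp add: agree_def M'_def)
    qed
    then show ?thesis by blast
  qed
qed

text \<open>The classical conclusion is solubility; for a perfect image only triviality is left.
  Modulo the kernel of \<open>M\<close> the product is antisymmetric, since products go to
  commutators, and left multiplications are nilpotent, so the consequence of Engel's theorem
  applies.\<close>

theorem cartan_criterion:
  assumes "x \<in> E"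
  shows "agree n (M x) (\<lambda>i j. 0)"
proof -
  define K where "K = {x \<in> E. agree n (M x) (\<lambda>i j. 0)}"
  have M0: "agree n (M 0) (\<lambda>i j. 0)"
    using matrix_repD(2)[OF M, of 0 0] subspace_0[OF E(1)] by (simp add: agree_def)
  have sK: "subspace K"
  proof (rule subspaceI)
    show "0 \<in> K" using M0 subspace_0[OF E(1)] by (simp add: K_def)
  next
    fix y z assume "y \<in> K" "z \<in> K"
    then show "y + z \<in> K"
      using matrix_repD(1)[OF M, of y z] subspace_add[OF E(1)] by (auto simp: K_def agree_def)
  next
    fix k y assume "y \<in> K"
    then show "k *s y \<in> K"
      using matrix_repD(2)[OF M, of k y] subspace_scale[OF E(1)] by (auto simp: K_def agree_def)
  qed
  have M_mult: "agree n (M (y \<cdot> z)) (\<lambda>i j. 0)"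
    if "y \<in> E" "z \<in> E" "agree n (M y) (\<lambda>i j. 0) \<or> agree n (M z) (\<lambda>i j. 0)" for y z
    using matrix_repD(3)[OF M that(1,2)] that(3) by (auto simp: agree_def mat_comm_def mat_mul_def)
  have "E \<subseteq> K"
  proof (rule perfect_nil_trivial)
    show "y \<cdot> z + z \<cdot> y \<in> K" if yz: "y \<in> E" "z \<in> E" for y z
    proof -
      have "agree n (M (y \<cdot> z + z \<cdot> y)) (\<lambda>i j. M (y \<cdot> z) i j + M (z \<cdot> y) i j)"
        by (rule matrix_repD(1)[OF M])
      then show ?thesis
        using matrix_repD(3)[OF M yz] matrix_repD(3)[OF M yz(2,1)] yz E subspace_add[OF E(1)]
        by (auto simp: agree_def mat_comm_def K_def)
    qed
    show "\<exists>N. ((\<cdot>) y ^^ N) z \<in> K" if yz: "y \<in> E" "z \<in> E" for y z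
    proof -
      have "((\<cdot>) y ^^ N) z \<in> E" for N by (induction N) (use yz E in auto)
      then show ?thesis using ad_nilpotent_modulo_kernel[OF yz(1)] yz(2) by (auto simp: K_def)
    qed
    show "\<exists>z\<in>prod_space E E. y - z \<in> K" if "y \<in> E" for y
      using perfect[OF that] by (auto simp: K_def)
  qed (use E sK M_mult in \<open>auto simp: K_def\<close>)
  then show ?thesis using assms by (auto simp: K_def)
qed

end

section \<open>Ideals, derived series and perfectness\<close>

lemma ideal_ofD:
  assumes "ideal_of A I"
  shows "subspace I" "I \<subseteq> A" "a \<in> A \<Longrightarrow> x \<in> I \<Longrightarrow> a \<cdot> x \<in> I" "a \<in> A \<Longrightarrow> x \<in> I \<Longrightarrow> x \<cdot> a \<in> I"
  using assms by (auto simp: ideal_of_def)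

lemma ideal_ofI:
  assumes "subspace I" "I \<subseteq> A" "\<And>a x. a \<in> A \<Longrightarrow> x \<in> I \<Longrightarrow> a \<cdot> x \<in> I"
    "\<And>a x. a \<in> A \<Longrightarrow> x \<in> I \<Longrightarrow> x \<cdot> a \<in> I"
  shows "ideal_of A I"
  using assms by (auto simp: ideal_of_def)

lemma subalgebraD:
  assumes "subalgebra A"
  shows "subspace A" "x \<in> A \<Longrightarrow> y \<in> A \<Longrightarrow> x \<cdot> y \<in> A"
  using assms by (auto simp: subalgebra_def)

lemma prod_space_ideal_subset: "ideal_of A K \<Longrightarrow> prod_space K K \<subseteq> K"
  by (intro prod_space_subset) (auto simp: ideal_of_def)

lemma ideal_of_prod_space:
  assumes K: "ideal_of A K"
  shows "ideal_of A (prod_space K K)"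
proof (rule ideal_ofI)
  show "prod_space K K \<subseteq> A" using prod_space_ideal_subset[OF K] ideal_ofD(2)[OF K] by blast
  fix a x assume a: "a \<in> A" and "x \<in> prod_space K K"
  have "subspace {x. a \<cdot> x \<in> prod_space K K \<and> x \<cdot> a \<in> prod_space K K}"
    by (rule subspaceI)
      (auto simp: mult_linear intro: subspace_add subspace_scale subspace_0 subspace_prod_space)
  moreover have "a \<cdot> (y \<cdot> z) \<in> prod_space K K \<and> (y \<cdot> z) \<cdot> a \<in> prod_space K K"
    if yz: "y \<in> K" "z \<in> K" for y z
  proof
    show "a \<cdot> (y \<cdot> z) \<in> prod_space K K"
      unfolding left_leibniz[of a y z] using a yz ideal_ofD[OF K]
      by (intro subspace_add subspace_prod_space prod_space_mem) auto
    have "(y \<cdot> z) \<cdot> a = y \<cdot> (z \<cdot> a) - z \<cdot> (y \<cdot> a)"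
      using left_leibniz[of y z a] by simp
    also have "\<dots> \<in> prod_space K K"
      using a yz ideal_ofD[OF K]
      by (intro subspace_diff subspace_prod_space prod_space_mem) auto
    finally show "(y \<cdot> z) \<cdot> a \<in> prod_space K K" .
  qed
  ultimately have "prod_space K K \<subseteq> {x. a \<cdot> x \<in> prod_space K K \<and> x \<cdot> a \<in> prod_space K K}"
    by (intro prod_space_subset) auto
  then show "a \<cdot> x \<in> prod_space K K" "x \<cdot> a \<in> prod_space K K"
    using \<open>x \<in> prod_space K K\<close> by auto
qed (rule subspace_prod_space)

lemma ideal_of_derived_series: "ideal_of A K \<Longrightarrow> ideal_of A (derived_series K n)"
  by (induction n) (auto intro: ideal_of_prod_space)

text \<open>Dimensions cannot drop forever. The stationary term is perfect, and in that form
  Cartan's criterion applies to it.\<close>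

lemma derived_series_stationary:
  assumes "ideal_of A K"
  obtains n where "prod_space (derived_series K n) (derived_series K n) = derived_series K n"
proof -
  obtain n where n: "\<And>m. dim (derived_series K n) \<le> dim (derived_series K m)"
    using ex_has_least_nat[of "\<lambda>_. True" 0 "\<lambda>n. dim (derived_series K n)"] by auto
  have "prod_space (derived_series K n) (derived_series K n) \<subseteq> derived_series K n"
    using prod_space_ideal_subset ideal_of_derived_series assms by blast
  then have "prod_space (derived_series K n) (derived_series K n) = derived_series K n"
    using dim_psubset_in_finite_span[OF subspace_prod_space _ subset_span_Basis finite_Basis,
        of "derived_series K n" "derived_series K n" "derived_series K n"] n[of "Suc n"] by auto
  then show ?thesis by (rule that)
qed

text \<open>Elements of \<open>A'\<close> come from \<open>B\<close> up to an error in
  \<open>I\<close>, and \<open>I\<close> absorbs the error on either side. This lifts ideals of a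
  complement \<open>B\<close> to the whole algebra.\<close>

lemma ideal_of_plus:
  assumes "ideal_of A I" "ideal_of B J" "\<And>a. a \<in> A' \<Longrightarrow> \<exists>b\<in>B. a - b \<in> I" "I \<subseteq> A'" "B \<subseteq> A'"
    "J \<subseteq> A" "A' \<subseteq> A" "subspace A'"
  shows "ideal_of A' (J + I)"
proof (rule ideal_ofI)
  show "subspace (J + I)" using assms by (intro subspace_plus) (auto simp: ideal_of_def)
  show "J + I \<subseteq> A'"
    using assms ideal_ofD(2)[OF assms(2)] by (auto simp: set_plus_def intro!: subspace_add)
next
  fix a x assume a: "a \<in> A'" and x: "x \<in> J + I"
  obtain b where b: "b \<in> B" "a - b \<in> I" using assms(3)[OF a] by blast
  obtain j i where ji: "x = j + i" "j \<in> J" "i \<in> I" using x by (rule set_plus_elim)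
  have "a \<cdot> x = b \<cdot> j + ((a - b) \<cdot> j + a \<cdot> i)" "x \<cdot> a = j \<cdot> b + (j \<cdot> (a - b) + i \<cdot> a)"
    by (simp_all add: ji mult_linear)
  moreover have "(a - b) \<cdot> j + a \<cdot> i \<in> I" "j \<cdot> (a - b) + i \<cdot> a \<in> I"
  proof -
    have "a \<in> A" "j \<in> A" using a ji assms(6,7) by auto
    then show "(a - b) \<cdot> j + a \<cdot> i \<in> I" "j \<cdot> (a - b) + i \<cdot> a \<in> I"
      using ji(3) b(2) ideal_ofD(3,4)[OF assms(1)] by (auto intro!: subspace_add[OF ideal_ofD(1)[OF assms(1)]])
  qed
  ultimately show "a \<cdot> x \<in> J + I" "x \<cdot> a \<in> J + I"
    using b(1) ji(2) ideal_ofD(3,4)[OF assms(2)] by (auto intro!: set_plus_intro)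
qed

text \<open>For \<open>I\<close> inside \<open>K\<close>, this is perfectness of K / I.\<close>

definition perfect_over :: "'b set \<Rightarrow> 'b set \<Rightarrow> bool" where
  "perfect_over I K \<longleftrightarrow> (\<forall>x\<in>K. \<exists>y\<in>prod_space K K. x - y \<in> I)"

section \<open>Trace forms\<close>

definition trace_form :: "nat \<Rightarrow> ('b \<Rightarrow> 'a matrix) \<Rightarrow> 'b \<Rightarrow> 'b \<Rightarrow> 'a" where
  "trace_form n M x y = mat_tr n (mat_mul n (M x) (M y))"

lemma trace_form_commute: "trace_form n M x y = trace_form n M y x"
  by (simp add: trace_form_def mat_tr_mat_mul_commute)

context
  fixes n :: nat and M :: "'b \<Rightarrow> 'a matrix" and A :: "'b set"
  assumes M: "matrix_rep n A M"
begin

lemma trace_form_linear_right: "Vector_Spaces.linear scale (*) (trace_form n M z)"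
proof -
  have "trace_form n M z (x + y) = trace_form n M z x + trace_form n M z y" for x y
    using mat_tr_mat_mul_cong[of n "M z" "M z", OF _ matrix_repD(1)[OF M, of x y]]
    by (simp add: trace_form_def agree_def mat_mul_linear mat_tr_add)
  moreover have "trace_form n M z (c *s x) = c * trace_form n M z x" for c x
    using mat_tr_mat_mul_cong[of n "M z" "M z", OF _ matrix_repD(2)[OF M, of c x]]
    by (simp add: trace_form_def agree_def mat_mul_linear mat_tr_scale)
  moreover have "vector_space ((*) :: 'a \<Rightarrow> 'a \<Rightarrow> 'a)" by unfold_locales (auto simp: algebra_simps)
  ultimately show ?thesis using vector_space_axioms by (simp add: Vector_Spaces.linear_iff)
qed

lemma trace_form_linear_left: "Vector_Spaces.linear scale (*) (\<lambda>x. trace_form n M x z)"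
proof -
  have "(\<lambda>x. trace_form n M x z) = trace_form n M z" by (intro ext trace_form_commute)
  then show ?thesis using trace_form_linear_right[of z] by simp
qed

lemmas trace_form_simps = linear_functional_simps[OF trace_form_linear_right]
  linear_functional_simps[OF trace_form_linear_left]

lemma trace_form_assoc:
  assumes "x \<in> A" "y \<in> A" "z \<in> A"
  shows "trace_form n M (x \<cdot> y) z = trace_form n M x (y \<cdot> z)"
proof -
  have "trace_form n M (x \<cdot> y) z = mat_tr n (mat_mul n (mat_comm n (M x) (M y)) (M z))"
    unfolding trace_form_def using matrix_repD(3)[OF M assms(1,2)]
    by (intro mat_tr_mat_mul_cong) (auto simp: agree_def)
  also have "\<dots> = mat_tr n (mat_mul n (M x) (mat_comm n (M y) (M z)))" by (rule mat_tr_mat_comm)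
  also have "\<dots> = trace_form n M x (y \<cdot> z)"
    unfolding trace_form_def using matrix_repD(3)[OF M assms(2,3)]
    by (intro mat_tr_mat_mul_cong) (auto simp: agree_def)
  finally show ?thesis .
qed

lemma trace_form_skew:
  assumes "x \<in> A" "y \<in> A" "z \<in> A"
  shows "trace_form n M (x \<cdot> y) z = - trace_form n M y (x \<cdot> z)"
proof -
  have "trace_form n M (x \<cdot> y) z = mat_tr n (mat_mul n (\<lambda>i j. - 1 * M (y \<cdot> x) i j) (M z))"
    unfolding trace_form_def using matrix_repD(3)[OF M assms(1,2)] matrix_repD(3)[OF M assms(2,1)]
    by (intro mat_tr_mat_mul_cong) (auto simp: agree_def mat_comm_def)
  also have "\<dots> = - trace_form n M (y \<cdot> x) z"
    unfolding mat_mul_linear mat_tr_scale by (simp add: trace_form_def)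
  finally show ?thesis using trace_form_assoc assms by simp
qed

lemma zero_matrix_trace_form: "agree n (M x) (\<lambda>i j. 0) \<Longrightarrow> trace_form n M x y = 0"
  using mat_tr_mat_mul_cong[of n "M x" "\<lambda>i j. 0" "M y" "M y"]
  by (auto simp: trace_form_def agree_def mat_mul_def mat_tr_def)

text \<open>Without antisymmetry each side uses its own invariance: \<open>trace_form_skew\<close>
  for left products, \<open>trace_form_assoc\<close> for right ones. Both move \<open>a\<close> over
  to \<open>L\<close>.\<close>

lemma form_perp_ideal:
  assumes A: "subalgebra A" and K: "ideal_of A K" and L: "ideal_of A L"
  shows "ideal_of A {x \<in> K. \<forall>y\<in>L. trace_form n M x y = 0}"
proof (rule ideal_ofI)
  show "subspace {x \<in> K. \<forall>y\<in>L. trace_form n M x y = 0}"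
    using ideal_ofD(1)[OF K]
    by (intro subspaceI) (auto simp: trace_form_simps subspace_0 subspace_add subspace_scale)
  fix a x assume a: "a \<in> A" and x: "x \<in> {x \<in> K. \<forall>y\<in>L. trace_form n M x y = 0}"
  have "trace_form n M (a \<cdot> x) y = 0 \<and> trace_form n M (x \<cdot> a) y = 0" if "y \<in> L" for y
  proof -
    have "x \<in> A" "y \<in> A" using x that ideal_ofD(2)[OF K] ideal_ofD(2)[OF L] by auto
    then show ?thesis
      using a x ideal_ofD(3)[OF L a that] trace_form_skew[of a x y] trace_form_assoc[of x a y] by auto
  qed
  then show "a \<cdot> x \<in> {x \<in> K. \<forall>y\<in>L. trace_form n M x y = 0}"
    "x \<cdot> a \<in> {x \<in> K. \<forall>y\<in>L. trace_form n M x y = 0}"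
    using a x ideal_ofD[OF K] by auto
qed (use ideal_ofD[OF K] in auto)

end

end

section \<open>Modules\<close>

text \<open>Only a left action is given, which makes this a module in the Lie sense. The laws are
  asked on \<open>V\<close>, because the carrier type may be larger than the module.\<close>

locale leibniz_module = fd_leibniz_algebra scale mult Basis + W: vector_space scaleW
  for scale :: "'a::field_char_0 \<Rightarrow> 'b::ab_group_add \<Rightarrow> 'b" (infixr \<open>*s\<close> 75)
    and mult :: "'b \<Rightarrow> 'b \<Rightarrow> 'b" (infixl \<open>\<cdot>\<close> 70)
    and Basis :: "'b set"
    and scaleW :: "'a \<Rightarrow> 'w::ab_group_add \<Rightarrow> 'w" (infixr \<open>*w\<close> 75) +
  fixes act :: "'b \<Rightarrow> 'w \<Rightarrow> 'w" (infixr \<open>\<triangleright>\<close> 70)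
    and V F :: "'w set"
  assumes V: "W.subspace V" "V \<subseteq> W.span F" "finite F"
    and act_closed: "w \<in> V \<Longrightarrow> x \<triangleright> w \<in> V"
    and act_add: "v \<in> V \<Longrightarrow> w \<in> V \<Longrightarrow> x \<triangleright> (v + w) = x \<triangleright> v + x \<triangleright> w"
    and act_scale: "w \<in> V \<Longrightarrow> x \<triangleright> (c *w w) = c *w (x \<triangleright> w)"
    and add_act: "w \<in> V \<Longrightarrow> (x + y) \<triangleright> w = x \<triangleright> w + y \<triangleright> w"
    and scale_act: "w \<in> V \<Longrightarrow> (c *s x) \<triangleright> w = c *w (x \<triangleright> w)"
    and mult_act: "w \<in> V \<Longrightarrow> (x \<cdot> y) \<triangleright> w = x \<triangleright> (y \<triangleright> w) - y \<triangleright> (x \<triangleright> w)"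
begin

lemma act_zero: "x \<triangleright> 0 = 0"
  using act_scale[of 0 x 0] W.subspace_0[OF V(1)] by simp

lemma zero_act: "w \<in> V \<Longrightarrow> 0 \<triangleright> w = 0"
  using scale_act[of w 0 0] by simp

lemma act_diff: "v \<in> V \<Longrightarrow> w \<in> V \<Longrightarrow> x \<triangleright> (v - w) = x \<triangleright> v - x \<triangleright> w"
  using act_add[of "v - w" w x] W.subspace_diff[OF V(1)] by simp

lemma diff_act: "w \<in> V \<Longrightarrow> (x - y) \<triangleright> w = x \<triangleright> w - y \<triangleright> w"
  using add_act[of w "x - y" y] by simp

lemma act_sum: "(\<And>i. i \<in> S \<Longrightarrow> f i \<in> V) \<Longrightarrow> x \<triangleright> (\<Sum>i\<in>S. f i) = (\<Sum>i\<in>S. x \<triangleright> f i)"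
proof (induction S rule: infinite_finite_induct)
  case (insert i S)
  then have "(\<Sum>i\<in>S. f i) \<in> V" by (intro W.subspace_sum[OF V(1)]) auto
  then show ?case using insert by (simp add: act_add)
qed (simp_all add: act_zero)

lemma sum_act: "w \<in> V \<Longrightarrow> (\<Sum>i\<in>S. f i) \<triangleright> w = (\<Sum>i\<in>S. f i \<triangleright> w)"
  by (induction S rule: infinite_finite_induct) (simp_all add: zero_act add_act)

definition stable :: "'b set \<Rightarrow> 'w set \<Rightarrow> bool" where
  "stable A U \<longleftrightarrow> W.subspace U \<and> U \<subseteq> V \<and> (\<forall>x\<in>A. \<forall>u\<in>U. x \<triangleright> u \<in> U)"

lemma stableD:
  assumes "stable A U"
  shows "W.subspace U" "U \<subseteq> V" "u \<in> U \<Longrightarrow> u \<in> V" "x \<in> A \<Longrightarrow> u \<in> U \<Longrightarrow> x \<triangleright> u \<in> U"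
  using assms by (auto simp: stable_def)

text \<open>\<open>(x \<cdot> y) \<triangleright> w\<close> is a difference of two double actions,
  each passing through \<open>U\<close> into \<open>P\<close>. So products in \<open>K\<close> kill
  \<open>w\<close> modulo \<open>P\<close>, as does \<open>I\<close>, and together they exhaust
  \<open>K\<close>.\<close>

lemma perfect_act_trivial:
  assumes w: "w \<in> V" and P: "W.subspace P"
    and U: "\<And>x. x \<in> K \<Longrightarrow> x \<triangleright> w \<in> U" "\<And>x u. x \<in> K \<Longrightarrow> u \<in> U \<Longrightarrow> x \<triangleright> u \<in> P"
    and I: "\<And>x. x \<in> I \<Longrightarrow> x \<triangleright> w \<in> P"
    and K: "perfect_over I K" and x: "x \<in> K"
  shows "x \<triangleright> w \<in> P"
proof -
  have "subspace {x. x \<triangleright> w \<in> P}"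
    by (rule subspaceI)
      (use w P in \<open>auto simp: zero_act add_act scale_act W.subspace_0 W.subspace_add W.subspace_scale\<close>)
  moreover have "(x \<cdot> y) \<triangleright> w \<in> P" if "x \<in> K" "y \<in> K" for x y
    using that U by (auto simp: mult_act w intro!: W.subspace_diff[OF P])
  ultimately have prod: "prod_space K K \<subseteq> {x. x \<triangleright> w \<in> P}" by (intro prod_space_subset) auto
  obtain y where y: "y \<in> prod_space K K" "x - y \<in> I" using K x by (auto simp: perfect_over_def)
  have "y \<triangleright> w + (x - y) \<triangleright> w \<in> P" using y prod I by (intro W.subspace_add[OF P]) auto
  then show ?thesis by (simp add: diff_act w)
qed

text \<open>The matrix of \<open>x\<close> on U / P when \<open>b\<close> and \<open>co\<close> are
  coordinates of \<open>U\<close> modulo \<open>P\<close>.\<close>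

definition rep :: "(nat \<Rightarrow> 'w) \<Rightarrow> (nat \<Rightarrow> 'w \<Rightarrow> 'a) \<Rightarrow> 'b \<Rightarrow> 'a matrix" where
  "rep b co x i j = co i (x \<triangleright> b j)"

context
  fixes A :: "'b set" and U P :: "'w set" and n b co
  assumes A: "subalgebra A" and U: "stable A U" and P: "stable A P" "P \<subseteq> U"
    and co: "W.coordinates_modulo P U n b co"
begin

lemma coordinates_act:
  assumes x: "x \<in> A" and u: "u \<in> U" and i: "i < n"
  shows "co i (x \<triangleright> u) = (\<Sum>k<n. rep b co x i k * co k u)"
proof -
  have bV: "b k \<in> V" if "k < n" for k
    using W.coordinates_moduloD(1)[OF co that] stableD(2)[OF U] by blast
  have sbV: "co k u *w b k \<in> V" if "k < n" for k using bV[OF that] W.subspace_scale[OF V(1)] by blast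
  define s where "s = (\<Sum>k<n. co k u *w b k)"
  have sV: "s \<in> V" unfolding s_def using sbV by (intro W.subspace_sum[OF V(1)]) auto
  have "x \<triangleright> (u - s) \<in> P"
    using W.coordinates_moduloD(5)[OF co u] x stableD(4)[OF P(1)] by (simp add: s_def)
  then have "co i (x \<triangleright> u - x \<triangleright> s) = 0"
    using W.coordinates_moduloD(3)[OF co i] u stableD(2)[OF U] sV by (auto simp: act_diff)
  moreover have "x \<triangleright> s = (\<Sum>k<n. co k u *w (x \<triangleright> b k))"
    unfolding s_def using sbV bV by (subst act_sum) (auto simp: act_scale)
  ultimately show ?thesis
    by (simp add: W.linear_functional_simps[OF W.coordinates_moduloD(2)[OF co]] rep_def mult.commute)
qed

lemma mat_mul_rep:
  assumes "x \<in> A" "y \<in> A" "i < n" "j < n"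
  shows "mat_mul n (rep b co x) (rep b co y) i j = co i (x \<triangleright> (y \<triangleright> b j))"
proof -
  have "y \<triangleright> b j \<in> U"
    using W.coordinates_moduloD(1)[OF co assms(4)] assms stableD(4)[OF U] by blast
  then show ?thesis using assms by (simp add: coordinates_act mat_mul_def) (simp add: rep_def)
qed

lemma matrix_rep_rep: "matrix_rep n A (rep b co)"
proof -
  note lin = W.linear_functional_simps[OF W.coordinates_moduloD(2)[OF co]]
  have bV: "b k \<in> V" if "k < n" for k
    using W.coordinates_moduloD(1)[OF co that] stableD(2)[OF U] by blast
  show ?thesis
    unfolding matrix_rep_def
  proof (intro conjI allI ballI agreeI)
    show "rep b co (x \<cdot> y) i j = mat_comm n (rep b co x) (rep b co y) i j"
      if "x \<in> A" "y \<in> A" "i < n" "j < n" for x y i j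
      using that by (simp add: mat_comm_def mat_mul_rep) (simp add: rep_def mult_act bV lin)
  qed (auto simp: rep_def add_act scale_act bV lin)
qed

lemma rep_zero_iff:
  assumes x: "x \<in> A"
  shows "agree n (rep b co x) (\<lambda>i j. 0) \<longleftrightarrow> (\<forall>u\<in>U. x \<triangleright> u \<in> P)"
proof
  assume z: "agree n (rep b co x) (\<lambda>i j. 0)"
  show "\<forall>u\<in>U. x \<triangleright> u \<in> P"
  proof
    fix u assume u: "u \<in> U"
    have "x \<triangleright> u \<in> U" using x u stableD(4)[OF U] by blast
    from W.coordinates_moduloD(5)[OF co this] show "x \<triangleright> u \<in> P"
      using z by (simp add: coordinates_act[OF x u] agree_def)
  qed
next
  assume "\<forall>u\<in>U. x \<triangleright> u \<in> P"
  then show "agree n (rep b co x) (\<lambda>i j. 0)"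
    using W.coordinates_moduloD(1,3)[OF co] by (auto simp: agree_def rep_def)
qed

lemma rep_kernel_ideal: "ideal_of A {x \<in> A. \<forall>u\<in>U. x \<triangleright> u \<in> P}"
proof -
  note sP = stableD(1)[OF P(1)]
  have UV: "u \<in> V" if "u \<in> U" for u using that stableD(3)[OF U] by blast
  show ?thesis
  proof (rule ideal_ofI)
    show "subspace {x \<in> A. \<forall>u\<in>U. x \<triangleright> u \<in> P}"
      using subalgebraD(1)[OF A] sP UV
      by (intro subspaceI) (auto simp: zero_act add_act scale_act subspace_0 subspace_add
          subspace_scale W.subspace_0 W.subspace_add W.subspace_scale)
  next
    fix a x assume a: "a \<in> A" and x: "x \<in> {x \<in> A. \<forall>u\<in>U. x \<triangleright> u \<in> P}"
    have 1: "a \<triangleright> (x \<triangleright> u) \<in> P" if "u \<in> U" for u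
      using a x that stableD(4)[OF P(1)] by blast
    have 2: "x \<triangleright> (a \<triangleright> u) \<in> P" if "u \<in> U" for u
      using a x that stableD(4)[OF U] by blast
    show "a \<cdot> x \<in> {x \<in> A. \<forall>u\<in>U. x \<triangleright> u \<in> P}" "x \<cdot> a \<in> {x \<in> A. \<forall>u\<in>U. x \<triangleright> u \<in> P}"
      using a x subalgebraD(2)[OF A] by (auto simp: mult_act UV 1 2 intro!: W.subspace_diff[OF sP])
  qed auto
qed

end

section \<open>The Casimir operator and Whitehead's lemma\<close>

context
  fixes A I :: "'b set"
  assumes A: "subalgebra A" and I: "ideal_of A I"
    and perfect: "\<And>K. ideal_of A K \<Longrightarrow> I \<subseteq> K \<Longrightarrow> perfect_over I K"
begin

text \<open>On A / K the trace form is non-degenerate, so the coordinate functionals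
  \<open>ce i\<close> are represented by a dual basis \<open>f\<close>. The last clause expands
  \<open>y\<close> in it modulo \<open>K\<close>.\<close>

lemma dual_family:
  assumes M: "matrix_rep n A M" and K: "ideal_of A K"
    and rad: "\<And>x. x \<in> A \<Longrightarrow> (\<And>y. y \<in> A \<Longrightarrow> trace_form n M x y = 0) \<Longrightarrow> x \<in> K"
    and rad': "\<And>x y. x \<in> K \<Longrightarrow> trace_form n M x y = 0"
    and ce: "local.coordinates_modulo K A m e ce"
  shows "\<exists>f. (\<forall>i<m. f i \<in> A) \<and> (\<forall>i<m. \<forall>x\<in>A. trace_form n M (f i) x = ce i x)
    \<and> (\<forall>y\<in>A. y - (\<Sum>j<m. trace_form n M y (e j) *s f j) \<in> K)"
proof -
  note sA = subalgebraD(1)[OF A]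
  note tf = trace_form_simps[OF M]
  have "\<forall>i<m. \<exists>z\<in>A. \<forall>x\<in>A. ce i x = trace_form n M z x"
  proof (intro allI impI)
    fix i assume i: "i < m"
    show "\<exists>z\<in>A. \<forall>x\<in>A. ce i x = trace_form n M z x"
    proof (rule functional_represented[OF sA subset_span_Basis finite_Basis])
      show "Vector_Spaces.linear scale (*) (ce i)" by (rule coordinates_moduloD(2)[OF ce])
      show "ce i x = 0" if "x \<in> A" "\<And>z. z \<in> A \<Longrightarrow> trace_form n M z x = 0" for x
      proof -
        have "x \<in> K" by (rule rad[OF that(1)]) (simp add: trace_form_commute[of n M x] that(2))
        then show ?thesis by (rule coordinates_moduloD(3)[OF ce i])
      qed
    qed (simp_all add: tf)
  qed
  then obtain f where f: "\<And>i. i < m \<Longrightarrow> f i \<in> A"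
    "\<And>i x. i < m \<Longrightarrow> x \<in> A \<Longrightarrow> ce i x = trace_form n M (f i) x"
    by metis
  have eA: "e i \<in> A" if "i < m" for i using coordinates_moduloD(1)[OF ce that] .
  have "y - (\<Sum>j<m. trace_form n M y (e j) *s f j) \<in> K" if y: "y \<in> A" for y
  proof (rule rad)
    show "y - (\<Sum>j<m. trace_form n M y (e j) *s f j) \<in> A"
      using y f sA by (intro subspace_diff subspace_sum subspace_scale) auto
    fix z assume z: "z \<in> A"
    \<comment> \<open>\<open>d\<close> is orthogonal to every \<open>e k\<close> and to
      \<open>K\<close>, and these span \<open>A\<close>.\<close>
    define d where "d = y - (\<Sum>j<m. trace_form n M y (e j) *s f j)"
    have "trace_form n M d (e k) = 0" if k: "k < m" for k
    proof -
      have "trace_form n M (f j) (e k) = (if j = k then 1 else 0)" if "j < m" for j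
        using f(2)[OF that eA[OF k]] coordinates_moduloD(4)[OF ce that k] by simp
      then have "(\<Sum>j<m. trace_form n M y (e j) * trace_form n M (f j) (e k))
          = (\<Sum>j<m. if j = k then trace_form n M y (e k) else 0)"
        by (intro sum.cong) auto
      then show ?thesis using k by (simp add: d_def tf)
    qed
    moreover have "trace_form n M d (z - (\<Sum>k<m. ce k z *s e k)) = 0"
      using rad'[OF coordinates_moduloD(5)[OF ce z]] by (simp add: trace_form_commute[of n M d])
    ultimately show "trace_form n M (y - (\<Sum>j<m. trace_form n M y (e j) *s f j)) z = 0"
      by (fold d_def) (simp add: tf)
  qed
  then show ?thesis using f by (intro exI[of _ f]) simp
qed

text \<open>If \<open>A\<close> acts non-trivially on \<open>U / P\<close>, the Casimir operator of its trace form commutes with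
  \<open>A\<close> and has trace \<open>m = dim (A / K) \<noteq> 0\<close>, so by Schur's lemma it is bijective on \<open>U / P\<close>; the
  corrected vector is the one it kills.\<close>

lemma whitehead_irreducible:
  assumes U: "stable A U" and P: "stable A P" "P \<subset> U"
    and irr: "\<And>S. stable A S \<Longrightarrow> P \<subseteq> S \<Longrightarrow> S \<subseteq> U \<Longrightarrow> S = P \<or> S = U"
    and IU: "\<And>x u. x \<in> I \<Longrightarrow> u \<in> U \<Longrightarrow> x \<triangleright> u \<in> P"
    and w0: "w0 \<in> V" "\<And>x. x \<in> A \<Longrightarrow> x \<triangleright> w0 \<in> U" "\<And>x. x \<in> I \<Longrightarrow> x \<triangleright> w0 \<in> P"
  shows "\<exists>u\<in>U. \<forall>x\<in>A. x \<triangleright> (w0 - u) \<in> P"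
proof -
  have PU: "P \<subseteq> U" using P by auto
  note sA = subalgebraD(1)[OF A]
  note sU = stableD(1)[OF U] and sP = stableD(1)[OF P(1)]
  have UV: "u \<in> V" if "u \<in> U" for u using that stableD(3)[OF U] by blast
  have AU: "x \<triangleright> u \<in> U" if "x \<in> A" "u \<in> U" for x u using that stableD(4)[OF U] by blast
  have AP: "x \<triangleright> u \<in> P" if "x \<in> A" "u \<in> P" for x u using that stableD(4)[OF P(1)] by blast
  obtain n b co where co: "W.coordinates_modulo P U n b co"
    using W.coordinates_modulo_exists[OF sP sU PU _ V(3)] stableD(2)[OF U] V(2) by blast
  let ?M = "rep b co"
  note M = matrix_rep_rep[OF A U P(1) PU co]
  note tf = trace_form_simps[OF M]
  define K where "K = {x \<in> A. \<forall>u\<in>U. x \<triangleright> u \<in> P}"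
  have K: "ideal_of A K" unfolding K_def by (rule rep_kernel_ideal[OF A U P(1) PU co])
  have KA: "x \<in> A" if "x \<in> K" for x using that by (simp add: K_def)
  have KU: "x \<triangleright> u \<in> P" if "x \<in> K" "u \<in> U" for x u using that by (simp add: K_def)
  have IK: "I \<subseteq> K" using IU ideal_ofD(2)[OF I] by (auto simp: K_def)
  have KM: "x \<in> K \<longleftrightarrow> agree n (?M x) (\<lambda>i j. 0)" if "x \<in> A" for x
    using rep_zero_iff[OF A U P(1) PU co that] that by (simp add: K_def)
  \<comment> \<open>\<open>K\<close> is the kernel on U / P, but \<open>w0\<close> may lie outside
    \<open>U\<close>; that \<open>K\<close> kills it modulo \<open>P\<close> comes from perfectness
    of \<open>K\<close>.\<close>
  have Kw0: "x \<triangleright> w0 \<in> P" if "x \<in> K" for x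
    using perfect_act_trivial[OF w0(1) sP w0(2)[OF KA] KU w0(3) perfect[OF K IK] that] .
  show ?thesis
  proof (cases "K = A")
    case True
    then show ?thesis using Kw0 W.subspace_0[OF sU] by (intro bexI[of _ 0]) auto
  next
    case False
    define R where "R = {x \<in> A. \<forall>y\<in>A. trace_form n ?M x y = 0}"
    have AA: "ideal_of A A" using A by (auto simp: ideal_of_def subalgebra_def)
    have R: "ideal_of A R" unfolding R_def by (rule form_perp_ideal[OF M A AA AA])
    have rad': "trace_form n ?M x y = 0" if "x \<in> K" for x y
      using that KM[OF KA[OF that]] zero_matrix_trace_form[OF M] by blast
    have KR: "K \<subseteq> R" using rad' KA by (auto simp: R_def)
    \<comment> \<open>The trace form vanishes on its radical \<open>R\<close>, which is perfect over
      \<open>I\<close>; by Cartan's criterion \<open>R\<close> acts trivially on U / P.\<close>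
    have RK: "R \<subseteq> K"
    proof
      fix x assume x: "x \<in> R"
      have RA: "x \<in> A" if "x \<in> R" for x using that by (simp add: R_def)
      have "agree n (?M x) (\<lambda>i j. 0)"
      proof (rule cartan_criterion[OF ideal_ofD(1)[OF R] _ matrix_rep_subset[OF M] _ _ x])
        show "mat_tr n (mat_mul n (?M y) (?M z)) = 0" if "y \<in> R" "z \<in> R" for y z
          using that by (simp add: R_def trace_form_def)
        show "\<exists>z\<in>prod_space R R. y - z \<in> R \<and> agree n (?M (y - z)) (\<lambda>i j. 0)" if "y \<in> R" for y
        proof -
          obtain z where z: "z \<in> prod_space R R" "y - z \<in> I"
            using perfect[OF R] IK KR \<open>y \<in> R\<close> unfolding perfect_over_def by blast
          then have "y - z \<in> K" using IK by blast
          then show ?thesis using z KM[OF KA] KR by blast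
        qed
      qed (use RA ideal_ofD(3)[OF R] in auto)
      then show "x \<in> K" using KM RA x by blast
    qed
    obtain m e ce where ce: "local.coordinates_modulo K A m e ce"
      using coordinates_modulo_exists[OF ideal_ofD(1)[OF K] sA ideal_ofD(2)[OF K] subset_span_Basis finite_Basis]
      by blast
    have RK': "x \<in> K" if "x \<in> A" "\<And>y. y \<in> A \<Longrightarrow> trace_form n ?M x y = 0" for x
      using that RK by (auto simp: R_def)
    obtain f where f: "\<forall>i<m. f i \<in> A" "\<forall>i<m. \<forall>x\<in>A. trace_form n ?M (f i) x = ce i x"
      "\<forall>y\<in>A. y - (\<Sum>j<m. trace_form n ?M y (e j) *s f j) \<in> K"
      using dual_family[OF M K RK' rad' ce] by blast
    note f = f[rule_format]
    have eA: "e i \<in> A" if "i < m" for i using coordinates_moduloD(1)[OF ce that] .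
    have m0: "m \<noteq> 0"
    proof
      assume "m = 0"
      then have "A \<subseteq> K" using coordinates_moduloD(5)[OF ce] by auto
      then show False using False KA by auto
    qed
    define c where "c w = (\<Sum>i<m. e i \<triangleright> (f i \<triangleright> w))" for w
    have cV: "c w \<in> V" if "w \<in> V" for w
      unfolding c_def using that by (intro W.subspace_sum[OF V(1)] act_closed)
    have c_add: "c (v + w) = c v + c w" and c_diff: "c (v - w) = c v - c w"
      if "v \<in> V" "w \<in> V" for v w
      using that by (simp_all add: c_def act_add act_diff act_closed sum.distrib sum_subtractf)
    have c_scale: "c (k *w w) = k *w c w" if "w \<in> V" for k w
      using that by (simp add: c_def act_scale act_closed W.scale_sum_right)
    have c0: "c 0 = 0" by (simp add: c_def act_zero)
    have cU: "c w \<in> U" if "\<And>x. x \<in> A \<Longrightarrow> x \<triangleright> w \<in> U" for w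
      unfolding c_def using that eA f AU by (intro W.subspace_sum[OF sU]) auto
    have cP: "c w \<in> P" if "w \<in> P" for w
      unfolding c_def using that eA f AP by (intro W.subspace_sum[OF sP]) auto
    have commute: "x \<triangleright> c w - c (x \<triangleright> w) \<in> P"
      if x: "x \<in> A" and w: "w \<in> V" "\<And>x. x \<in> A \<Longrightarrow> x \<triangleright> w \<in> U" "\<And>k. k \<in> K \<Longrightarrow> k \<triangleright> w \<in> P" for x w
    proof -
      \<comment> \<open>Structure constants: modulo \<open>K\<close>, \<open>x \<cdot> e i\<close>
        has coefficients \<open>a i j\<close>, and skewness of the form gives \<open>- a j i\<close>
        for the dual basis. The errors \<open>t\<close> and \<open>s\<close> lie in
        \<open>P\<close>, and the sums over \<open>a\<close> cancel after an exchange of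
        indices.\<close>
      define a where "a i j = ce j (x \<cdot> e i)" for i j
      define t where "t i = (x \<cdot> e i) \<triangleright> (f i \<triangleright> w) - (\<Sum>j<m. a i j *w (e j \<triangleright> (f i \<triangleright> w)))" for i
      define s where "s i = e i \<triangleright> ((x \<cdot> f i) \<triangleright> w) + (\<Sum>j<m. a j i *w (e i \<triangleright> (f j \<triangleright> w)))" for i
      have tP: "t i \<in> P" if i: "i < m" for i
      proof -
        have "x \<cdot> e i - (\<Sum>j<m. a i j *s e j) \<in> K"
          unfolding a_def using x eA[OF i] subalgebraD(2)[OF A] by (intro coordinates_moduloD(5)[OF ce])
        then have "(x \<cdot> e i - (\<Sum>j<m. a i j *s e j)) \<triangleright> (f i \<triangleright> w) \<in> P"
          using KU w f i by blast
        then show ?thesis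
          by (simp add: t_def diff_act sum_act scale_act act_closed w(1))
      qed
      have sP': "s i \<in> P" if i: "i < m" for i
      proof -
        have xf: "x \<cdot> f i \<in> A" using x f i subalgebraD(2)[OF A] by blast
        have "trace_form n ?M (x \<cdot> f i) (e j) = - a j i" if j: "j < m" for j
        proof -
          have "x \<cdot> e j \<in> A" using x eA[OF j] subalgebraD(2)[OF A] by blast
          then show ?thesis
            using trace_form_skew[OF M x f(1)[OF i] eA[OF j]] f(2)[OF i] by (simp add: a_def)
        qed
        then have "(\<Sum>j<m. trace_form n ?M (x \<cdot> f i) (e j) *s f j) = (\<Sum>j<m. (- a j i) *s f j)"
          by (intro sum.cong) auto
        then have "x \<cdot> f i - (\<Sum>j<m. (- a j i) *s f j) \<in> K" using f(3)[OF xf] by simp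
        then have "e i \<triangleright> ((x \<cdot> f i - (\<Sum>j<m. (- a j i) *s f j)) \<triangleright> w) \<in> P"
          using w(3) AP[OF eA[OF i]] by blast
        moreover have "(x \<cdot> f i - (\<Sum>j<m. (- a j i) *s f j)) \<triangleright> w
            = (x \<cdot> f i) \<triangleright> w + (\<Sum>j<m. a j i *w (f j \<triangleright> w))"
          using w(1) scale_act[OF w(1), of "- _"]
          by (simp add: diff_act sum_act scale_act sum_negf del: scale_minus_left)
        moreover have "e i \<triangleright> (\<Sum>j<m. a j i *w (f j \<triangleright> w)) = (\<Sum>j<m. a j i *w (e i \<triangleright> (f j \<triangleright> w)))"
          using w(1) W.subspace_scale[OF V(1)] by (subst act_sum) (auto simp: act_scale act_closed)
        moreover have "(\<Sum>j<m. a j i *w (f j \<triangleright> w)) \<in> V"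
          using w(1) by (intro W.subspace_sum[OF V(1)] W.subspace_scale[OF V(1)] act_closed)
        ultimately show ?thesis
          using w(1) by (simp add: s_def act_add act_closed)
      qed
      have "x \<triangleright> c w = (\<Sum>i<m. x \<triangleright> (e i \<triangleright> (f i \<triangleright> w)))"
        unfolding c_def using w(1) by (intro act_sum act_closed)
      moreover have "x \<triangleright> (e i \<triangleright> (f i \<triangleright> w)) - e i \<triangleright> (f i \<triangleright> (x \<triangleright> w))
          = (x \<cdot> e i) \<triangleright> (f i \<triangleright> w) + e i \<triangleright> ((x \<cdot> f i) \<triangleright> w)" for i
        using w(1) by (simp add: mult_act act_closed act_diff)
      ultimately have "x \<triangleright> c w - c (x \<triangleright> w)
          = (\<Sum>i<m. (x \<cdot> e i) \<triangleright> (f i \<triangleright> w) + e i \<triangleright> ((x \<cdot> f i) \<triangleright> w))"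
        by (simp add: c_def flip: sum_subtractf)
      also have "\<dots> = (\<Sum>i<m. t i + s i)"
      proof -
        have "(\<Sum>i<m. \<Sum>j<m. a i j *w (e j \<triangleright> (f i \<triangleright> w))) = (\<Sum>i<m. \<Sum>j<m. a j i *w (e i \<triangleright> (f j \<triangleright> w)))"
          by (rule sum.swap)
        then show ?thesis by (simp add: t_def s_def sum.distrib sum_subtractf)
      qed
      also have "\<dots> \<in> P" using tP sP' by (intro W.subspace_sum[OF sP] W.subspace_add[OF sP]) auto
      finally show ?thesis .
    qed
    have commuteU: "x \<triangleright> c u - c (x \<triangleright> u) \<in> P" if "x \<in> A" "u \<in> U" for x u
      using commute[OF that(1) UV[OF that(2)]] AU KU that by blast
    have nontriv: "\<exists>u\<in>U. c u \<notin> P"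
    proof (rule ccontr)
      assume "\<not> ?thesis"
      then have no: "c u \<in> P" if "u \<in> U" for u using that by blast
      have "0 = (\<Sum>j<n. co j (c (b j)))"
        using no W.coordinates_moduloD(1,3)[OF co] by simp
      also have "\<dots> = (\<Sum>j<n. \<Sum>i<m. co j (e i \<triangleright> (f i \<triangleright> b j)))"
        by (simp add: c_def W.linear_functional_sum[OF W.coordinates_moduloD(2)[OF co]])
      also have "\<dots> = (\<Sum>j<n. \<Sum>i<m. mat_mul n (?M (e i)) (?M (f i)) j j)"
        using eA f by (intro sum.cong) (auto simp: mat_mul_rep[OF A U P(1) PU co])
      also have "\<dots> = (\<Sum>i<m. trace_form n ?M (e i) (f i))"
        by (subst sum.swap) (simp add: trace_form_def mat_tr_def)
      also have "\<dots> = (\<Sum>i<m. 1)"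
        using f eA coordinates_moduloD(4)[OF ce]
        by (intro sum.cong) (auto simp: trace_form_commute[of n ?M "e _"])
      finally show False using m0 by simp
    qed
    \<comment> \<open>\<open>N\<close> and, further down, \<open>T\<close> are kernel and image of
      the Casimir operator modulo \<open>P\<close>. Both are submodules, so irreducibility decides
      them.\<close>
    define N where "N = {u \<in> U. c u \<in> P}"
    have "stable A N"
      unfolding stable_def
    proof (intro conjI ballI)
      show "W.subspace N"
        using sU sP by (intro W.subspaceI)
          (auto simp: N_def c0 c_add c_scale UV W.subspace_0 W.subspace_add W.subspace_scale)
      show "N \<subseteq> V" using UV by (auto simp: N_def)
      fix x u assume x: "x \<in> A" and u: "u \<in> N"
      have uU: "u \<in> U" "c u \<in> P" using u by (auto simp: N_def)
      have "c (x \<triangleright> u) \<in> P"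
        using W.subspace_diff[OF sP AP[OF x uU(2)] commuteU[OF x uU(1)]] by simp
      then show "x \<triangleright> u \<in> N" using x uU AU by (simp add: N_def)
    qed
    moreover have "P \<subseteq> N" "N \<subseteq> U" using cP PU by (auto simp: N_def)
    moreover have "N \<noteq> U" using nontriv by (auto simp: N_def)
    ultimately have NP: "N = P" using irr by blast
    define T where "T = {v \<in> U. \<exists>u\<in>U. v - c u \<in> P}"
    have "stable A T"
      unfolding stable_def
    proof (intro conjI ballI)
      show "W.subspace T"
      proof (rule W.subspaceI)
        show "0 \<in> T" using W.subspace_0[OF sU] W.subspace_0[OF sP] c0 by (force simp: T_def)
      next
        fix v v' assume "v \<in> T" "v' \<in> T"
        then obtain u u' where u: "v \<in> U" "v' \<in> U" "u \<in> U" "u' \<in> U" "v - c u \<in> P" "v' - c u' \<in> P"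
          by (auto simp: T_def)
        then have "(v - c u) + (v' - c u') \<in> P" by (intro W.subspace_add[OF sP])
        then have "v + v' - c (u + u') \<in> P" using u by (simp add: c_add UV algebra_simps)
        then show "v + v' \<in> T" using u W.subspace_add[OF sU] by (auto simp: T_def)
      next
        fix k v assume "v \<in> T"
        then obtain u where u: "v \<in> U" "u \<in> U" "v - c u \<in> P" by (auto simp: T_def)
        then have "k *w (v - c u) \<in> P" by (intro W.subspace_scale[OF sP])
        then have "k *w v - c (k *w u) \<in> P" using u by (simp add: c_scale UV W.scale_right_diff_distrib)
        then show "k *w v \<in> T" using u W.subspace_scale[OF sU] by (auto simp: T_def)
      qed
      show "T \<subseteq> V" using UV by (auto simp: T_def)
      fix x v assume x: "x \<in> A" and "v \<in> T"
      then obtain u where u: "v \<in> U" "u \<in> U" "v - c u \<in> P" by (auto simp: T_def)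
      have "x \<triangleright> (v - c u) + (x \<triangleright> c u - c (x \<triangleright> u)) \<in> P"
        using x u AP commuteU by (intro W.subspace_add[OF sP]) auto
      then have "x \<triangleright> v - c (x \<triangleright> u) \<in> P" using u by (simp add: act_diff UV cV)
      then show "x \<triangleright> v \<in> T" using x u AU by (auto simp: T_def)
    qed
    moreover have "P \<subseteq> T" "T \<subseteq> U" using PU W.subspace_0[OF sU] c0 by (force simp: T_def)+
    moreover have "T \<noteq> P"
    proof -
      obtain u where u: "u \<in> U" "c u \<notin> P" using nontriv by blast
      then have "c u \<in> T"
        using cU[of u] AU W.subspace_0[OF sP] by (auto simp: T_def intro!: bexI[of _ u])
      then show ?thesis using u by blast
    qed
    ultimately have "T = U" using irr by blast
    moreover have "c w0 \<in> U" using cU w0 by blast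
    ultimately obtain u where u: "u \<in> U" "c w0 - c u \<in> P" by (auto simp: T_def)
    define w where "w = w0 - u"
    have wV: "w \<in> V" using w0 u UV by (auto simp: w_def intro: W.subspace_diff[OF V(1)])
    have wA: "x \<triangleright> w \<in> U" if "x \<in> A" for x
      using that w0 u UV AU by (auto simp: w_def act_diff intro: W.subspace_diff[OF sU])
    have wK: "x \<triangleright> w \<in> P" if "x \<in> K" for x
      using that w0 u UV Kw0 KU by (auto simp: w_def act_diff intro: W.subspace_diff[OF sP])
    have cw: "c w \<in> P" using u w0 UV by (simp add: w_def c_diff)
    \<comment> \<open>Modulo \<open>P\<close> the Casimir operator commutes with \<open>x\<close>
      and kills \<open>w\<close>; so it kills \<open>x \<triangleright> w\<close>, on which it is
      injective.\<close>
    have "x \<triangleright> w \<in> P" if x: "x \<in> A" for x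
    proof -
      have "c (x \<triangleright> w) \<in> P"
        using W.subspace_diff[OF sP AP[OF x cw] commute[OF x wV wA wK]] by simp
      then have "x \<triangleright> w \<in> N" using wA[OF x] by (simp add: N_def)
      then show ?thesis using NP by simp
    qed
    then show ?thesis using u by (auto simp: w_def)
  qed
qed

text \<open>The map from \<open>x\<close> to \<open>x \<triangleright> w0\<close> is a cocycle with
  values in U / P, to be written as the coboundary of \<open>u\<close>. A maximal proper submodule
  \<open>S\<close> of \<open>U\<close> above \<open>P\<close> gives an irreducible U / S; after the
  correction there, the cocycle takes its values in \<open>S\<close>, of smaller dimension.\<close>

lemma whitehead:
  assumes "stable A U" "stable A P" "P \<subseteq> U"
    and "\<And>x u. x \<in> I \<Longrightarrow> u \<in> U \<Longrightarrow> x \<triangleright> u \<in> P"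
    and "w0 \<in> V" "\<And>x. x \<in> A \<Longrightarrow> x \<triangleright> w0 \<in> U" "\<And>x. x \<in> I \<Longrightarrow> x \<triangleright> w0 \<in> P"
  shows "\<exists>u\<in>U. \<forall>x\<in>A. x \<triangleright> (w0 - u) \<in> P"
  using assms
proof (induction "W.dim U" arbitrary: U w0 rule: less_induct)
  case less
  note sU = stableD(1)[OF less.prems(1)] and sP = stableD(1)[OF less.prems(2)]
  have UV: "u \<in> V" if "u \<in> U" for u using that stableD(3)[OF less.prems(1)] by blast
  show ?case
  proof (cases "P = U")
    case True
    then show ?thesis using less.prems W.subspace_0[OF sU] by (intro bexI[of _ 0]) auto
  next
    case False
    let ?Q = "\<lambda>S. stable A S \<and> P \<subseteq> S \<and> S \<subset> U"
    have Q: "?Q P" using less.prems False by auto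
    have "\<exists>S. ?Q S \<and> (\<forall>T. ?Q T \<longrightarrow> S \<subseteq> T \<longrightarrow> T = S)"
      by (rule W.maximal_subspace[of ?Q P, OF Q _ V(3)]) (use V(2) in \<open>auto simp: stable_def\<close>)
    then obtain S where S: "?Q S" and max: "\<forall>T. ?Q T \<longrightarrow> S \<subseteq> T \<longrightarrow> T = S"
      by (rule exE) (erule conjE, rule that)
    have SA: "stable A S" "S \<subset> U" "P \<subseteq> S" using S by auto
    have irr: "T = S \<or> T = U" if "stable A T" "S \<subseteq> T" "T \<subseteq> U" for T
      using max[rule_format, of T] that SA by blast
    have IS: "x \<triangleright> u \<in> S" if "x \<in> I" "u \<in> U" for x u using less.prems(4)[OF that] SA by blast
    have "\<exists>u\<in>U. \<forall>x\<in>A. x \<triangleright> (w0 - u) \<in> S"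
      by (rule whitehead_irreducible[OF less.prems(1) SA(1,2) irr IS less.prems(5,6)])
        (use less.prems(7) SA in auto)
    then obtain u where u: "u \<in> U" "\<And>x. x \<in> A \<Longrightarrow> x \<triangleright> (w0 - u) \<in> S" by blast
    have dim: "W.dim S < W.dim U"
      using W.dim_psubset_in_finite_span[OF stableD(1)[OF SA(1)] SA(2) _ V(3)]
        stableD(2)[OF less.prems(1)] V(2) by blast
    have "\<exists>u'\<in>S. \<forall>x\<in>A. x \<triangleright> ((w0 - u) - u') \<in> P"
    proof (rule less.hyps[OF dim SA(1) less.prems(2) SA(3)])
      show "x \<triangleright> v \<in> P" if "x \<in> I" "v \<in> S" for x v using less.prems(4) that SA by blast
      show "w0 - u \<in> V" using less.prems(5) u UV by (auto intro: W.subspace_diff[OF V(1)])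
      show "x \<triangleright> (w0 - u) \<in> P" if "x \<in> I" for x
        using that less.prems(4,5,7) u UV by (auto simp: act_diff intro: W.subspace_diff[OF sP])
    qed (use u in auto)
    then obtain u' where "u' \<in> S" "\<forall>x\<in>A. x \<triangleright> ((w0 - u) - u') \<in> P" by blast
    then show ?thesis
      using u SA W.subspace_add[OF sU] by (intro bexI[of _ "u + u'"]) (auto simp: diff_diff_eq)
  qed
qed

end

end

context fd_leibniz_algebra
begin

lemma mult_mult_left: "(x \<cdot> y) \<cdot> z = x \<cdot> (y \<cdot> z) - y \<cdot> (x \<cdot> z)"
  using left_leibniz[of x y z] by simp

section \<open>The Killing form\<close>

text \<open>Passing from semisimplicity of the quotient by \<open>I\<close> to perfectness of all its ideals is what
  makes the induction work: the latter is inherited by quotients.\<close>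

lemma semisimple_quotient_perfect:
  assumes I: "ideal_of UNIV I"
    and ss: "\<And>T k. ideal_of UNIV T \<Longrightarrow> derived_series T k \<subseteq> I \<Longrightarrow> T \<subseteq> I"
    and K: "ideal_of UNIV K" and IK: "I \<subseteq> K"
  shows "perfect_over I K"
proof -
  interpret ad: leibniz_module scale mult Basis scale mult UNIV Basis
    by (intro leibniz_module.intro leibniz_module_axioms.intro fd_leibniz_algebra_axioms vector_space_axioms)
      (simp_all add: mult_linear mult_mult_left finite_Basis span_Basis)
  have UN: "subalgebra UNIV" by (simp add: subalgebra_def)
  have st: "ad.stable UNIV UNIV" "ad.stable UNIV I"
    using ideal_ofD[OF I] by (auto simp: ad.stable_def)
  obtain n b co where co: "local.coordinates_modulo I UNIV n b co"
    using coordinates_modulo_exists[of I UNIV Basis] ideal_ofD[OF I] subset_span_Basis finite_Basis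
    by auto
  define M where "M = ad.rep b co"
  have M: "matrix_rep n UNIV M"
    unfolding M_def by (rule ad.matrix_rep_rep[OF UN st subset_UNIV co])
  have M0: "agree n (M x) (\<lambda>i j. 0) \<longleftrightarrow> (\<forall>y. x \<cdot> y \<in> I)" for x
    using ad.rep_zero_iff[OF UN st subset_UNIV co, of x] by (simp add: M_def)
  let ?tf = "trace_form n M"
  define T where "T = {x \<in> K. \<forall>y\<in>K. ?tf x y = 0}"
  have T: "ideal_of UNIV T" unfolding T_def by (rule form_perp_ideal[OF M UN K K])
  have TI: "T \<subseteq> I"
  proof -
    \<comment> \<open>\<open>T\<close> need not be perfect, but its stationary derived term is.
      Cartan's criterion puts the products of that term into \<open>I\<close>, so \<open>T\<close>
      is soluble modulo \<open>I\<close>.\<close>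
    obtain k where k: "prod_space (derived_series T k) (derived_series T k) = derived_series T k"
      using derived_series_stationary[OF T] by blast
    define E where "E = derived_series T k"
    have E: "ideal_of UNIV E" unfolding E_def by (rule ideal_of_derived_series[OF T])
    have ET: "E \<subseteq> T" unfolding E_def by (rule derived_series_subset[OF T])
    have "agree n (M x) (\<lambda>i j. 0)" if "x \<in> E" for x
    proof (rule cartan_criterion[OF ideal_ofD(1)[OF E] _ matrix_rep_subset[OF M] _ _ that])
      show "mat_tr n (mat_mul n (M y) (M z)) = 0" if "y \<in> E" "z \<in> E" for y z
        using that ET by (auto simp: T_def trace_form_def)
      show "\<exists>z\<in>prod_space E E. y - z \<in> E \<and> agree n (M (y - z)) (\<lambda>i j. 0)" if "y \<in> E" for y
        using that k M0[of 0] subspace_0[OF ideal_ofD(1)[OF E]] ideal_ofD(1)[OF I]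
        by (intro bexI[of _ y]) (auto simp: E_def mult_zero_left subspace_0)
    qed (use ideal_ofD(3)[OF E] in auto)
    then have "x \<cdot> y \<in> I" if "x \<in> E" for x y using M0 that by blast
    then have "prod_space E E \<subseteq> I" using ideal_ofD(1)[OF I] by (intro prod_space_subset) auto
    then have "derived_series T k \<subseteq> I" using k by (simp add: E_def)
    then show ?thesis by (rule ss[OF T])
  qed
  \<comment> \<open>The goal is \<open>K \<subseteq> L\<close>. The orthogonal complement
    \<open>Z\<close> of \<open>L\<close> in \<open>K\<close> has its products in \<open>T\<close>,
    because \<open>y \<cdot> z\<close> is in \<open>L\<close> for \<open>z\<close> in
    \<open>K\<close>; so \<open>Z\<close> is abelian modulo \<open>I\<close> and falls into
    \<open>I\<close>.\<close>
  define L where "L = prod_space K K + I"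
  have sL: "subspace L" unfolding L_def
    by (intro subspace_plus subspace_prod_space ideal_ofD(1)[OF I])
  have LK: "L \<subseteq> K"
    unfolding L_def using prod_space_ideal_subset[OF K] IK ideal_ofD(1)[OF K]
    by (auto simp: set_plus_def intro!: subspace_add)
  have prod: "prod_space K K \<subseteq> L" "I \<subseteq> L"
    unfolding L_def using Un_subset_plus[OF subspace_prod_space ideal_ofD(1)[OF I]] by blast+
  have "\<exists>b\<in>UNIV. a - b \<in> I" for a
    by (rule bexI[of _ a]) (simp_all add: subspace_0[OF ideal_ofD(1)[OF I]])
  then have "ideal_of UNIV L"
    unfolding L_def by (rule ideal_of_plus[OF I ideal_of_prod_space[OF K]]) simp_all
  then have Z: "ideal_of UNIV {x \<in> K. \<forall>y\<in>L. ?tf x y = 0}"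
    by (intro form_perp_ideal[OF M UN K])
  define Z where "Z = {x \<in> K. \<forall>y\<in>L. ?tf x y = 0}"
  have "x \<cdot> y \<in> I" if xy: "x \<in> Z" "y \<in> Z" for x y
  proof -
    have "?tf (x \<cdot> y) z = 0" if z: "z \<in> K" for z
    proof -
      have "y \<cdot> z \<in> L" using xy z prod prod_space_mem[of y K z K] by (auto simp: Z_def)
      then show ?thesis using xy trace_form_assoc[OF M, of x y z] by (simp add: Z_def)
    qed
    then have "x \<cdot> y \<in> T" using xy ideal_ofD(3)[OF K] by (auto simp: T_def Z_def)
    then show ?thesis using TI by blast
  qed
  then have "prod_space Z Z \<subseteq> I" using ideal_ofD(1)[OF I] by (intro prod_space_subset) auto
  then have "Z \<subseteq> I" using ss[of Z 1] Z by (simp add: Z_def)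
  have "K \<subseteq> L"
  proof (rule ccontr)
    assume "\<not> K \<subseteq> L"
    then obtain x where x: "x \<in> K" "x \<notin> L" by blast
    \<comment> \<open>A non-zero functional on K / L would be represented by some \<open>z\<close>
      orthogonal to \<open>L\<close>. Such a \<open>z\<close> is in \<open>Z\<close>, hence in
      \<open>I\<close>, where the form vanishes.\<close>
    obtain m e ce where ce: "local.coordinates_modulo L K m e ce"
      using coordinates_modulo_exists[OF sL ideal_ofD(1)[OF K] LK subset_span_Basis finite_Basis] by blast
    have m: "0 < m" using coordinates_moduloD(5)[OF ce x(1)] x(2) by (cases m) auto
    note tf = trace_form_simps[OF M]
    have "\<exists>z\<in>K. \<forall>x\<in>K. ce 0 x = ?tf z x"
    proof (rule functional_represented[OF ideal_ofD(1)[OF K] subset_span_Basis finite_Basis])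
      show "Vector_Spaces.linear scale (*) (ce 0)" by (rule coordinates_moduloD(2)[OF ce])
      show "ce 0 y = 0" if "y \<in> K" "\<And>z. z \<in> K \<Longrightarrow> ?tf z y = 0" for y
      proof -
        have "y \<in> T" using that by (simp add: T_def trace_form_commute[of n M y])
        then show ?thesis using TI prod coordinates_moduloD(3)[OF ce m] by blast
      qed
    qed (simp_all add: tf)
    then obtain z where z: "z \<in> K" "\<And>x. x \<in> K \<Longrightarrow> ce 0 x = ?tf z x" by blast
    have "?tf z y = 0" if "y \<in> L" for y
      using z(2)[of y] coordinates_moduloD(3)[OF ce m that] LK that by auto
    then have "z \<in> I" using z(1) \<open>Z \<subseteq> I\<close> by (auto simp: Z_def)
    then have "agree n (M z) (\<lambda>i j. 0)" using M0 ideal_ofD(4)[OF I] by blast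
    then have "?tf z (e 0) = 0" by (rule zero_matrix_trace_form[OF M])
    then show False
      using z(2)[OF coordinates_moduloD(1)[OF ce m]] coordinates_moduloD(4)[OF ce m m] by simp
  qed
  then show ?thesis
    unfolding perfect_over_def L_def by (auto simp: set_plus_def subset_iff)
      (metis add_diff_cancel_left')
qed

section \<open>Splitting off a minimal ideal\<close>

definition fun_scale :: "'a \<Rightarrow> ('b \<Rightarrow> 'b) \<Rightarrow> 'b \<Rightarrow> 'b" where
  "fun_scale c f = (\<lambda>y. c *s f y)"

definition fun_act :: "'b \<Rightarrow> ('b \<Rightarrow> 'b) \<Rightarrow> 'b \<Rightarrow> 'b" where
  "fun_act x f = (\<lambda>y. x \<cdot> f y - f (x \<cdot> y))"

text \<open>Maps are linear on the whole space, although only their values on a subalgebra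
  \<open>A\<close> will count; those vanishing on \<open>A\<close> will belong to the submodule that
  is factored out.\<close>

definition linear_maps :: "('b \<Rightarrow> 'b) set" where
  "linear_maps = {f. Vector_Spaces.linear scale scale f}"

text \<open>The matrix units with respect to \<open>Basis\<close>.\<close>

definition elementary_maps :: "('b \<Rightarrow> 'b) set" where
  "elementary_maps = (\<lambda>(b, c) v. representation Basis v b *s c) ` (Basis \<times> Basis)"

lemma linear_mapsD:
  assumes "f \<in> linear_maps"
  shows "f (x + y) = f x + f y" "f (c *s x) = c *s f x" "f (x - y) = f x - f y" "f 0 = 0"
    "f (sum g S) = (\<Sum>i\<in>S. f (g i))"
proof -
  interpret f: module_hom scale scale f
    using assms by (simp add: linear_maps_def module_hom_iff_linear)
  show "f (x + y) = f x + f y" "f (c *s x) = c *s f x" "f (x - y) = f x - f y" "f 0 = 0"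
    "f (sum g S) = (\<Sum>i\<in>S. f (g i))"
    by (rule f.add f.scale f.diff f.zero f.sum)+
qed

lemma linear_mapsI:
  "(\<And>x y. f (x + y) = f x + f y) \<Longrightarrow> (\<And>c x. f (c *s x) = c *s f x) \<Longrightarrow> f \<in> linear_maps"
  using vector_space_axioms by (simp add: linear_maps_def Vector_Spaces.linear_iff)

lemma expand_Basis: "v = (\<Sum>b\<in>Basis. representation Basis v b *s b)"
  using sum_representation_eq[OF independent_Basis, of v Basis] span_Basis finite_Basis by simp

lemma leibniz_module_linear_maps:
  "leibniz_module scale mult Basis fun_scale fun_act linear_maps elementary_maps"
proof (intro leibniz_module.intro leibniz_module_axioms.intro)
  show "fd_leibniz_algebra (*s) (\<cdot>) Basis" by (rule fd_leibniz_algebra_axioms)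
  show vs: "vector_space fun_scale"
    by unfold_locales (auto simp: fun_scale_def fun_eq_iff scale_right_distrib scale_left_distrib)
  interpret W: vector_space fun_scale by (rule vs)
  show "W.subspace linear_maps"
    by (intro W.subspaceI linear_mapsI)
      (auto simp: linear_mapsD fun_scale_def scale_right_distrib scale_left_commute)
  show "finite elementary_maps" by (simp add: elementary_maps_def finite_Basis)
  show "linear_maps \<subseteq> W.span elementary_maps"
  proof
    fix f assume f: "f \<in> linear_maps"
    let ?r = "representation Basis"
    have "f v = (\<Sum>b\<in>Basis. \<Sum>c\<in>Basis. fun_scale (?r (f b) c) (\<lambda>v. ?r v b *s c)) v" for v
    proof -
      have "f v = (\<Sum>b\<in>Basis. ?r v b *s f b)"
        using arg_cong[OF expand_Basis[of v], of f] by (simp add: linear_mapsD[OF f])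
      also have "\<dots> = (\<Sum>b\<in>Basis. ?r v b *s (\<Sum>c\<in>Basis. ?r (f b) c *s c))"
        using expand_Basis by simp
      finally show ?thesis
        by (simp add: sum_fun_apply fun_scale_def scale_sum_right mult.commute)
    qed
    then have "f = (\<Sum>b\<in>Basis. \<Sum>c\<in>Basis. fun_scale (?r (f b) c) (\<lambda>v. ?r v b *s c))" by (rule ext)
    moreover have "\<dots> \<in> W.span elementary_maps"
      by (intro W.span_sum W.span_scale W.span_base) (auto simp: elementary_maps_def)
    ultimately show "f \<in> W.span elementary_maps" by simp
  qed
qed (auto simp: fun_act_def fun_scale_def fun_eq_iff linear_mapsD mult_linear mult_mult_left
    scale_right_diff_distrib scale_right_distrib algebra_simps intro!: linear_mapsI)

text \<open>The space of linear maps is a module under \<open>(x f) y = x (f y) - f (x y)\<close>. Starting from a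
  projection \<open>\<pi>\<close> onto \<open>I\<close>, Whitehead's lemma yields \<open>f\<close> with \<open>f i \<equiv> i\<close> modulo \<open>J\<close> on \<open>I\<close> which is
  either invariant modulo \<open>J\<close> (if \<open>I A \<subseteq> J\<close>), and then its kernel modulo \<open>J\<close> is the complement, or
  (if left and right action of \<open>A\<close> on \<open>I / J\<close> are opposite) invariant modulo the maps \<open>y \<mapsto> y i\<close>,
  and then the stabiliser of \<open>f\<close> modulo \<open>J\<close> is the complement. As \<open>I / J\<close> is irreducible and
  \<open>(a x + x a) y = 0\<close>, there are no other cases.\<close>

lemma levi_minimal:
  assumes A: "subalgebra A" and I: "ideal_of A I" and J: "ideal_of A J" and JI: "J \<subset> I"
    and II: "prod_space I I \<subseteq> J"
    and min: "\<And>T. ideal_of A T \<Longrightarrow> J \<subseteq> T \<Longrightarrow> T \<subseteq> I \<Longrightarrow> T = J \<or> T = I"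
    and perfect: "\<And>K. ideal_of A K \<Longrightarrow> I \<subseteq> K \<Longrightarrow> perfect_over I K"
  shows "\<exists>S. subalgebra S \<and> S \<subseteq> A \<and> S + I = A \<and> S \<inter> I = J"
proof -
  interpret H: leibniz_module scale mult Basis fun_scale fun_act linear_maps elementary_maps
    by (rule leibniz_module_linear_maps)
  note sA = subalgebraD(1)[OF A] and AA = subalgebraD(2)[OF A]
  note sI = ideal_ofD(1)[OF I] and IA = ideal_ofD(2)[OF I]
  note sJ = ideal_ofD(1)[OF J] and JA = ideal_ofD(2)[OF J]
  have AI: "a \<cdot> x \<in> I" "x \<cdot> a \<in> I" if "a \<in> A" "x \<in> I" for a x using that ideal_ofD[OF I] by auto
  have AJ: "a \<cdot> x \<in> J" "x \<cdot> a \<in> J" if "a \<in> A" "x \<in> J" for a x using that ideal_ofD[OF J] by auto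
  have II': "x \<cdot> y \<in> J" if "x \<in> I" "y \<in> I" for x y using that II prod_space_mem by blast
  have JI': "x \<in> I" if "x \<in> J" for x using that JI by blast
  have IA': "x \<in> A" if "x \<in> I" for x using that IA by blast
  obtain \<pi> where \<pi>: "\<pi> \<in> linear_maps" "\<And>v. \<pi> v \<in> I" "\<And>v. v \<in> I \<Longrightarrow> \<pi> v = v"
  proof -
    interpret vector_space_pair scale scale by unfold_locales
    have "Vector_Spaces.linear scale scale (\<lambda>x. x)"
      using vector_space_axioms by (simp add: Vector_Spaces.linear_iff)
    from linear_exists_left_inverse_on[OF this sI] obtain g
      where "g ` UNIV \<subseteq> I" "Vector_Spaces.linear scale scale g" "\<forall>v\<in>I. g v = v" by auto
    then show ?thesis using that[of g] by (auto simp: linear_maps_def)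
  qed
  \<comment> \<open>These induce the maps from A / I to I / J. Subtracting one of them from
    \<open>\<pi>\<close> keeps it the identity on \<open>I\<close> modulo \<open>J\<close>.\<close>
  define U where "U = {f \<in> linear_maps. (\<forall>y\<in>A. f y \<in> I) \<and> (\<forall>i\<in>I. f i \<in> J)}"
  have UD: "f \<in> linear_maps" "y \<in> A \<Longrightarrow> f y \<in> I" "i \<in> I \<Longrightarrow> f i \<in> J" if "f \<in> U" for f y i
    using that by (auto simp: U_def)
  have act_lin: "fun_act x f \<in> linear_maps" if "f \<in> linear_maps" for x f
    using H.act_closed[OF that] .
  have U: "H.stable A U"
    unfolding H.stable_def
  proof (intro conjI ballI)
    show "H.W.subspace U"
      using H.W.subspace_0[OF H.V(1)] H.W.subspace_add[OF H.V(1)] H.W.subspace_scale[OF H.V(1)]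
      by (intro H.W.subspaceI) (auto simp: U_def fun_scale_def sI sJ subspace_0 subspace_add subspace_scale)
    show "fun_act x f \<in> U" if "x \<in> A" "f \<in> U" for x f
      using UD[OF that(2)] that(1) AA AI AJ IA' act_lin
      by (auto simp: U_def fun_act_def intro!: subspace_diff[OF sI] subspace_diff[OF sJ])
  qed (auto simp: U_def)
  have \<pi>U: "fun_act x \<pi> \<in> U" if "x \<in> A" for x
    using that \<pi> AI act_lin by (auto simp: U_def fun_act_def subspace_0[OF sJ] intro!: subspace_diff[OF sI])
  have IU: "fun_act x f y \<in> J" if "x \<in> I" "f \<in> U" "y \<in> A" for x f y
    using UD[OF that(2)] that II' AI by (auto simp: fun_act_def intro!: subspace_diff[OF sJ])
  have actJ: "fun_act x f y \<in> J" if "x \<in> A" "\<And>y. y \<in> A \<Longrightarrow> f y \<in> J" "y \<in> A" for x f y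
    using that AA AJ by (auto simp: fun_act_def intro!: subspace_diff[OF sJ])
  have \<pi>_minus: "\<pi> - u \<in> linear_maps" "y \<in> A \<Longrightarrow> (\<pi> - u) y \<in> I" "i \<in> I \<Longrightarrow> (\<pi> - u) i - i \<in> J"
    if "u \<in> U" for u y i
    using UD[OF that] \<pi> H.W.subspace_diff[OF H.V(1)] subspace_neg[OF sJ]
    by (auto intro!: subspace_diff[OF sI])
  \<comment> \<open>This ideal measures the failure of antisymmetry between \<open>A\<close> and
    \<open>I\<close>. Its products with \<open>A\<close> on the right lie in \<open>J\<close>, so
    \<open>T = I\<close> would put all \<open>i \<cdot> a\<close> into \<open>J\<close>.\<close>
  define T where "T = span ({a \<cdot> x + x \<cdot> a |a x. a \<in> A \<and> x \<in> I} \<union> J)"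
  have kill: "(a \<cdot> x + x \<cdot> a) \<cdot> y = 0" for a x y
    using left_leibniz[of a x y] left_leibniz[of x a y] by (simp add: mult_linear algebra_simps)
  have TI: "T \<subseteq> I" unfolding T_def
    using AI JI' by (intro span_minimal sI) (auto intro!: subspace_add[OF sI])
  have JT: "J \<subseteq> T" unfolding T_def by (auto intro: span_base)
  have Tr: "x \<cdot> y \<in> J" if "x \<in> T" "y \<in> A" for x y
  proof -
    have "subspace {x. x \<cdot> y \<in> J}"
      by (intro subspaceI) (auto simp: mult_linear sJ subspace_0 subspace_add subspace_scale)
    then have "T \<subseteq> {x. x \<cdot> y \<in> J}" unfolding T_def
      using that kill AJ subspace_0[OF sJ] by (intro span_minimal) auto
    then show ?thesis using that by blast
  qed
  have Tl: "b \<cdot> z \<in> T" if z: "z \<in> T" and b: "b \<in> A" for z b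
  proof -
    have sT: "subspace T" by (simp add: T_def)
    have "subspace {z. b \<cdot> z \<in> T}"
      by (intro subspaceI) (auto simp: mult_linear sT subspace_0 subspace_add subspace_scale)
    moreover have "b \<cdot> (a \<cdot> x + x \<cdot> a) \<in> T" if "a \<in> A" "x \<in> I" for a x
    proof -
      have "b \<cdot> (a \<cdot> x + x \<cdot> a)
          = ((b \<cdot> a) \<cdot> x + x \<cdot> (b \<cdot> a)) + (a \<cdot> (b \<cdot> x) + (b \<cdot> x) \<cdot> a)"
        using left_leibniz[of b a x] left_leibniz[of b x a] by (simp add: mult_linear)
      also have "\<dots> \<in> T"
        using that b AA AI unfolding T_def by (intro span_add[of "_ + _"] span_base) blast+
      finally show ?thesis .
    qed
    ultimately have "T \<subseteq> {z. b \<cdot> z \<in> T}"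
      unfolding T_def using b AJ JT by (intro span_minimal) (auto simp flip: T_def)
    then show ?thesis using z by blast
  qed
  have T: "ideal_of A T"
    by (rule ideal_ofI) (use TI IA Tr Tl JT in \<open>auto simp: T_def[symmetric]\<close>, simp add: T_def)
  show ?thesis
  proof (cases "\<forall>i\<in>I. \<forall>a\<in>A. i \<cdot> a \<in> J")
    case True
    define P where "P = {f \<in> linear_maps. \<forall>y\<in>A. f y \<in> J}"
    have P: "H.stable A P"
      unfolding H.stable_def
    proof (intro conjI ballI)
      show "H.W.subspace P"
        using H.W.subspace_0[OF H.V(1)] H.W.subspace_add[OF H.V(1)] H.W.subspace_scale[OF H.V(1)]
        by (intro H.W.subspaceI) (auto simp: P_def fun_scale_def sJ subspace_0 subspace_add subspace_scale)
      show "fun_act x f \<in> P" if "x \<in> A" "f \<in> P" for x f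
        using that act_lin actJ[of x f] by (auto simp: P_def)
    qed (auto simp: P_def)
    have "\<exists>u\<in>U. \<forall>x\<in>A. fun_act x (\<pi> - u) \<in> P"
    proof (rule H.whitehead[OF A I perfect U P])
      show "P \<subseteq> U" using JI' IA' by (auto simp: P_def U_def)
      show "fun_act x u \<in> P" if "x \<in> I" "u \<in> U" for x u
        using that IU UD act_lin by (auto simp: P_def)
      \<comment> \<open>The case assumption enters: \<open>x \<cdot> y\<close> lies in
        \<open>J\<close>, and \<open>\<pi>\<close> fixes it.\<close>
      show "fun_act x \<pi> \<in> P" if "x \<in> I" for x
        using that \<pi> act_lin II' AI True
        by (auto simp: P_def fun_act_def intro!: subspace_diff[OF sJ])
    qed (use \<pi> \<pi>U in auto)
    then obtain u where u: "u \<in> U" "\<And>x. x \<in> A \<Longrightarrow> fun_act x (\<pi> - u) \<in> P" by blast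
    define f where "f = \<pi> - u"
    have f: "f \<in> linear_maps" "\<And>y. y \<in> A \<Longrightarrow> f y \<in> I" "\<And>i. i \<in> I \<Longrightarrow> f i - i \<in> J"
      using \<pi>_minus[OF u(1)] by (auto simp: f_def simp del: minus_apply)
    have fP: "x \<cdot> f y - f (x \<cdot> y) \<in> J" if "x \<in> A" "y \<in> A" for x y
      using u(2)[OF that(1)] that by (auto simp: P_def fun_act_def f_def)
    define S where "S = {x \<in> A. f x \<in> J}"
    have "subalgebra S"
      unfolding subalgebra_def
    proof (intro conjI ballI)
      show "subspace S"
        by (intro subspaceI)
          (auto simp: S_def linear_mapsD[OF f(1)] sA sJ subspace_0 subspace_add subspace_scale)
      fix x y assume xy: "x \<in> S" "y \<in> S"
      then have xy': "x \<in> A" "y \<in> A" "f y \<in> J" by (auto simp: S_def)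
      have "f (x \<cdot> y) \<in> J"
        using subspace_diff[OF sJ AJ(1)[OF xy'(1,3)] fP[OF xy'(1,2)]] by simp
      then show "x \<cdot> y \<in> S" using xy AA by (simp add: S_def)
    qed
    moreover have "S + I = A"
    proof
      show "S + I \<subseteq> A" using IA' by (auto simp: S_def set_plus_def intro!: subspace_add[OF sA])
      show "A \<subseteq> S + I"
      proof
        fix x assume x: "x \<in> A"
        \<comment> \<open>\<open>f x\<close> lies in \<open>I\<close>, where \<open>f\<close> is the
          identity modulo \<open>J\<close>; so \<open>f\<close> sends \<open>x - f x\<close> into
          \<open>J\<close>.\<close>
        have "f x - f (f x) \<in> J" using subspace_neg[OF sJ f(3)[OF f(2)[OF x]]] by simp
        then have "x - f x \<in> S"
          using f x IA' by (auto simp: S_def linear_mapsD[OF f(1)] intro!: subspace_diff[OF sA])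
        then have "(x - f x) + f x \<in> S + I" using f x by (intro set_plus_intro) auto
        then show "x \<in> S + I" by simp
      qed
    qed
    moreover have "S \<inter> I = J"
    proof -
      have "f i \<in> J \<longleftrightarrow> i \<in> J" if "i \<in> I" for i
        using f(3)[OF that] subspace_diff[OF sJ, of "f i" "f i - i"] subspace_add[OF sJ, of "f i - i" i]
        by auto
      then show ?thesis using JI' IA' by (auto simp: S_def)
    qed
    moreover have "S \<subseteq> A" by (auto simp: S_def)
    ultimately show ?thesis by blast
  next
    case False
    have skew: "a \<cdot> x + x \<cdot> a \<in> J" if "a \<in> A" "x \<in> I" for a x
    proof -
      have "T \<noteq> I" using False Tr by blast
      then have "T = J" using min[OF T JT TI] by blast
      moreover have "a \<cdot> x + x \<cdot> a \<in> T" unfolding T_def using that by (intro span_base) blast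
      ultimately show ?thesis by simp
    qed
    \<comment> \<open>Right multiplications by \<open>I\<close> are factored out because
      \<open>x\<close> in \<open>I\<close> does not kill \<open>\<pi>\<close>: modulo
      \<open>J\<close> it sends \<open>\<pi>\<close> to minus left multiplication by
      \<open>x\<close>, which by \<open>skew\<close> is right multiplication by
      \<open>x\<close>.\<close>
    define P where "P = {f \<in> linear_maps. \<exists>i\<in>I. \<forall>y\<in>A. f y - y \<cdot> i \<in> J}"
    have P: "H.stable A P"
      unfolding H.stable_def
    proof (intro conjI ballI)
      show "H.W.subspace P"
      proof (rule H.W.subspaceI)
        show "0 \<in> P" using H.W.subspace_0[OF H.V(1)] subspace_0[OF sI] subspace_0[OF sJ]
          by (auto simp: P_def mult_linear intro!: bexI[of _ 0])
      next
        fix f g assume "f \<in> P" "g \<in> P"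
        then obtain i j where ij: "i \<in> I" "j \<in> I" "f \<in> linear_maps" "g \<in> linear_maps"
          "\<And>y. y \<in> A \<Longrightarrow> f y - y \<cdot> i \<in> J" "\<And>y. y \<in> A \<Longrightarrow> g y - y \<cdot> j \<in> J"
          by (auto simp: P_def)
        have "(f + g) y - y \<cdot> (i + j) \<in> J" if "y \<in> A" for y
          using subspace_add[OF sJ ij(5)[OF that] ij(6)[OF that]] by (simp add: mult_linear algebra_simps)
        then show "f + g \<in> P"
          using ij H.W.subspace_add[OF H.V(1)] subspace_add[OF sI] by (auto simp: P_def simp del: plus_fun_apply intro!: bexI[of _ "i + j"])
      next
        fix c f assume "f \<in> P"
        then obtain i where i: "i \<in> I" "f \<in> linear_maps" "\<And>y. y \<in> A \<Longrightarrow> f y - y \<cdot> i \<in> J"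
          by (auto simp: P_def)
        have "fun_scale c f y - y \<cdot> (c *s i) \<in> J" if "y \<in> A" for y
          using subspace_scale[OF sJ i(3)[OF that], of c]
          by (simp add: mult_linear fun_scale_def scale_right_diff_distrib)
        then show "fun_scale c f \<in> P"
          using i H.W.subspace_scale[OF H.V(1)] subspace_scale[OF sI]
          by (auto simp: P_def intro!: bexI[of _ "c *s i"])
      qed
      show "fun_act x f \<in> P" if x: "x \<in> A" and "f \<in> P" for x f
      proof -
        obtain i where i: "i \<in> I" "f \<in> linear_maps" "\<And>y. y \<in> A \<Longrightarrow> f y - y \<cdot> i \<in> J"
          using \<open>f \<in> P\<close> by (auto simp: P_def)
        have "fun_act x f y - y \<cdot> (x \<cdot> i) \<in> J" if y: "y \<in> A" for y
        proof -
          have "x \<cdot> (f y - y \<cdot> i) - (f (x \<cdot> y) - (x \<cdot> y) \<cdot> i) \<in> J"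
            by (rule subspace_diff[OF sJ AJ(1)[OF x i(3)[OF y]] i(3)[OF AA[OF x y]]])
          moreover have "x \<cdot> (f y - y \<cdot> i) - (f (x \<cdot> y) - (x \<cdot> y) \<cdot> i) = fun_act x f y - y \<cdot> (x \<cdot> i)"
            using left_leibniz[of x y i] by (simp add: fun_act_def mult_linear)
          ultimately show ?thesis by simp
        qed
        then show ?thesis using i x AI act_lin by (auto simp: P_def intro!: bexI[of _ "x \<cdot> i"])
      qed
    qed (auto simp: P_def)
    have "\<exists>u\<in>U. \<forall>x\<in>A. fun_act x (\<pi> - u) \<in> P"
    proof (rule H.whitehead[OF A I perfect U P])
      show "P \<subseteq> U"
      proof
        fix f assume "f \<in> P"
        then obtain i where i: "i \<in> I" "f \<in> linear_maps" "\<And>y. y \<in> A \<Longrightarrow> f y - y \<cdot> i \<in> J"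
          by (auto simp: P_def)
        have "f y - y \<cdot> i + y \<cdot> i \<in> I" if "y \<in> A" for y
          using i that AI JI' by (intro subspace_add[OF sI]) auto
        moreover have "f y - y \<cdot> i + y \<cdot> i \<in> J" if "y \<in> I" for y
          using i that II' IA' by (intro subspace_add[OF sJ]) auto
        ultimately show "f \<in> U" using i by (auto simp: U_def)
      qed
      show "fun_act x u \<in> P" if "x \<in> I" "u \<in> U" for x u
        using that IU UD act_lin subspace_0[OF sI]
        by (auto simp: P_def mult_linear intro!: bexI[of _ 0])
      show "fun_act x \<pi> \<in> P" if x: "x \<in> I" for x
      proof -
        have "fun_act x \<pi> y - y \<cdot> x \<in> J" if y: "y \<in> A" for y
        proof -
          have "x \<cdot> \<pi> y - (y \<cdot> x + x \<cdot> y) \<in> J"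
            using x y II' \<pi> skew by (intro subspace_diff[OF sJ]) auto
          then show ?thesis using x y AI \<pi> by (simp add: fun_act_def algebra_simps)
        qed
        then show ?thesis using x \<pi> act_lin by (auto simp: P_def)
      qed
    qed (use \<pi> \<pi>U in auto)
    then obtain u where u: "u \<in> U" "\<And>x. x \<in> A \<Longrightarrow> fun_act x (\<pi> - u) \<in> P" by blast
    define f where "f = \<pi> - u"
    have f: "f \<in> linear_maps" "\<And>y. y \<in> A \<Longrightarrow> f y \<in> I" "\<And>i. i \<in> I \<Longrightarrow> f i - i \<in> J"
      using \<pi>_minus[OF u(1)] by (auto simp: f_def simp del: minus_apply)
    have fP: "\<exists>i\<in>I. \<forall>y\<in>A. fun_act x f y - y \<cdot> i \<in> J" if "x \<in> A" for x
      using u(2)[OF that] by (auto simp: P_def f_def)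
    define S where "S = {x \<in> A. \<forall>y\<in>A. fun_act x f y \<in> J}"
    have "subalgebra S"
      unfolding subalgebra_def
    proof (intro conjI ballI)
      show "subspace S"
      proof (intro subspaceI)
        show "0 \<in> S" using subspace_0[OF sA] subspace_0[OF sJ] by (simp add: S_def H.zero_act f)
        show "x + y \<in> S" if "x \<in> S" "y \<in> S" for x y
          using that subspace_add[OF sA] subspace_add[OF sJ] by (auto simp: S_def H.add_act f)
        show "c *s x \<in> S" if "x \<in> S" for c x
          using that subspace_scale[OF sA] subspace_scale[OF sJ]
          by (auto simp: S_def H.scale_act f fun_scale_def)
      qed
      fix x y assume xy: "x \<in> S" "y \<in> S"
      have "fun_act (x \<cdot> y) f z \<in> J" if z: "z \<in> A" for z
        unfolding H.mult_act[OF f(1)] minus_apply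
        using xy z actJ[of x "fun_act y f"] actJ[of y "fun_act x f"]
        by (intro subspace_diff[OF sJ]) (auto simp: S_def)
      then show "x \<cdot> y \<in> S" using xy AA by (simp add: S_def)
    qed
    moreover have "S + I = A"
    proof
      show "S + I \<subseteq> A" using IA' by (auto simp: S_def set_plus_def intro!: subspace_add[OF sA])
      show "A \<subseteq> S + I"
      proof
        fix x assume x: "x \<in> A"
        \<comment> \<open>If \<open>x\<close> sends \<open>f\<close> to right multiplication by
          \<open>i\<close>, then so does \<open>i\<close>, as \<open>f\<close> is the identity on
          \<open>I\<close> modulo \<open>J\<close>; hence \<open>x - i\<close> stabilises
          \<open>f\<close>.\<close>
        obtain i where i: "i \<in> I" "\<And>y. y \<in> A \<Longrightarrow> fun_act x f y - y \<cdot> i \<in> J" using fP[OF x] by blast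
        have "fun_act (x - i) f y \<in> J" if y: "y \<in> A" for y
        proof -
          have "fun_act x f y - y \<cdot> i + (y \<cdot> i + i \<cdot> y - i \<cdot> f y) + (f (i \<cdot> y) - i \<cdot> y) \<in> J"
            by (rule subspace_add[OF sJ subspace_add[OF sJ i(2)[OF y]
                  subspace_diff[OF sJ skew[OF y i(1)] II'[OF i(1) f(2)[OF y]]]] f(3)[OF AI(2)[OF y i(1)]]])
          then show ?thesis by (simp add: fun_act_def mult_linear linear_mapsD[OF f(1)] algebra_simps)
        qed
        then have "x - i \<in> S" using x i IA' by (auto simp: S_def intro!: subspace_diff[OF sA])
        then have "(x - i) + i \<in> S + I" using i by (intro set_plus_intro) auto
        then show "x \<in> S + I" by simp
      qed
    qed
    moreover have "S \<inter> I = J"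
    proof
      \<comment> \<open>The part of \<open>I\<close> that \<open>A\<close> annihilates on both sides
        modulo \<open>J\<close>; an ideal different from \<open>I\<close>, hence \<open>J\<close>.
        For \<open>i\<close> in \<open>S\<close> and \<open>I\<close>, stability gives
        \<open>f (i \<cdot> y) \<in> J\<close>, so \<open>i \<cdot> y \<in> J\<close>, and
        \<open>skew\<close> gives \<open>y \<cdot> i \<in> J\<close>.\<close>
      define Z where "Z = {i \<in> I. \<forall>y\<in>A. y \<cdot> i \<in> J \<and> i \<cdot> y \<in> J}"
      have "ideal_of A Z"
      proof (rule ideal_ofI)
        show "subspace Z"
          by (intro subspaceI)
            (auto simp: Z_def mult_linear sI sJ subspace_0 subspace_add subspace_scale)
        show "a \<cdot> x \<in> Z" "x \<cdot> a \<in> Z" if "a \<in> A" "x \<in> Z" for a x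
          using that AI AJ JI' by (auto simp: Z_def)
      qed (use IA' in \<open>auto simp: Z_def\<close>)
      moreover have "J \<subseteq> Z" using AJ JI' by (auto simp: Z_def)
      moreover have "Z \<subseteq> I" by (auto simp: Z_def)
      moreover have "Z \<noteq> I" using False by (auto simp: Z_def)
      ultimately have ZJ: "Z = J" using min by blast
      show "S \<inter> I \<subseteq> J"
      proof
        fix i assume i: "i \<in> S \<inter> I"
        have "y \<cdot> i \<in> J \<and> i \<cdot> y \<in> J" if y: "y \<in> A" for y
        proof -
          have i': "i \<in> I" "fun_act i f y \<in> J" using i y by (auto simp: S_def)
          have iy: "i \<cdot> y \<in> J"
            using subspace_diff[OF sJ subspace_diff[OF sJ II'[OF i'(1) f(2)[OF y]] i'(2)] f(3)[OF AI(2)[OF y i'(1)]]]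
            by (simp add: fun_act_def)
          show ?thesis using subspace_diff[OF sJ skew[OF y i'(1)] iy] iy by simp
        qed
        then have "i \<in> Z" using i by (auto simp: Z_def)
        then show "i \<in> J" using ZJ by simp
      qed
      show "J \<subseteq> S \<inter> I"
      proof
        fix j assume j: "j \<in> J"
        have "fun_act j f y \<in> J" if y: "y \<in> A" for y
        proof -
          have "f (j \<cdot> y) - j \<cdot> y + j \<cdot> y \<in> J"
            using j y f AJ JI' by (intro subspace_add[OF sJ]) auto
          then show ?thesis
            using j y f AJ IA' by (auto simp: fun_act_def intro!: subspace_diff[OF sJ])
        qed
        then show "j \<in> S \<inter> I" using j JI' JA by (auto simp: S_def)
      qed
    qed
    moreover have "S \<subseteq> A" by (auto simp: S_def)
    ultimately show ?thesis by blast
  qed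
qed

section \<open>Induction along a chain of ideals\<close>

lemma prod_space_eq_self_soluble:
  assumes "subspace K" "prod_space K K = K" "derived_series K n = {0}"
  shows "K = {0}"
proof -
  have "derived_series K n = K" for n by (induction n) (simp_all add: assms)
  then show ?thesis using assms by simp
qed

text \<open>With \<open>J\<close> maximal among the ideals properly below \<open>I\<close> that
  contain \<open>prod_space I I\<close>, the quotient I / J is abelian and minimal.
  \<open>levi_minimal\<close> gives \<open>S1\<close> with S1 / J isomorphic to A / I, and the
  induction goes on with \<open>S1\<close> and \<open>J\<close>.\<close>

lemma levi_perfect:
  assumes "subalgebra A" "ideal_of A I" "soluble I"
    and "\<And>K. ideal_of A K \<Longrightarrow> I \<subseteq> K \<Longrightarrow> perfect_over I K"
  shows "\<exists>S. subalgebra S \<and> S + I = A \<and> S \<inter> I = {0} \<and> (\<forall>K. ideal_of S K \<longrightarrow> perfect_over {0} K)"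
  using assms
proof (induction "dim I" arbitrary: A I rule: less_induct)
  case less
  note A = less.prems(1) and I = less.prems(2)
  note sA = subalgebraD(1)[OF A] and sI = ideal_ofD(1)[OF I]
  show ?case
  proof (cases "I = {0}")
    case True
    have "perfect_over {0} K" if "ideal_of A K" for K
      using less.prems(4)[OF that] True subspace_0[OF ideal_ofD(1)[OF that]] by simp
    then show ?thesis using A True subspace_0[OF sA] by (intro exI[of _ A]) (auto simp: set_plus_def)
  next
    case False
    let ?Q = "\<lambda>J. ideal_of A J \<and> prod_space I I \<subseteq> J \<and> J \<subset> I"
    have "prod_space I I \<noteq> I"
      using False prod_space_eq_self_soluble[OF sI] less.prems(3) by (auto simp: soluble_def)
    then have Q: "?Q (prod_space I I)"
      using ideal_of_prod_space[OF I] prod_space_ideal_subset[OF I] by auto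
    have "\<exists>J. ?Q J \<and> (\<forall>T. ?Q T \<longrightarrow> J \<subseteq> T \<longrightarrow> T = J)"
      by (rule maximal_subspace[of ?Q "prod_space I I", OF Q _ finite_Basis])
        (use subset_span_Basis in \<open>auto simp: ideal_of_def\<close>)
    then obtain J where J: "?Q J" and max: "\<forall>T. ?Q T \<longrightarrow> J \<subseteq> T \<longrightarrow> T = J"
      by (rule exE) (erule conjE, rule that)
    have JA: "ideal_of A J" and JI: "J \<subset> I" using J by auto
    have "\<exists>S. subalgebra S \<and> S \<subseteq> A \<and> S + I = A \<and> S \<inter> I = J"
    proof (rule levi_minimal[OF A I JA JI _ _ less.prems(4)])
      show "T = J \<or> T = I" if "ideal_of A T" "J \<subseteq> T" "T \<subseteq> I" for T
        using max[rule_format, of T] that J by blast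
    qed (use J in auto)
    then obtain S1 where S1: "subalgebra S1" "S1 \<subseteq> A" "S1 + I = A" "S1 \<inter> I = J" by blast
    have JS: "ideal_of S1 J" using JA S1 by (auto simp: ideal_of_def)
    have "soluble J"
    proof -
      obtain n where "derived_series I n = {0}" using less.prems(3) by (auto simp: soluble_def)
      then have "derived_series J n \<subseteq> {0}" using derived_series_mono[of J I n] JI by auto
      then have "derived_series J n = {0}"
        using subspace_0[OF subspace_derived_series[OF ideal_ofD(1)[OF JA], of n]] by auto
      then show ?thesis by (auto simp: soluble_def)
    qed
    moreover have "perfect_over J K" if K: "ideal_of S1 K" and JK: "J \<subseteq> K" for K
    proof -
      have decomp: "\<exists>b\<in>S1. a - b \<in> I" if "a \<in> A" for a
        using that S1(3) by (auto simp: set_plus_def) (metis add_diff_cancel_left')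
      \<comment> \<open>Ideals of \<open>S1\<close> above \<open>J\<close> are lifted to ideals of
        \<open>A\<close> above \<open>I\<close>, where perfectness is known.\<close>
      have "ideal_of A (K + I)"
        using ideal_of_plus[OF I K decomp ideal_ofD(2)[OF I] S1(2) _ _ sA] ideal_ofD(2)[OF K] S1(2) by auto
      moreover have sub: "K \<subseteq> K + I" "I \<subseteq> K + I"
        using Un_subset_plus[OF ideal_ofD(1)[OF K] sI] by auto
      ultimately have perf: "perfect_over I (K + I)" by (intro less.prems(4))
      have prodKI: "prod_space (K + I) (K + I) \<subseteq> prod_space K K + I"
      proof (rule prod_space_subset)
        show "subspace (prod_space K K + I)" by (intro subspace_plus subspace_prod_space sI)
        fix x y assume "x \<in> K + I" "y \<in> K + I"
        then obtain k i l j where k: "x = k + i" "y = l + j" "k \<in> K" "l \<in> K" "i \<in> I" "j \<in> I"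
          by (auto elim!: set_plus_elim)
        have inA: "k \<in> A" "l \<in> A" "i \<in> A" using k ideal_ofD(2)[OF K] S1(2) ideal_ofD(2)[OF I] by auto
        have "k \<cdot> j + i \<cdot> l + i \<cdot> j \<in> I"
          using k inA ideal_ofD[OF I] by (intro subspace_add[OF sI]) auto
        moreover have "x \<cdot> y = k \<cdot> l + (k \<cdot> j + i \<cdot> l + i \<cdot> j)" by (simp add: k mult_linear)
        ultimately show "x \<cdot> y \<in> prod_space K K + I"
          using k by (auto intro!: set_plus_intro prod_space_mem)
      qed
      show ?thesis
        unfolding perfect_over_def
      proof
        fix x assume x: "x \<in> K"
        then obtain y where y: "y \<in> prod_space (K + I) (K + I)" "x - y \<in> I"
          using perf sub unfolding perfect_over_def by blast
        then obtain z i where z: "y = z + i" "z \<in> prod_space K K" "i \<in> I"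
          using prodKI by (blast elim: set_plus_elim)
        have "x - y + i \<in> I" using y z by (intro subspace_add[OF sI]) auto
        then have "x - z \<in> I" by (simp add: z)
        \<comment> \<open>The error lies in \<open>I\<close> and in \<open>S1\<close>, hence in
          \<open>J\<close>.\<close>
        moreover have "x - z \<in> S1"
          using x z prod_space_ideal_subset[OF K] ideal_ofD(2)[OF K] subalgebraD(1)[OF S1(1)]
          by (intro subspace_diff) auto
        ultimately show "\<exists>y\<in>prod_space K K. x - y \<in> J" using z S1(4) by blast
      qed
    qed
    moreover have "dim J < dim I"
      using dim_psubset_in_finite_span[OF ideal_ofD(1)[OF JA] JI subset_span_Basis finite_Basis] .
    ultimately obtain S where S: "subalgebra S" "S + J = S1" "S \<inter> J = {0}"
      "\<And>K. ideal_of S K \<Longrightarrow> perfect_over {0} K"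
      using less.hyps[of J S1] S1(1) JS by blast
    have JJ: "J + I = I"
      using JI subspace_0[OF ideal_ofD(1)[OF JA]] by (auto simp: set_plus_def intro: subspace_add[OF sI]) force
    have "S + I = A" using S1(3) unfolding S(2)[symmetric] by (simp add: add.assoc JJ)
    moreover have "S \<inter> I = {0}"
    proof -
      have "S \<subseteq> S1"
        using S(2) Un_subset_plus[OF subalgebraD(1)[OF S(1)] ideal_ofD(1)[OF JA]] by auto
      then show ?thesis using S1(4) S(3) by blast
    qed
    ultimately show ?thesis using S by blast
  qed
qed

theorem levi_decomposition:
  "\<exists>S. subalgebra S \<and> semi_simple S \<and> S + soluble_radical UNIV = UNIV \<and> S \<inter> soluble_radical UNIV = {0}"
proof -
  let ?R = "soluble_radical UNIV"
  have UN: "subalgebra UNIV" by (simp add: subalgebra_def)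
  note rad = soluble_radical_greatest[OF finite_dimensional_vector_space_axioms]
  have R: "ideal_of UNIV ?R" "soluble ?R" and max: "\<And>I. ideal_of UNIV I \<Longrightarrow> soluble I \<Longrightarrow> I \<subseteq> ?R"
    using rad[OF UN] by auto
  \<comment> \<open>Derived series concatenate, so an ideal soluble modulo the radical is soluble
    and lies in the radical.\<close>
  have ss: "T \<subseteq> ?R" if T: "ideal_of UNIV T" and k: "derived_series T k \<subseteq> ?R" for T k
  proof (rule max[OF T])
    obtain m where "derived_series ?R m = {0}" using R(2) by (auto simp: soluble_def)
    then have "derived_series T (k + m) \<subseteq> {0}"
      unfolding derived_series_add using derived_series_mono[OF k, of m] by simp
    then have "derived_series T (k + m) = {0}"
      using subspace_0[OF subspace_derived_series[OF ideal_ofD(1)[OF T], of "k + m"]] by auto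
    then show "soluble T" by (auto simp: soluble_def)
  qed
  have perfect: "perfect_over ?R K" if "ideal_of UNIV K" "?R \<subseteq> K" for K
    by (rule semisimple_quotient_perfect[OF R(1) ss that])
  obtain S where S: "subalgebra S" "S + ?R = UNIV" "S \<inter> ?R = {0}"
    "\<And>K. ideal_of S K \<Longrightarrow> perfect_over {0} K"
    using levi_perfect[OF UN R perfect] by blast
  \<comment> \<open>As an ideal of \<open>S\<close> it is perfect, and it is also soluble.\<close>
  have "soluble_radical S = {0}"
  proof -
    note K = rad(1,2)[OF S(1)]
    have "soluble_radical S \<subseteq> prod_space (soluble_radical S) (soluble_radical S)"
      using S(4)[OF K(1)] by (auto simp: perfect_over_def)
    then have "prod_space (soluble_radical S) (soluble_radical S) = soluble_radical S"
      using prod_space_ideal_subset[OF K(1)] by auto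
    then show ?thesis
      using prod_space_eq_self_soluble[OF ideal_ofD(1)[OF K(1)]] K(2) by (auto simp: soluble_def)
  qed
  then show ?thesis using S by (auto simp: semi_simple_def)
qed

end

theorem theorem1:
  fixes scale :: "'a::field_char_0 \<Rightarrow> 'b::ab_group_add \<Rightarrow> 'b"
    and mult :: "'b \<Rightarrow> 'b \<Rightarrow> 'b"
    and Basis R :: "'b set"
  assumes "left_leibniz_algebra scale mult"
    and "finite_dimensional_vector_space scale Basis"
    and "R = left_leibniz_algebra.soluble_radical scale mult UNIV"
  shows "\<exists>S. left_leibniz_algebra.subalgebra scale mult S \<and>
    left_leibniz_algebra.semi_simple scale mult S \<and>
    S + R = UNIV \<and> S \<inter> R = {0}"
proof -
  interpret fd_leibniz_algebra scale mult Basis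
    using assms by (intro fd_leibniz_algebra.intro)
  show ?thesis unfolding assms(3) by (rule levi_decomposition)
qed

end
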